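(* Let $\mathfrak{p}\subset V$ be an $n$-dimensional polytope, $\xi\in V^*_{\mathbb{C}}$, and $\mathfrak{g}$ a $k$-dimensional $\xi$-constant face. Then the meromorphic function $\alpha\mapsto I({}^0\mathrm{LC}^{\mathfrak{p}}_{\mathfrak{g}}(\xi);\alpha)$, $\alpha\in(\mathrm{lin}(\mathfrak{g})^\perp)^*_{\mathbb{C}}$, is holomorphic at $\alpha=\xi$ (restricted to $\mathrm{lin}(\mathfrak{g})^\perp$), and its value there equals $${}^0\mathrm{DBI}^{\mathfrak{p}}_{\mathfrak{g}}(\xi):=\sum_{(\mathfrak{h}_k\subset\cdots\subset\mathfrak{h}_n)\in\mathrm{sFl}^{\mathfrak{p}}_{\mathfrak{g}}(\xi)}\ \prod_{j=k+1}^{n}\frac{\langle\xi,\eta^{\mathfrak{h}_j}_{\mathfrak{h}_{j-1}}\rangle_H}{\|\xi^{\mathfrak{h}_j}\|^2}.$$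
   Context: $V$ is a real $n$-dimensional inner product space identified with $V^*$; the pairing is extended bilinearly to $V^*_{\mathbb{C}}$, with Hermitian form $\langle\alpha,\beta\rangle_H:=\langle\bar\alpha,\beta\rangle$ and $\|\alpha\|^2:=\langle\alpha,\alpha\rangle_H$. For a face $\mathfrak{h}$, $\mathrm{lin}(\mathfrak{h})$ is the linear subspace parallel to its affine hull and $\xi^{\mathfrak{h}}$ is the restriction of $\xi$ to $\mathrm{lin}(\mathfrak{h})$ (with the induced inner product). If $\mathfrak{h}'$ is a facet of a face $\mathfrak{h}$, $\eta^{\mathfrak{h}}_{\mathfrak{h}'}\in\mathrm{lin}(\mathfrak{h})$ is the outward unit normal of $\mathfrak{h}'$ in $\mathfrak{h}$. A face is $\xi$-constant if $\langle\xi,\cdot\rangle$ is constant on it. $\mathrm{sFl}^{\mathfrak{p}}_{\mathfrak{g}}(\xi)$ is the set of saturated flags $\mathfrak{g}=\mathfrak{h}_k\subset\mathfrak{h}_{k+1}\subset\cdots\subset\mathfrak{h}_n=\mathfrak{p}$ with $\dim\mathfrak{h}_j=j$ such that no $\mathfrak{h}_j$ with $j>k$ is $\xi$-constant (if $\mathfrak{g}=\mathfrak{p}$ the only flag is $\mathfrak{p}$ and the empty product is $1$). For faces/polyhedra: $P_W$ orthogonal projection; transverse cone $\mathfrak{t}^{\mathfrak{q}}_{\mathfrak{f}}:=P_{\mathrm{lin}(\mathfrak{f})^\perp}(\{x+w:x+\varepsilon w\in\mathfrak{q}\text{ for small }\varepsilon>0\})$, $x$ in the relative interior of $\mathfrak{f}$;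 ${}^0\mathfrak{k}$ is the translate of a cone to have vertex $0$. $I(\mathfrak{q};\alpha)$ is the meromorphic continuation of $\int_{\mathfrak{q}}e^{\langle\alpha,x\rangle}dx$ (Lebesgue measure from the inner product of the ambient subspace) from its region of absolute convergence, set to $0$ if $\mathfrak{q}$ contains a line, and extended linearly to virtual polyhedra. ${}^0\mathrm{LC}^{\mathfrak{p}}_{\mathfrak{g}}(\xi):=\sum(-1)^\ell[{}^0\mathfrak{t}^{\mathfrak{h}_1}_{\mathfrak{g}}\times\cdots\times{}^0\mathfrak{t}^{\mathfrak{h}_\ell}_{\mathfrak{h}_{\ell-1}}\times{}^0\mathfrak{t}^{\mathfrak{p}}_{\mathfrak{h}_\ell}]$ over all chains $\mathfrak{g}=\mathfrak{h}_0\subsetneq\cdots\subsetneq\mathfrak{h}_\ell$ ($\ell\ge0$) of $\xi$-constant faces, a virtual cone in $\mathrm{lin}(\mathfrak{g})^\perp$ (product in the orthogonal decomposition $\mathrm{lin}(\mathfrak{g})^\perp=\bigoplus_j(\mathrm{lin}(\mathfrak{h}_j)^\perp\cap\mathrm{lin}(\mathfrak{h}_{j+1}))\oplus\mathrm{lin}(\mathfrak{h}_\ell)^\perp$). *)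

theory Defs
  imports "HOL-Analysis.Analysis"
begin

text \<open>Conventions. V is a euclidean_space 'a (n = DIM('a)), identified with its dual via the
inner product. A complexified (co)vector xi in V*_C is represented by the pair (Re xi, Im xi).\<close>

definition cpair :: "'a::euclidean_space \<times> 'a \<Rightarrow> 'a \<Rightarrow> complex" where
  "cpair \<alpha> x = Complex (fst \<alpha> \<bullet> x) (snd \<alpha> \<bullet> x)"

definition hpair :: "'a::euclidean_space \<times> 'a \<Rightarrow> 'a \<Rightarrow> complex" where
  "hpair \<alpha> v = Complex (fst \<alpha> \<bullet> v) (- (snd \<alpha> \<bullet> v))"

definition lin :: "'a::euclidean_space set \<Rightarrow> 'a set" where
  "lin S = span {x - y | x y. x \<in> S \<and> y \<in> S}"

definition ocomp :: "'a::euclidean_space set \<Rightarrow> 'a set" where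
  "ocomp S = {v. \<forall>u\<in>S. u \<bullet> v = 0}"

definition proj :: "'a::euclidean_space set \<Rightarrow> 'a \<Rightarrow> 'a" where
  "proj S x = closest_point S x"

definition xi_const :: "'a::euclidean_space \<times> 'a \<Rightarrow> 'a set \<Rightarrow> bool" where
  "xi_const \<xi> h \<longleftrightarrow> (\<forall>x\<in>h. \<forall>y\<in>h. cpair \<xi> x = cpair \<xi> y)"

definition onb :: "'a::euclidean_space set \<Rightarrow> nat \<Rightarrow> 'a" where
  "onb W = (SOME b. (\<forall>i<dim W. b i \<in> W) \<and>
                    (\<forall>i<dim W. \<forall>j<dim W. b i \<bullet> b j = (if i = j then 1 else 0)))"

definition lebW :: "'a::euclidean_space set \<Rightarrow> 'a measure" where
  "lebW W = distr (PiM {..<dim W} (\<lambda>_. lborel)) borel (\<lambda>t. \<Sum>i<dim W. t i *\<^sub>R onb W i)"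

definition cplx :: "'a::euclidean_space set \<Rightarrow> ('a \<times> 'a) set" where
  "cplx W = W \<times> W"

definition Jmul :: "'a::euclidean_space \<times> 'a \<Rightarrow> 'a \<times> 'a" where
  "Jmul v = (- snd v, fst v)"

definition holo_on :: "('a::euclidean_space \<times> 'a) set \<Rightarrow> ('a \<times> 'a \<Rightarrow> complex) \<Rightarrow> bool" where
  "holo_on U G \<longleftrightarrow> (\<forall>z\<in>U. \<exists>L. (G has_derivative L) (at z within U) \<and> (\<forall>v. L (Jmul v) = \<i> * L v))"

definition contains_line :: "'a::euclidean_space set \<Rightarrow> bool" where
  "contains_line q \<longleftrightarrow> (\<exists>x v. v \<noteq> 0 \<and> (\<forall>t::real. x + t *\<^sub>R v \<in> q))"

definition conv_region :: "'a::euclidean_space set \<Rightarrow> 'a set \<Rightarrow> ('a \<times> 'a) set" where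
  "conv_region W q = {\<alpha> \<in> cplx W. integrable (lebW W) (\<lambda>x. indicator q x *\<^sub>R exp (cpair \<alpha> x))}"

definition cone_int :: "'a::euclidean_space set \<Rightarrow> 'a set \<Rightarrow> 'a \<times> 'a \<Rightarrow> complex" where
  "cone_int W q \<alpha> = (LINT x|lebW W. indicator q x *\<^sub>R exp (cpair \<alpha> x))"

text \<open>F (with polar set Z) is the meromorphic continuation of alpha |-> I(q; alpha) on W_C
from the region of absolute convergence; I(q;.) = 0 if q contains a line.\<close>
definition is_mero_cont ::
  "'a::euclidean_space set \<Rightarrow> 'a set \<Rightarrow> ('a \<times> 'a \<Rightarrow> complex) \<Rightarrow> ('a \<times> 'a) set \<Rightarrow> bool" where
  "is_mero_cont W q F Z \<longleftrightarrow>
    (if contains_line q then Z = {} \<and> (\<forall>\<alpha>. F \<alpha> = 0)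
     else Z \<subseteq> cplx W \<and> closedin (top_of_set (cplx W)) Z \<and>
       (\<forall>U. openin (top_of_set (cplx W)) U \<and> U \<subseteq> Z \<longrightarrow> U = {}) \<and>
       (\<forall>z\<in>cplx W. \<exists>U g h. openin (top_of_set (cplx W)) U \<and> z \<in> U \<and>
            holo_on U g \<and> holo_on U h \<and> (\<forall>\<alpha>\<in>U - Z. h \<alpha> \<noteq> 0 \<and> F \<alpha> = g \<alpha> / h \<alpha>)) \<and>
       (\<forall>\<alpha>\<in>conv_region W q - Z. F \<alpha> = cone_int W q \<alpha>))"

definition tcone :: "'a::euclidean_space set \<Rightarrow> 'a set \<Rightarrow> 'a set" where
  "tcone q f = (let x = (SOME x. x \<in> rel_interior f) in
     proj (ocomp (lin f)) ` {x + w | w. \<exists>e>0. \<forall>d. 0 < d \<and> d \<le> e \<longrightarrow> x + d *\<^sub>R w \<in> q})"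

definition tcone0 :: "'a::euclidean_space set \<Rightarrow> 'a set \<Rightarrow> 'a set" where
  "tcone0 q f = (let x = (SOME x. x \<in> rel_interior f) in
     (\<lambda>y. y - proj (ocomp (lin f)) x) ` tcone q f)"

text \<open>Product of cones lying in mutually orthogonal subspaces = Minkowski sum.\<close>
definition msum :: "'a::euclidean_space set list \<Rightarrow> 'a set" where
  "msum Ks = foldr (\<lambda>K A. {a + b | a b. a \<in> K \<and> b \<in> A}) Ks {0}"

definition LC_chains :: "'a::euclidean_space set \<Rightarrow> 'a set \<Rightarrow> 'a \<times> 'a \<Rightarrow> 'a set list set" where
  "LC_chains p g \<xi> = {hs. hs \<noteq> [] \<and> hd hs = g \<and> sorted_wrt (\<subset>) hs \<and>
      (\<forall>h\<in>set hs. h face_of p \<and> xi_const \<xi> h)}"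

definition LC_cone :: "'a::euclidean_space set \<Rightarrow> 'a set list \<Rightarrow> 'a set" where
  "LC_cone p hs = msum (map (\<lambda>(a, b). tcone0 b a) (zip hs (tl hs @ [p])))"

definition onormal :: "'a::euclidean_space set \<Rightarrow> 'a set \<Rightarrow> 'a" where
  "onormal h h' = (SOME \<eta>. \<eta> \<in> lin h \<and> norm \<eta> = 1 \<and> (\<forall>u\<in>lin h'. u \<bullet> \<eta> = 0) \<and>
                          (\<forall>y\<in>h. \<forall>x\<in>h'. (y - x) \<bullet> \<eta> \<le> 0))"

definition restr_normsq :: "'a::euclidean_space \<times> 'a \<Rightarrow> 'a set \<Rightarrow> real" where
  "restr_normsq \<xi> h = (norm (proj (lin h) (fst \<xi>)))\<^sup>2 + (norm (proj (lin h) (snd \<xi>)))\<^sup>2"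

definition sFl :: "'a::euclidean_space set \<Rightarrow> 'a set \<Rightarrow> 'a \<times> 'a \<Rightarrow> 'a set list set" where
  "sFl p g \<xi> = {hs. hs \<noteq> [] \<and> hd hs = g \<and> last hs = p \<and>
      (\<forall>i<length hs. hs ! i face_of p \<and> aff_dim (hs ! i) = aff_dim g + int i) \<and>
      (\<forall>i. Suc i < length hs \<longrightarrow> hs ! i \<subseteq> hs ! Suc i) \<and>
      (\<forall>i. 0 < i \<and> i < length hs \<longrightarrow> \<not> xi_const \<xi> (hs ! i))}"

definition DBI0 :: "'a::euclidean_space set \<Rightarrow> 'a set \<Rightarrow> 'a \<times> 'a \<Rightarrow> complex" where
  "DBI0 p g \<xi> = (\<Sum>hs\<in>sFl p g \<xi>. \<Prod>j\<in>{1..<length hs}.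
       hpair \<xi> (onormal (hs ! j) (hs ! (j - 1))) / complex_of_real (restr_normsq \<xi> (hs ! j)))"

end

theory Submission
  imports Defs "HOL-Probability.Distributions" "HOL-Complex_Analysis.Conformal_Mappings"
begin

text \<open>
  Write \<open>I(f,q)\<close> for the meromorphic continuation of the exponential integral over the transverse
  cone of \<open>q\<close> along \<open>f\<close>. Sweeping that cone out from its facets in a fixed interior direction gives
  Stokes' formula \<open>\<langle>\<alpha>,v\<rangle> I(f,q) = \<Sum>\<^sub>q\<^sub>' \<langle>v,\<eta>\<rangle> I(f,q')\<close>, the sum being over the facets \<open>q'\<close> of \<open>q\<close> that
  contain \<open>f\<close>; it is linear in \<open>v\<close>, and by the identity theorem it holds for generic \<open>\<alpha>\<close>.
  If \<open>q\<close> is not \<open>\<xi>\<close>-constant, take for \<open>v\<close> the projection of the conjugate of \<open>\<xi>\<close> to \<open>lin q\<close>. It is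
  orthogonal to every \<open>\<xi>\<close>-constant face of \<open>q\<close>, so one and the same \<open>v\<close> can be used in the last factor
  of all chains, and the alternating sum \<open>S(q)\<close> over the chains in \<open>q\<close> satisfies
  \<open>\<langle>\<alpha>,v\<rangle> S(q) = \<Sum>\<^sub>q\<^sub>' \<langle>\<xi>,\<eta>\<rangle>\<^sub>H S(q')\<close>. Moreover \<open>S(g) = 1\<close>, and \<open>S(q) = 0\<close> for all other \<open>\<xi>\<close>-constant \<open>q\<close>.
  This is the recursion of the sum over flags with denominators \<open>\<langle>\<alpha>,v\<rangle>\<close>, which do not vanish
  at \<open>\<alpha> = \<xi>\<close>.
\<close>

section \<open>Lebesgue measure on subspaces\<close>

text \<open>The single terms of the alternating sum may have poles at \<open>\<xi>\<close>; only
  their combination is regular there. No limit at \<open>\<xi>\<close> is taken: identities are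
  proved on a dense open set of \<open>\<alpha>\<close>, and the flag sum with denominators
  \<open>conj_pair\<close> serves as the holomorphic extension. Generic statements are used because
  each cone has a convergence region of its own and because a given continuation is constrained only
  off its polar set; continuity carries the final identity to every point off the polar sets. On the
  measure side, \<open>lebW\<close> is built from an arbitrarily chosen orthonormal basis, and the
  bases chosen for different subspaces are unrelated. Fubini decompositions are therefore obtained
  from uniqueness of Haar measure, normalised by a Gaussian integral. The vector v of the overview
  is complex, whereas cones are swept in real directions. It enters through its real and imaginary
  parts, neither of which need point into the cone; hence the extension of Stokes' formula from
  interior directions to all directions.\<close>

lemma sigma_finite_measure_of_positive_integrable:
  fixes f :: "'b \<Rightarrow> ennreal"
  assumes f[measurable]: "f \<in> borel_measurable M"
    and pos: "\<And>x. x \<in> space M \<Longrightarrow> 0 < f x" and fin: "integral\<^sup>N M f < top"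
  shows "sigma_finite_measure M"
proof
  \<comment> \<open>The level sets where f is at least 1/n have finite measure by Markov's
    inequality and exhaust the space because f is positive.\<close>
  define A where "A n = {x \<in> space M. 1 \<le> of_nat n * f x}" for n :: nat
  have A[measurable]: "A n \<in> sets M" for n unfolding A_def by measurable
  have fin_A: "emeasure M (A n) \<noteq> \<infinity>" for n
  proof -
    have "emeasure M (A n) \<le> of_nat n * (\<integral>\<^sup>+x. f x * indicator (space M) x \<partial>M)"
      unfolding A_def by (rule nn_integral_Markov_inequality) auto
    also have "(\<integral>\<^sup>+x. f x * indicator (space M) x \<partial>M) = integral\<^sup>N M f"
      by (rule nn_integral_cong) simp
    also have "of_nat n * integral\<^sup>N M f < top" using fin by (simp add: ennreal_mult_less_top of_nat_less_top)
    finally show ?thesis by simp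
  qed
  have cover: "x \<in> (\<Union>n. A n)" if x: "x \<in> space M" for x
  proof -
    have "\<exists>n. 1 \<le> of_nat n * f x"
    proof (cases "f x = top")
      case True
      then show ?thesis by (intro exI[of _ 1]) simp
    next
      case False
      then obtain r where r: "f x = ennreal r" "r > 0"
        using pos[OF x] by (cases "f x") (auto simp: ennreal_less_zero_iff)
      obtain n where n: "1 / r \<le> real n" using real_arch_simple by blast
      then have "1 \<le> real n * r" using r by (simp add: field_simps)
      then have "1 \<le> ennreal (real n * r)" by simp
      also have "\<dots> = of_nat n * f x"
        using r by (simp add: ennreal_mult ennreal_of_nat_eq_real_of_nat)
      finally show ?thesis by blast
    qed
    then show ?thesis using x by (auto simp: A_def)
  qed
  show "\<exists>A. countable A \<and> A \<subseteq> sets M \<and> \<Union> A = space M \<and> (\<forall>a\<in>A. emeasure M a \<noteq> \<infinity>)"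
    by (intro exI[of _ "range A"] conjI) (use fin_A cover in \<open>auto simp: A_def\<close>)
qed

text \<open>A test function that is positive, even, of finite integral on every subspace, and
  multiplicative on orthogonal sums. The first three properties serve the uniqueness proof, the last
  one the computation of the normalisation.\<close>

definition gauss_weight :: "'a::euclidean_space \<Rightarrow> ennreal" where
  "gauss_weight x = ennreal (exp (- (norm x)\<^sup>2))"

definition gauss_mass :: ennreal where
  "gauss_mass = (\<integral>\<^sup>+ t. ennreal (exp (- t\<^sup>2)) \<partial>(lborel :: real measure))"

lemma gauss_weight_measurable [measurable]: "gauss_weight \<in> borel_measurable borel"
  unfolding gauss_weight_def by measurable

lemma gauss_weight_pos: "0 < gauss_weight x"
  by (simp add: gauss_weight_def)

lemma gauss_weight_minus: "gauss_weight (x - y) = gauss_weight (y - x)"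
  by (simp add: gauss_weight_def norm_minus_commute)

lemma gauss_weight_add_orthogonal:
  "x \<bullet> y = 0 \<Longrightarrow> gauss_weight (x + y) = gauss_weight x * gauss_weight y"
  by (simp add: gauss_weight_def power2_norm_eq_inner inner_add inner_commute
      flip: exp_add ennreal_mult)

lemma gauss_mass_finite: "gauss_mass < top" and gauss_mass_pos: "0 < gauss_mass"
proof -
  have *: "has_bochner_integral lborel (\<lambda>x::real. exp (- x\<^sup>2)) (2 *\<^sub>R (sqrt pi / 2))"
    by (rule has_bochner_integral_even_function[OF gaussian_moment_0]) simp
  have "gauss_mass = ennreal (\<integral>x. exp (- x\<^sup>2) \<partial>(lborel :: real measure))"
    unfolding gauss_mass_def
    by (intro nn_integral_eq_integral) (use * in \<open>auto intro: integrable.intros\<close>)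
  moreover have "(\<integral>x. exp (- x\<^sup>2) \<partial>(lborel :: real measure)) = sqrt pi"
    using has_bochner_integral_integral_eq[OF *] by simp
  ultimately have eq: "gauss_mass = ennreal (sqrt pi)" by simp
  show "gauss_mass < top" "0 < gauss_mass" unfolding eq by auto
qed

text \<open>Uniqueness of Haar measure: by Fubini and the translations \<open>y \<mapsto> y + x\<close> and
  \<open>x \<mapsto> x - y\<close>, the products \<open>\<integral>f d\<mu> \<cdot> \<integral>g d\<nu>\<close> and \<open>\<integral>g d\<mu> \<cdot> \<integral>f d\<nu>\<close> agree for the even function
  \<open>f = gauss_weight\<close>.\<close>

lemma translation_invariant_measure_unique:
  fixes \<mu> \<nu> :: "'a::euclidean_space measure"
  assumes sets: "sets \<mu> = sets borel" "sets \<nu> = sets borel"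
    and AE: "AE x in \<mu>. x \<in> W" "AE x in \<nu>. x \<in> W"
    and inv: "\<And>w. w \<in> W \<Longrightarrow> distr \<mu> borel (\<lambda>x. x + w) = \<mu>"
             "\<And>w. w \<in> W \<Longrightarrow> distr \<nu> borel (\<lambda>x. x + w) = \<nu>"
    and W: "subspace W"
    and mass: "integral\<^sup>N \<mu> gauss_weight = integral\<^sup>N \<nu> gauss_weight"
      "0 < integral\<^sup>N \<mu> gauss_weight" "integral\<^sup>N \<mu> gauss_weight < top"
  shows "\<mu> = \<nu>"
proof -
  note [measurable_cong] = sets
  interpret \<mu>: sigma_finite_measure \<mu>
    by (rule sigma_finite_measure_of_positive_integrable[of gauss_weight])
       (use mass gauss_weight_pos in auto)
  interpret \<nu>: sigma_finite_measure \<nu>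
    by (rule sigma_finite_measure_of_positive_integrable[of gauss_weight])
       (use mass gauss_weight_pos in auto)
  interpret P: pair_sigma_finite \<mu> \<nu> ..
  have inv\<mu>: "(\<integral>\<^sup>+x. h (x + w) \<partial>\<mu>) = (\<integral>\<^sup>+x. h x \<partial>\<mu>)"
    if [measurable]: "h \<in> borel_measurable borel" and "w \<in> W" for h w
    using nn_integral_distr[of "\<lambda>x. x + w" \<mu> borel h] inv(1)[OF \<open>w \<in> W\<close>] by simp
  have inv\<nu>: "(\<integral>\<^sup>+x. h (x + w) \<partial>\<nu>) = (\<integral>\<^sup>+x. h x \<partial>\<nu>)"
    if [measurable]: "h \<in> borel_measurable borel" and "w \<in> W" for h w
    using nn_integral_distr[of "\<lambda>x. x + w" \<nu> borel h] inv(2)[OF \<open>w \<in> W\<close>] by simp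
  let ?f = gauss_weight
  have eq: "integral\<^sup>N \<nu> g = integral\<^sup>N \<mu> g" if [measurable]: "g \<in> borel_measurable borel" for g
  proof -
    have "integral\<^sup>N \<mu> ?f * integral\<^sup>N \<nu> g = (\<integral>\<^sup>+x. ?f x * integral\<^sup>N \<nu> g \<partial>\<mu>)"
      by (simp add: nn_integral_multc)
    also have "\<dots> = (\<integral>\<^sup>+x. (\<integral>\<^sup>+y. ?f x * g (y + x) \<partial>\<nu>) \<partial>\<mu>)"
      by (rule nn_integral_cong_AE, rule AE_mp[OF AE(1)], rule AE_I2)
         (simp add: nn_integral_cmult inv\<nu>)
    also have "\<dots> = (\<integral>\<^sup>+y. (\<integral>\<^sup>+x. ?f x * g (y + x) \<partial>\<mu>) \<partial>\<nu>)"
      by (rule P.Fubini'[symmetric]) measurable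
    also have "\<dots> = (\<integral>\<^sup>+y. (\<integral>\<^sup>+x. ?f (x - y) * g x \<partial>\<mu>) \<partial>\<nu>)"
    proof (rule nn_integral_cong_AE, rule AE_mp[OF AE(2)], rule AE_I2, rule impI)
      fix y assume "y \<in> W"
      then show "(\<integral>\<^sup>+x. ?f x * g (y + x) \<partial>\<mu>) = (\<integral>\<^sup>+x. ?f (x - y) * g x \<partial>\<mu>)"
        using inv\<mu>[of "\<lambda>x. ?f (x - y) * g x" y] by (simp add: add.commute)
    qed
    also have "\<dots> = (\<integral>\<^sup>+x. (\<integral>\<^sup>+y. ?f (x - y) * g x \<partial>\<nu>) \<partial>\<mu>)"
      by (rule P.Fubini') measurable
    also have "\<dots> = (\<integral>\<^sup>+x. g x * integral\<^sup>N \<nu> ?f \<partial>\<mu>)"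
    proof (rule nn_integral_cong_AE, rule AE_mp[OF AE(1)], rule AE_I2, rule impI)
      fix x assume "x \<in> W"
      then have "- x \<in> W" using W by (rule subspace_neg[rotated])
      then have "(\<integral>\<^sup>+y. ?f (x - y) \<partial>\<nu>) = integral\<^sup>N \<nu> ?f"
        using inv\<nu>[of ?f "- x"] by (simp add: gauss_weight_minus[of x])
      then show "(\<integral>\<^sup>+y. ?f (x - y) * g x \<partial>\<nu>) = g x * integral\<^sup>N \<nu> ?f"
        by (simp add: nn_integral_multc mult.commute[of _ "integral\<^sup>N \<nu> gauss_weight"])
    qed
    also have "\<dots> = integral\<^sup>N \<mu> ?f * integral\<^sup>N \<mu> g"
      by (simp add: nn_integral_multc mass mult.commute)
    finally show ?thesis
      using mass ennreal_mult_cancel_left[of "integral\<^sup>N \<mu> ?f" "integral\<^sup>N \<nu> g" "integral\<^sup>N \<mu> g"]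
      by (metis less_irrefl)
  qed
  show ?thesis
  proof (rule measure_eqI)
    fix A assume "A \<in> sets \<mu>"
    then have [measurable]: "A \<in> sets borel" using sets by simp
    show "emeasure \<mu> A = emeasure \<nu> A"
      using eq[of "indicator A"] by simp
  qed (use sets in simp)
qed

section \<open>Orthonormal coordinates and translation invariance of \<open>lebW\<close>\<close>

lemma onb_orthonormal:
  fixes W :: "'a::euclidean_space set"
  assumes "subspace W"
  shows onb_in: "\<And>i. i < dim W \<Longrightarrow> onb W i \<in> W"
    and onb_inner: "\<And>i j. i < dim W \<Longrightarrow> j < dim W \<Longrightarrow> onb W i \<bullet> onb W j = (if i = j then 1 else 0)"
proof -
  obtain B where B: "B \<subseteq> W" "pairwise orthogonal B" "\<And>x. x \<in> B \<Longrightarrow> norm x = 1"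
    "independent B" "card B = dim W"
    using orthonormal_basis_subspace[OF assms] by metis
  have "finite B" using B(4) by (rule independent_imp_finite)
  then obtain b where b: "bij_betw b {..<dim W} B"
    using ex_bij_betw_nat_finite[of B] B(5) by (auto simp: atLeast0LessThan)
  have "b i \<in> W" if "i < dim W" for i
    using b B(1) that by (auto simp: bij_betw_def)
  moreover have "b i \<bullet> b j = (if i = j then 1 else 0)" if "i < dim W" "j < dim W" for i j
  proof (cases "i = j")
    case True
    have "norm (b j) = 1" using b B(3) that by (auto simp: bij_betw_def)
    with True show ?thesis by (simp add: norm_eq_1)
  next
    case False
    then have "b i \<noteq> b j" using b that by (auto simp: bij_betw_def inj_on_def)
    then show ?thesis
      using False B(2) b that by (auto simp: pairwise_def orthogonal_def bij_betw_def)
  qed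
  \<comment> \<open>\<open>onb\<close> is a bare choice; this existence statement is what makes it
    satisfy its specification.\<close>
  ultimately have ex: "\<exists>b. (\<forall>i<dim W. b i \<in> W) \<and>
      (\<forall>i<dim W. \<forall>j<dim W. b i \<bullet> b j = (if i = j then 1 else 0))"
    by blast
  from someI_ex[OF ex] show "\<And>i. i < dim W \<Longrightarrow> onb W i \<in> W"
    "\<And>i j. i < dim W \<Longrightarrow> j < dim W \<Longrightarrow> onb W i \<bullet> onb W j = (if i = j then 1 else 0)"
    unfolding onb_def by auto
qed

text \<open>The remainder of the expansion lies in \<open>W\<close> and is orthogonal to every basis
  vector. A dimension count shows that these vectors span \<open>W\<close>, so the remainder is
  orthogonal to itself.\<close>

lemma onb_expansion:
  fixes W :: "'a::euclidean_space set"
  assumes W: "subspace W" and w: "w \<in> W"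
  shows "(\<Sum>i<dim W. (w \<bullet> onb W i) *\<^sub>R onb W i) = w"
proof -
  note onb = onb_in[OF W] onb_inner[OF W]
  define B where "B = onb W ` {..<dim W}"
  have inj: "inj_on (onb W) {..<dim W}"
  proof (rule inj_onI, rule ccontr)
    fix i j assume "i \<in> {..<dim W}" "j \<in> {..<dim W}" "onb W i = onb W j" "i \<noteq> j"
    then show False using onb(2)[of i j] onb(2)[of i i] by simp
  qed
  have "pairwise orthogonal B" "0 \<notin> B"
    using onb(2) by (fastforce simp: B_def pairwise_def orthogonal_def)+
  then have ind: "independent B" by (rule pairwise_orthogonal_independent)
  have "card B = dim W" using inj by (simp add: B_def card_image)
  then have span: "W \<subseteq> span B"
    using ind onb(1) by (intro card_ge_dim_independent) (auto simp: B_def)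
  have *: "(\<Sum>i<dim W. (w \<bullet> onb W i) *\<^sub>R onb W i) - w \<in> W"
    using W w onb(1) by (intro subspace_diff subspace_sum subspace_scale) auto
  have "orthogonal ((\<Sum>i<dim W. (w \<bullet> onb W i) *\<^sub>R onb W i) - w) b" if b: "b \<in> B" for b
  proof -
    obtain j where j: "j < dim W" "b = onb W j" using b by (auto simp: B_def)
    then show ?thesis
      by (simp add: orthogonal_def inner_diff_left inner_sum_left onb(2) if_distrib[of "(*) _"]
            cong: if_cong)
  qed
  then have "orthogonal ((\<Sum>i<dim W. (w \<bullet> onb W i) *\<^sub>R onb W i) - w)
      ((\<Sum>i<dim W. (w \<bullet> onb W i) *\<^sub>R onb W i) - w)"
    using * span orthogonal_to_span by blast
  then show ?thesis by (simp add: orthogonal_def)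
qed

interpretation lborel_prod: product_sigma_finite "\<lambda>_::nat. lborel :: real measure"
  by standard

lemma lborel_translation_real: "distr lborel borel (\<lambda>t::real. t + s) = lborel"
proof -
  have "(\<lambda>t. t + s) = (+) s" by (rule ext) simp
  then show ?thesis by (simp only: lborel_distr_plus)
qed

text \<open>A product measure is determined by its values on boxes, and the preimage of a box is a
  box whose sides are translated separately.\<close>

lemma PiM_lborel_translation:
  assumes "finite I"
  shows "distr (PiM I (\<lambda>_::nat. lborel :: real measure)) (PiM I (\<lambda>_. lborel))
           (\<lambda>t. \<lambda>i\<in>I. t i + s i) = PiM I (\<lambda>_. lborel)"
proof (rule lborel_prod.PiM_eqI[OF assms])
  fix A :: "nat \<Rightarrow> real set" assume "\<And>i. i \<in> I \<Longrightarrow> A i \<in> sets lborel"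
  then have A[measurable]: "\<And>i. i \<in> I \<Longrightarrow> A i \<in> sets borel" by simp
  have "(\<lambda>t. \<lambda>i\<in>I. t i + s i) -` PiE I A \<inter> space (PiM I (\<lambda>_. lborel :: real measure))
      = PiE I (\<lambda>i. (\<lambda>x. x + s i) -` A i)"
    by (auto simp: space_PiM PiE_def Pi_def)
  moreover have "(\<lambda>x. x + s i) -` A i \<in> sets borel" if "i \<in> I" for i
    using measurable_sets[of "\<lambda>x. x + s i" borel borel "A i"] A[OF that] by simp
  moreover have "emeasure lborel ((\<lambda>x. x + s i) -` A i) = emeasure lborel (A i)" if "i \<in> I" for i
  proof -
    have "emeasure lborel (A i) = emeasure (distr lborel borel (\<lambda>x. x + s i)) (A i)"
      by (simp only: lborel_translation_real)
    also have "\<dots> = emeasure lborel ((\<lambda>x. x + s i) -` A i)"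
      using A[OF that] by (subst emeasure_distr) auto
    finally show ?thesis by simp
  qed
  moreover have "PiE I A \<in> sets (PiM I (\<lambda>_. lborel :: real measure))"
    using A by (intro sets_PiM_I_finite assms) auto
  ultimately show "emeasure (distr (PiM I (\<lambda>_. lborel)) (PiM I (\<lambda>_. lborel)) (\<lambda>t. \<lambda>i\<in>I. t i + s i)) (PiE I A)
     = (\<Prod>i\<in>I. emeasure lborel (A i))"
    by (subst emeasure_distr) (auto simp: lborel_prod.emeasure_PiM[OF assms])
qed simp

lemma sets_lebW [measurable_cong]: "sets (lebW W) = sets borel"
  by (simp add: lebW_def)

lemma space_lebW [simp]: "space (lebW W) = UNIV"
  by (simp add: lebW_def)

lemma subspace_in_sets_borel: "subspace (W :: 'a::euclidean_space set) \<Longrightarrow> W \<in> sets borel"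
  by (intro borel_closed closed_subspace)

lemma AE_lebW:
  assumes W: "subspace (W :: 'a::euclidean_space set)"
  shows "AE x in lebW W. x \<in> W"
proof -
  have "{x \<in> space borel. x \<in> W} \<in> sets borel" using subspace_in_sets_borel[OF W] by simp
  then show ?thesis
    unfolding lebW_def
    by (subst AE_distr_iff) (auto intro!: subspace_sum subspace_scale W onb_in)
qed

text \<open>In the coordinates of \<open>onb W\<close>, translation by w is the coordinatewise
  translation by the numbers \<open>w \<bullet> onb W i\<close>.\<close>

lemma lebW_translation:
  assumes W: "subspace (W :: 'a::euclidean_space set)" and w: "w \<in> W"
  shows "distr (lebW W) borel (\<lambda>x. x + w) = lebW W"
proof -
  let ?n = "dim W"
  let ?P = "PiM {..<?n} (\<lambda>_. lborel :: real measure)"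
  let ?\<phi> = "\<lambda>t. \<Sum>i<?n. t i *\<^sub>R onb W i"
  let ?T = "\<lambda>t. \<lambda>i\<in>{..<?n}. t i + w \<bullet> onb W i"
  have "distr (lebW W) borel (\<lambda>x. x + w) = distr ?P borel (\<lambda>t. ?\<phi> t + w)"
    unfolding lebW_def by (subst distr_distr) (auto simp: o_def)
  also have "\<dots> = distr ?P borel (?\<phi> \<circ> ?T)"
  proof (rule arg_cong[where f = "distr ?P borel"], rule ext)
    fix t
    show "?\<phi> t + w = (?\<phi> \<circ> ?T) t"
      using onb_expansion[OF W w] by (simp add: scaleR_add_left sum.distrib)
  qed
  also have "\<dots> = distr (distr ?P ?P ?T) borel ?\<phi>"
    by (rule distr_distr[symmetric]) measurable
  also have "\<dots> = lebW W"
    by (simp add: PiM_lborel_translation lebW_def)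
  finally show ?thesis .
qed

text \<open>By Parseval the squared norm is the sum of the squared coordinates, so the integral is a
  product of one-dimensional ones. The value depends on \<open>W\<close> only through its dimension,
  which makes it a usable normalisation.\<close>

lemma lebW_gauss:
  assumes W: "subspace (W :: 'a::euclidean_space set)"
  shows "integral\<^sup>N (lebW W) gauss_weight = gauss_mass ^ dim W"
proof -
  let ?n = "dim W"
  let ?\<phi> = "\<lambda>t. \<Sum>i<?n. t i *\<^sub>R onb W i"
  have nsq: "(norm (?\<phi> t))\<^sup>2 = (\<Sum>i<?n. (t i)\<^sup>2)" for t
  proof -
    have "(norm (?\<phi> t))\<^sup>2 = (\<Sum>i<?n. t i * (\<Sum>j<?n. t j * (onb W j \<bullet> onb W i)))"
      by (simp add: power2_norm_eq_inner inner_sum_left inner_sum_right sum_distrib_left)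
    also have "\<dots> = (\<Sum>i<?n. (t i)\<^sup>2)"
    proof (rule sum.cong[OF refl])
      fix i assume "i \<in> {..<?n}"
      then have "(\<Sum>j<?n. t j * (onb W j \<bullet> onb W i)) = (\<Sum>j<?n. if j = i then t j else 0)"
        by (intro sum.cong) (auto simp: onb_inner[OF W])
      then show "t i * (\<Sum>j<?n. t j * (onb W j \<bullet> onb W i)) = (t i)\<^sup>2"
        using \<open>i \<in> {..<?n}\<close> by (simp add: power2_eq_square)
    qed
    finally show ?thesis .
  qed
  have "integral\<^sup>N (lebW W) gauss_weight
      = (\<integral>\<^sup>+t. gauss_weight (?\<phi> t) \<partial>PiM {..<?n} (\<lambda>_. lborel))"
    unfolding lebW_def by (rule nn_integral_distr) measurable
  also have "\<dots> = (\<integral>\<^sup>+t. (\<Prod>i\<in>{..<?n}. ennreal (exp (- (t i)\<^sup>2))) \<partial>PiM {..<?n} (\<lambda>_. lborel))"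
    by (intro nn_integral_cong)
       (simp add: gauss_weight_def nsq prod_ennreal exp_sum flip: sum_negf)
  also have "\<dots> = gauss_mass ^ ?n"
    by (subst lborel_prod.product_nn_integral_prod) (auto simp: gauss_mass_def)
  finally show ?thesis .
qed

lemma gauss_mass_power: "0 < gauss_mass ^ n" "gauss_mass ^ n < top"
proof -
  show "0 < gauss_mass ^ n"
    using gauss_mass_pos by (induction n) (simp_all add: ennreal_zero_less_mult_iff)
  show "gauss_mass ^ n < top"
    using gauss_mass_finite by (simp add: power_less_top_ennreal)
qed

lemma sigma_finite_lebW:
  assumes W: "subspace (W :: 'a::euclidean_space set)"
  shows "sigma_finite_measure (lebW W)"
  by (rule sigma_finite_measure_of_positive_integrable[of gauss_weight])
     (simp_all add: lebW_gauss[OF W] gauss_mass_power gauss_weight_pos)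

text \<open>The tool for recognising \<open>lebW W\<close> without any change of basis: invariance
  determines the measure up to a factor, and the Gaussian integral fixes the factor.\<close>

lemma lebW_eqI:
  fixes W :: "'a::euclidean_space set"
  assumes W: "subspace W" and "sets \<mu> = sets borel" "AE x in \<mu>. x \<in> W"
    and "\<And>w. w \<in> W \<Longrightarrow> distr \<mu> borel (\<lambda>x. x + w) = \<mu>"
    and "integral\<^sup>N \<mu> gauss_weight = gauss_mass ^ dim W"
  shows "\<mu> = lebW W"
  by (rule translation_invariant_measure_unique[of _ _ W])
     (use assms AE_lebW[OF W] lebW_translation[OF W] in
       \<open>simp_all add: lebW_gauss gauss_mass_power sets_lebW\<close>)

section \<open>Fubini decompositions of \<open>lebW\<close>\<close>

lemma pair_measure_translation:
  fixes M1 :: "'b::euclidean_space measure" and M2 :: "'c::euclidean_space measure"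
  assumes "sigma_finite_measure M2"
    and "distr M1 borel (\<lambda>x. x + u) = M1" "distr M2 borel (\<lambda>x. x + v) = M2"
  shows "distr (M1 \<Otimes>\<^sub>M M2) (M1 \<Otimes>\<^sub>M M2) (\<lambda>(x, y). (x + u, y + v)) = M1 \<Otimes>\<^sub>M M2"
proof -
  have sets: "sets M1 = sets borel" "sets M2 = sets borel"
    using assms(2,3) by (metis sets_distr)+
  note [measurable_cong] = sets
  have "distr M1 M1 (\<lambda>x. x + u) = M1" "distr M2 M2 (\<lambda>x. x + v) = M2"
    using assms(2,3) sets by (simp_all cong: distr_cong)
  moreover have "distr M1 M1 (\<lambda>x. x + u) \<Otimes>\<^sub>M distr M2 M2 (\<lambda>x. x + v)
      = distr (M1 \<Otimes>\<^sub>M M2) (M1 \<Otimes>\<^sub>M M2) (\<lambda>(x, y). (x + u, y + v))"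
    by (rule pair_measure_distr) (use assms(1) calculation in simp_all)
  ultimately show ?thesis by simp
qed

text \<open>The image of the product measure is invariant under both summands, and its Gaussian
  integral is the right one because the weight factors over orthogonal vectors. This is the measure
  on a product of transverse cones.\<close>

lemma lebW_orthogonal_sum:
  fixes W1 W2 :: "'a::euclidean_space set"
  assumes W1: "subspace W1" and W2: "subspace W2"
    and orth: "\<And>x y. x \<in> W1 \<Longrightarrow> y \<in> W2 \<Longrightarrow> x \<bullet> y = 0"
    and W: "W = {x + y | x y. x \<in> W1 \<and> y \<in> W2}"
  shows "lebW W = distr (lebW W1 \<Otimes>\<^sub>M lebW W2) borel (\<lambda>(x, y). x + y)"
proof -
  interpret M1: sigma_finite_measure "lebW W1" by (rule sigma_finite_lebW[OF W1])
  interpret M2: sigma_finite_measure "lebW W2" by (rule sigma_finite_lebW[OF W2])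
  interpret P: pair_sigma_finite "lebW W1" "lebW W2" ..
  let ?P = "lebW W1 \<Otimes>\<^sub>M lebW W2"
  let ?\<phi> = "\<lambda>(x::'a, y). x + y"
  have subW: "subspace W" unfolding W by (rule subspace_sums[OF W1 W2])
  have WB[measurable]: "W \<in> sets borel" by (rule subspace_in_sets_borel[OF subW])
  have \<phi>[measurable]: "?\<phi> \<in> measurable ?P borel" by measurable
  have "distr ?P borel ?\<phi> = lebW W"
  proof (rule lebW_eqI[OF subW])
    show "AE x in distr ?P borel ?\<phi>. x \<in> W"
    proof (subst AE_distr_iff)
      show "AE z in ?P. ?\<phi> z \<in> W"
      proof (rule P.AE_pair_measure)
        show "AE x in lebW W1. AE y in lebW W2. ?\<phi> (x, y) \<in> W"
          using AE_lebW[OF W1]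
        proof eventually_elim
          case (elim x)
          show ?case using AE_lebW[OF W2] by eventually_elim (use elim W in auto)
        qed
      qed measurable
    qed auto
  next
    fix w assume "w \<in> W"
    then obtain u v where uv: "u \<in> W1" "v \<in> W2" "w = u + v" using W by auto
    have "distr (distr ?P borel ?\<phi>) borel (\<lambda>x. x + w) = distr ?P borel (\<lambda>z. ?\<phi> z + w)"
      by (subst distr_distr) (auto simp: o_def)
    also have "\<dots> = distr ?P borel (?\<phi> \<circ> (\<lambda>(x, y). (x + u, y + v)))"
      by (rule arg_cong[where f = "distr ?P borel"]) (auto simp: uv)
    also have "\<dots> = distr (distr ?P ?P (\<lambda>(x, y). (x + u, y + v))) borel ?\<phi>"
      by (rule distr_distr[symmetric]) measurable
    also have "\<dots> = distr ?P borel ?\<phi>"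
      using pair_measure_translation[OF M2.sigma_finite_measure_axioms
          lebW_translation[OF W1 uv(1)] lebW_translation[OF W2 uv(2)]] by simp
    finally show "distr (distr ?P borel ?\<phi>) borel (\<lambda>x. x + w) = distr ?P borel ?\<phi>" .
  next
    \<comment> \<open>Orthogonality makes the intersection trivial, so dimensions add and the powers
      of \<open>gauss_mass\<close> match.\<close>
    have "W1 \<inter> W2 \<subseteq> {0}" using orth by force
    then have "dim (W1 \<inter> W2) = 0" by simp
    then have dim: "dim W = dim W1 + dim W2"
      unfolding W using dim_sums_Int[OF W1 W2] by linarith
    have "integral\<^sup>N (distr ?P borel ?\<phi>) gauss_weight
        = (\<integral>\<^sup>+x. \<integral>\<^sup>+y. gauss_weight (x + y) \<partial>lebW W2 \<partial>lebW W1)"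
      by (subst nn_integral_distr) (auto simp: M2.nn_integral_fst[symmetric])
    also have "\<dots> = (\<integral>\<^sup>+x. gauss_weight x * gauss_mass ^ dim W2 \<partial>lebW W1)"
    proof (rule nn_integral_cong_AE, use AE_lebW[OF W1] in eventually_elim)
      case (elim x)
      have "(\<integral>\<^sup>+y. gauss_weight (x + y) \<partial>lebW W2) = (\<integral>\<^sup>+y. gauss_weight x * gauss_weight y \<partial>lebW W2)"
        by (rule nn_integral_cong_AE, use AE_lebW[OF W2] in eventually_elim)
           (use elim orth in \<open>simp add: gauss_weight_add_orthogonal\<close>)
      then show ?case by (simp add: nn_integral_cmult lebW_gauss[OF W2])
    qed
    also have "\<dots> = gauss_mass ^ dim W"
      by (simp add: nn_integral_multc lebW_gauss[OF W1] dim power_add)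
    finally show "integral\<^sup>N (distr ?P borel ?\<phi>) gauss_weight = gauss_mass ^ dim W" .
  qed simp
  then show ?thesis by simp
qed

text \<open>A shear preserves volume: c differs from the unit normal only by a vector of
  \<open>L'\<close>. It is needed because the direction in which a cone is swept out from a facet is
  in general not normal to that facet.\<close>

lemma lebW_shear:
  fixes L' :: "'a::euclidean_space set"
  assumes L': "subspace L'" and \<eta>: "norm \<eta> = 1" "\<And>y. y \<in> L' \<Longrightarrow> y \<bullet> \<eta> = 0"
    and c: "c - \<eta> \<in> L'" and L: "L = {y + t *\<^sub>R c | y t. y \<in> L'}"
  shows "lebW L = distr (lebW L' \<Otimes>\<^sub>M lborel) borel (\<lambda>(y, t). y + t *\<^sub>R c)"
proof -
  interpret M1: sigma_finite_measure "lebW L'" by (rule sigma_finite_lebW[OF L'])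
  interpret P: pair_sigma_finite "lebW L'" "lborel :: real measure" ..
  let ?P = "lebW L' \<Otimes>\<^sub>M (lborel :: real measure)"
  let ?\<phi> = "\<lambda>(y, t). y + t *\<^sub>R c"
  have Lspan: "L = span (insert c L')"
  proof -
    have "x \<in> L \<longleftrightarrow> (\<exists>k. x - k *\<^sub>R c \<in> L')" for x
    proof
      assume "\<exists>k. x - k *\<^sub>R c \<in> L'"
      then obtain k where "x - k *\<^sub>R c \<in> L'" by blast
      moreover have "x = (x - k *\<^sub>R c) + k *\<^sub>R c" by simp
      ultimately show "x \<in> L" unfolding L by blast
    next
      assume "x \<in> L"
      then obtain y t where "y \<in> L'" "x = y + t *\<^sub>R c" unfolding L by blast
      then show "\<exists>k. x - k *\<^sub>R c \<in> L'" by (intro exI[of _ t]) simp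
    qed
    moreover have "span L' = L'" using L' span_eq_iff by blast
    ultimately show ?thesis by (simp add: span_insert set_eq_iff del: span_eq_iff)
  qed
  then have subL: "subspace L" by simp
  have [measurable]: "L \<in> sets borel" by (rule subspace_in_sets_borel[OF subL])
  have \<phi>[measurable]: "?\<phi> \<in> measurable ?P borel" by measurable
  have "distr ?P borel ?\<phi> = lebW L"
  proof (rule lebW_eqI[OF subL])
    show "AE x in distr ?P borel ?\<phi>. x \<in> L"
    proof (subst AE_distr_iff)
      show "AE z in ?P. ?\<phi> z \<in> L"
      proof (rule P.AE_pair_measure)
        show "AE x in lebW L'. AE t in lborel. ?\<phi> (x, t) \<in> L"
          using AE_lebW[OF L'] by eventually_elim (auto simp: L)
      qed measurable
    qed auto
  next
    fix w assume "w \<in> L"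
    then obtain u s where us: "u \<in> L'" "w = u + s *\<^sub>R c" using L by auto
    have "distr (distr ?P borel ?\<phi>) borel (\<lambda>x. x + w) = distr ?P borel (\<lambda>z. ?\<phi> z + w)"
      by (subst distr_distr) (auto simp: o_def)
    also have "\<dots> = distr ?P borel (?\<phi> \<circ> (\<lambda>(x, y). (x + u, y + s)))"
      by (rule arg_cong[where f = "distr ?P borel"]) (auto simp: us algebra_simps)
    also have "\<dots> = distr (distr ?P ?P (\<lambda>(x, y). (x + u, y + s))) borel ?\<phi>"
      by (rule distr_distr[symmetric]) measurable
    also have "\<dots> = distr ?P borel ?\<phi>"
      using pair_measure_translation[OF _ lebW_translation[OF L' us(1)] lborel_translation_real[of s]]
      by (simp add: sigma_finite_lborel)
    finally show "distr (distr ?P borel ?\<phi>) borel (\<lambda>x. x + w) = distr ?P borel ?\<phi>" .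
  next
    have "c \<notin> span L'"
    proof
      assume "c \<in> span L'"
      then have "c \<in> L'" using L' span_eq_iff by blast
      then have "\<eta> \<in> L'" using c subspace_diff[OF L' \<open>c \<in> L'\<close> c] by simp
      then show False using \<eta> by (metis norm_eq_1 zero_neq_one)
    qed
    then have dim: "dim L = Suc (dim L')" unfolding Lspan by (simp add: dim_insert)
    have "integral\<^sup>N (distr ?P borel ?\<phi>) gauss_weight
        = (\<integral>\<^sup>+y. \<integral>\<^sup>+t. gauss_weight (y + t *\<^sub>R c) \<partial>lborel \<partial>lebW L')"
      by (subst nn_integral_distr) (auto simp: lborel.nn_integral_fst[symmetric])
    also have "\<dots> = (\<integral>\<^sup>+t. \<integral>\<^sup>+y. gauss_weight (y + t *\<^sub>R c) \<partial>lebW L' \<partial>lborel)"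
      by (rule P.Fubini'[symmetric]) measurable
    also have "\<dots> = (\<integral>\<^sup>+t. gauss_mass ^ dim L' * ennreal (exp (- t\<^sup>2)) \<partial>(lborel::real measure))"
    proof (rule nn_integral_cong)
      fix t :: real
      \<comment> \<open>For fixed t the tangential part of t c is a translation within
        \<open>L'\<close>; removing it by invariance leaves the orthogonal case.\<close>
      have tc: "t *\<^sub>R (c - \<eta>) \<in> L'" by (rule subspace_scale[OF L' c])
      have "(\<integral>\<^sup>+y. gauss_weight (y + t *\<^sub>R c) \<partial>lebW L')
          = (\<integral>\<^sup>+y. gauss_weight ((y + t *\<^sub>R (c - \<eta>)) + t *\<^sub>R \<eta>) \<partial>lebW L')"
        by (simp add: algebra_simps)
      also have "\<dots> = (\<integral>\<^sup>+y. gauss_weight (y + t *\<^sub>R \<eta>) \<partial>distr (lebW L') borel (\<lambda>y. y + t *\<^sub>R (c - \<eta>)))"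
        by (rule nn_integral_distr[symmetric]) measurable
      also have "\<dots> = (\<integral>\<^sup>+y. gauss_weight (y + t *\<^sub>R \<eta>) \<partial>lebW L')"
        using lebW_translation[OF L' tc] by simp
      also have "\<dots> = (\<integral>\<^sup>+y. gauss_weight y * gauss_weight (t *\<^sub>R \<eta>) \<partial>lebW L')"
        by (rule nn_integral_cong_AE, use AE_lebW[OF L'] in eventually_elim)
           (simp add: gauss_weight_add_orthogonal \<eta>)
      also have "\<dots> = gauss_mass ^ dim L' * gauss_weight (t *\<^sub>R \<eta>)"
        by (simp add: nn_integral_multc lebW_gauss[OF L'])
      also have "gauss_weight (t *\<^sub>R \<eta>) = ennreal (exp (- t\<^sup>2))"
        by (simp add: gauss_weight_def \<eta>)
      finally show "(\<integral>\<^sup>+y. gauss_weight (y + t *\<^sub>R c) \<partial>lebW L')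
        = gauss_mass ^ dim L' * ennreal (exp (- t\<^sup>2))" .
    qed
    also have "\<dots> = gauss_mass ^ dim L"
      by (simp add: nn_integral_cmult dim mult.commute[of _ "gauss_mass ^ dim L'"] flip: gauss_mass_def)
    finally show "integral\<^sup>N (distr ?P borel ?\<phi>) gauss_weight = gauss_mass ^ dim L" .
  qed simp
  then show ?thesis by simp
qed

text \<open>After splitting off the unit direction of n, the hyperplane meets each line in that
  direction in a single point. Used to discard the overlaps of slabs.\<close>

lemma AE_lebW_not_hyperplane:
  fixes L :: "'a::euclidean_space set"
  assumes L: "subspace L" and n: "n \<in> L" "n \<noteq> 0"
  shows "AE x in lebW L. x \<bullet> n \<noteq> 0"
proof -
  define \<eta> where "\<eta> = n /\<^sub>R norm n"
  define L' where "L' = {y \<in> L. y \<bullet> \<eta> = 0}"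
  have \<eta>1: "norm \<eta> = 1" "\<eta> \<in> L" using n L by (auto simp: \<eta>_def subspace_scale)
  have subL': "subspace L'"
    using L by (auto simp: L'_def subspace_def inner_add_left)
  have "L = {y + t *\<^sub>R \<eta> | y t. y \<in> L'}"
  proof safe
    fix x assume "x \<in> L"
    then have "x - (x \<bullet> \<eta>) *\<^sub>R \<eta> \<in> L'"
      using \<eta>1 L by (auto simp: L'_def inner_diff_left subspace_diff subspace_scale norm_eq_1)
    moreover have "x = (x - (x \<bullet> \<eta>) *\<^sub>R \<eta>) + (x \<bullet> \<eta>) *\<^sub>R \<eta>" by simp
    ultimately show "\<exists>y t. x = y + t *\<^sub>R \<eta> \<and> y \<in> L'" by blast
  qed (use L \<eta>1 in \<open>auto simp: L'_def intro: subspace_add subspace_scale\<close>)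
  then have eq: "lebW L = distr (lebW L' \<Otimes>\<^sub>M lborel) borel (\<lambda>(y, t). y + t *\<^sub>R \<eta>)"
    by (intro lebW_shear[OF subL' \<eta>1(1)]) (auto simp: L'_def L subspace_0 subL')
  interpret M1: sigma_finite_measure "lebW L'" by (rule sigma_finite_lebW[OF subL'])
  interpret P: pair_sigma_finite "lebW L'" "lborel :: real measure" ..
  have [measurable]: "Measurable.pred borel (\<lambda>x. x \<bullet> n \<noteq> 0)" by measurable
  show ?thesis unfolding eq
  proof (subst AE_distr_iff)
    show "AE z in lebW L' \<Otimes>\<^sub>M lborel. (case z of (y, t) \<Rightarrow> y + t *\<^sub>R \<eta>) \<bullet> n \<noteq> 0"
    proof (rule P.AE_pair_measure)
      have "y \<bullet> n = 0" if "y \<in> L'" for y using that n by (auto simp: L'_def \<eta>_def)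
      moreover have "\<eta> \<bullet> n \<noteq> 0" using n by (auto simp: \<eta>_def)
      ultimately show "AE y in lebW L'. AE t in lborel.
            (case (y, t) of (y, t) \<Rightarrow> y + t *\<^sub>R \<eta>) \<bullet> n \<noteq> 0"
        using AE_lebW[OF subL'] AE_lborel_singleton[of "0::real"]
        by (auto simp: inner_add_left)
    qed measurable
  qed auto
qed

text \<open>Common form of the two Fubini computations, facet times half-line and cone times cone.
  The factorisation is asked for only on \<open>A\<close> and \<open>B\<close> because the indicator
  of a cone splits only for points taken from the respective subspaces.\<close>

lemma has_bochner_integral_distr_pair:
  fixes f1 :: "'b \<Rightarrow> complex" and f2 :: "'c \<Rightarrow> complex" and f :: "'d \<Rightarrow> complex"
  assumes "sigma_finite_measure M1" "sigma_finite_measure M2"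
    and \<phi>[measurable]: "\<phi> \<in> measurable (M1 \<Otimes>\<^sub>M M2) N" and f[measurable]: "f \<in> borel_measurable N"
    and f1: "has_bochner_integral M1 f1 I1" and f2: "has_bochner_integral M2 f2 I2"
    and AE: "AE x in M1. x \<in> A" "AE y in M2. y \<in> B"
    and eq: "\<And>x y. x \<in> A \<Longrightarrow> y \<in> B \<Longrightarrow> f (\<phi> (x, y)) = f1 x * f2 y"
  shows "has_bochner_integral (distr (M1 \<Otimes>\<^sub>M M2) N \<phi>) f (I1 * I2)"
proof -
  interpret M1: sigma_finite_measure M1 by fact
  interpret M2: sigma_finite_measure M2 by fact
  interpret P: pair_sigma_finite M1 M2 ..
  note int = has_bochner_integral_iff
  have i1: "integrable M1 f1" "integral\<^sup>L M1 f1 = I1" and i2: "integrable M2 f2" "integral\<^sup>L M2 f2 = I2"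
    using f1 f2 by (auto simp: int)
  have [measurable]: "f1 \<in> borel_measurable M1" "f2 \<in> borel_measurable M2" using i1 i2 by auto
  have meas[measurable]: "(\<lambda>z. f (\<phi> z)) \<in> borel_measurable (M1 \<Otimes>\<^sub>M M2)" by measurable
  have sec: "AE y in M2. f (\<phi> (x, y)) = f1 x * f2 y" if "x \<in> A" for x
    using AE(2) by eventually_elim (use eq that in auto)
  have integrable: "integrable (M1 \<Otimes>\<^sub>M M2) (\<lambda>z. f (\<phi> z))"
  proof (rule P.Fubini_integrable[OF meas])
    show "AE x in M1. integrable M2 (\<lambda>y. f (\<phi> (x, y)))"
      using AE(1) AE_space
    proof eventually_elim
      case (elim x)
      have [measurable]: "(\<lambda>y. f (\<phi> (x, y))) \<in> borel_measurable M2"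
        using elim(2) by measurable
      show ?case
        by (subst integrable_cong_AE[OF _ _ sec[OF elim(1)]]) (use i2 in auto)
    qed
    have "AE x in M1. norm (f1 x) * (\<integral>y. norm (f2 y) \<partial>M2) = (\<integral>y. norm (f (\<phi> (x, y))) \<partial>M2)"
      using AE(1) AE_space
    proof eventually_elim
      case (elim x)
      have [measurable]: "(\<lambda>y. f (\<phi> (x, y))) \<in> borel_measurable M2"
        using elim(2) by measurable
      have "(\<integral>y. norm (f (\<phi> (x, y))) \<partial>M2) = (\<integral>y. norm (f1 x) * norm (f2 y) \<partial>M2)"
        by (rule integral_cong_AE) (use sec[OF elim(1)] in \<open>auto simp: norm_mult\<close>)
      then show ?case by simp
    qed
    moreover have "integrable M1 (\<lambda>x. norm (f1 x) * (\<integral>y. norm (f2 y) \<partial>M2))"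
      using i1 by auto
    ultimately show "integrable M1 (\<lambda>x. \<integral>y. norm (f (\<phi> (x, y))) \<partial>M2)"
      by (subst (asm) integrable_cong_AE) auto
  qed
  have "integral\<^sup>L (M1 \<Otimes>\<^sub>M M2) (\<lambda>z. f (\<phi> z)) = (\<integral>x. (\<integral>y. f (\<phi> (x, y)) \<partial>M2) \<partial>M1)"
    by (rule P.integral_fst'[symmetric, OF integrable])
  also have "\<dots> = (\<integral>x. f1 x * I2 \<partial>M1)"
  proof (rule integral_cong_AE)
    show "AE x in M1. (\<integral>y. f (\<phi> (x, y)) \<partial>M2) = f1 x * I2"
      using AE(1) AE_space
    proof eventually_elim
      case (elim x)
      have [measurable]: "(\<lambda>y. f (\<phi> (x, y))) \<in> borel_measurable M2"
        using elim(2) by measurable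
      have "(\<integral>y. f (\<phi> (x, y)) \<partial>M2) = (\<integral>y. f1 x * f2 y \<partial>M2)"
        by (rule integral_cong_AE) (use sec[OF elim(1)] in auto)
      then show ?case using i2 by simp
    qed
  qed measurable
  also have "\<dots> = I1 * I2" using i1 by simp
  finally show ?thesis
    using integrable by (simp add: int integrable_distr_eq integral_distr)
qed

text \<open>Absolute convergence is settled by the modulus exp(t Re z). The antiderivative exp(t z)
  / z vanishes at infinity, so only its value at 0 contributes, with a minus sign.\<close>

lemma has_bochner_integral_exp_half_line:
  fixes z :: complex
  assumes z: "Re z < 0"
  shows "has_bochner_integral lborel (\<lambda>t::real. indicator {0..} t *\<^sub>R exp (of_real t * z)) (- 1 / z)"
proof -
  let ?f = "\<lambda>t::real. exp (of_real t * z)"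
  have z0: "z \<noteq> 0" using z by auto
  have decay: "((\<lambda>t. exp (t * Re z)) \<longlongrightarrow> 0) at_top"
    by (rule filterlim_compose[OF exp_at_bot])
       (use filterlim_tendsto_neg_mult_at_bot[OF tendsto_const z filterlim_ident]
         in \<open>simp add: mult.commute\<close>)
  have "(\<integral>\<^sup>+t. ennreal (exp (t * Re z)) * indicator {0..} t \<partial>lborel)
      = ennreal (0 - exp (0 * Re z) / Re z)"
  proof (rule nn_integral_FTC_atLeast)
    show "DERIV (\<lambda>t. exp (t * Re z) / Re z) t :> exp (t * Re z)" for t
      using z by (auto intro!: derivative_eq_intros)
    show "((\<lambda>t. exp (t * Re z) / Re z) \<longlongrightarrow> 0) at_top"
      by (rule tendsto_divide_zero[OF decay])
  qed auto
  moreover have "(\<integral>\<^sup>+t. ennreal (norm (indicator {0..} t *\<^sub>R ?f t)) \<partial>lborel)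
      = (\<integral>\<^sup>+t. ennreal (exp (t * Re z)) * indicator {0..} t \<partial>lborel)"
    by (intro nn_integral_cong) (auto split: split_indicator)
  ultimately have int: "integrable lborel (\<lambda>t. indicator {0..} t *\<^sub>R ?f t)"
    by (intro integrableI_bounded) auto
  have fin: "(\<integral>t. indicator {0..b} t *\<^sub>R ?f t \<partial>lborel) = ?f b / z - 1 / z" if "b \<ge> 0" for b
  proof -
    have "(\<integral>t. indicator {0..b} t *\<^sub>R ?f t \<partial>lborel) = ?f b / z - ?f 0 / z"
    proof (rule integral_FTC_atLeastAtMost[OF that])
      show "((\<lambda>t. ?f t / z) has_vector_derivative ?f t) (at t within {0..b})" for t
        using z0 by (auto intro!: derivative_eq_intros has_vector_derivative_real_field)
    qed (intro continuous_intros)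
    then show ?thesis by simp
  qed
  have "((\<lambda>b. ?f b / z - 1 / z) \<longlongrightarrow> 0 / z - 1 / z) at_top"
  proof (intro tendsto_intros z0)
    show "(?f \<longlongrightarrow> 0) at_top"
      by (subst tendsto_norm_zero_iff[symmetric]) (simp add: decay)
  qed
  moreover have "((\<lambda>b. set_lebesgue_integral lborel {0..b} ?f) \<longlongrightarrow> set_lebesgue_integral lborel {0..} ?f) at_top"
    by (rule tendsto_set_lebesgue_integral_at_top) (use int in \<open>auto simp: set_integrable_def\<close>)
  then have "((\<lambda>b. ?f b / z - 1 / z) \<longlongrightarrow> set_lebesgue_integral lborel {0..} ?f) at_top"
    by (rule Lim_transform_eventually)
       (auto simp: set_lebesgue_integral_def fin intro: eventually_mono[OF eventually_ge_at_top[of 0]])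
  ultimately have "set_lebesgue_integral lborel {0..} ?f = - 1 / z"
    using tendsto_unique[OF trivial_limit_at_top_linorder] by fastforce
  then show ?thesis using int by (simp add: has_bochner_integral_iff set_lebesgue_integral_def)
qed

section \<open>Holomorphic and meromorphic functions on complexified subspaces\<close>

lemma bounded_linear_cpair: "bounded_linear (\<lambda>\<alpha>. cpair \<alpha> v)"
proof -
  have "linear (\<lambda>\<alpha>. cpair \<alpha> v)"
    by (rule linearI) (auto simp: cpair_def inner_add_left complex_eq_iff)
  then show ?thesis by (simp add: linear_conv_bounded_linear)
qed

lemma linear_cpair: "linear (cpair \<alpha>)"
  by (rule linearI) (auto simp: cpair_def inner_add_right complex_eq_iff)

lemma cpair_Jmul: "cpair (Jmul \<alpha>) v = \<i> * cpair \<alpha> v"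
  by (simp add: cpair_def Jmul_def complex_eq_iff)

lemma holo_onI:
  assumes "\<And>z. z \<in> U \<Longrightarrow> (G has_derivative L z) (at z within U)"
    and "\<And>z v. z \<in> U \<Longrightarrow> L z (Jmul v) = \<i> * L z v"
  shows "holo_on U G"
  using assms unfolding holo_on_def by blast

text \<open>\<open>U\<close> is usually only relatively open in a complexified subspace, so a
  derivative on the ambient space is not determined by \<open>G\<close>; one is chosen at each
  point.\<close>

lemma holo_onE:
  assumes "holo_on U G"
  obtains L where "\<And>z. z \<in> U \<Longrightarrow> (G has_derivative L z) (at z within U)"
    and "\<And>z v. z \<in> U \<Longrightarrow> L z (Jmul v) = \<i> * L z v"
  using assms unfolding holo_on_def by metis

lemma holo_on_subset: "holo_on U G \<Longrightarrow> T \<subseteq> U \<Longrightarrow> holo_on T G"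
  unfolding holo_on_def by (meson has_derivative_subset subsetD)

lemma holo_on_imp_continuous_on: "holo_on U G \<Longrightarrow> continuous_on U G"
  unfolding holo_on_def continuous_on_eq_continuous_within
  using has_derivative_continuous by blast

lemma holo_on_const: "holo_on U (\<lambda>_. c)"
  by (rule holo_onI[of _ _ "\<lambda>_ _. 0"]) auto

lemma holo_on_cpair: "holo_on U (\<lambda>\<alpha>. cpair \<alpha> v)"
  by (rule holo_onI[of _ _ "\<lambda>_ \<alpha>. cpair \<alpha> v"])
     (auto simp: cpair_Jmul intro: bounded_linear_imp_has_derivative bounded_linear_cpair)

lemma holo_on_add:
  assumes "holo_on U f" "holo_on U g"
  shows "holo_on U (\<lambda>x. f x + g x)"
proof -
  from assms obtain Lf Lg where
    "\<And>z. z \<in> U \<Longrightarrow> (f has_derivative Lf z) (at z within U)" "\<And>z v. z \<in> U \<Longrightarrow> Lf z (Jmul v) = \<i> * Lf z v"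
    "\<And>z. z \<in> U \<Longrightarrow> (g has_derivative Lg z) (at z within U)" "\<And>z v. z \<in> U \<Longrightarrow> Lg z (Jmul v) = \<i> * Lg z v"
    by (elim holo_onE) metis
  then show ?thesis
    by (intro holo_onI[of _ _ "\<lambda>z v. Lf z v + Lg z v"]) (auto intro: has_derivative_add simp: algebra_simps)
qed

lemma holo_on_mult:
  assumes "holo_on U f" "holo_on U g"
  shows "holo_on U (\<lambda>x. f x * g x)"
proof -
  from assms obtain Lf Lg where
    "\<And>z. z \<in> U \<Longrightarrow> (f has_derivative Lf z) (at z within U)" "\<And>z v. z \<in> U \<Longrightarrow> Lf z (Jmul v) = \<i> * Lf z v"
    "\<And>z. z \<in> U \<Longrightarrow> (g has_derivative Lg z) (at z within U)" "\<And>z v. z \<in> U \<Longrightarrow> Lg z (Jmul v) = \<i> * Lg z v"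
    by (elim holo_onE) metis
  then show ?thesis
    by (intro holo_onI[of _ _ "\<lambda>z v. f z * Lg z v + Lf z v * g z"] has_derivative_mult)
       (simp_all add: algebra_simps)
qed

lemma holo_on_inverse:
  assumes "holo_on U f" and nz: "\<And>z. z \<in> U \<Longrightarrow> f z \<noteq> 0"
  shows "holo_on U (\<lambda>x. inverse (f x))"
proof -
  from assms(1) obtain L where
    "\<And>z. z \<in> U \<Longrightarrow> (f has_derivative L z) (at z within U)" "\<And>z v. z \<in> U \<Longrightarrow> L z (Jmul v) = \<i> * L z v"
    by (elim holo_onE) metis
  then show ?thesis using nz
    by (intro holo_onI[of _ _ "\<lambda>z v. - (inverse (f z) * L z v * inverse (f z))"]
          Deriv.has_derivative_inverse) simp_all
qed

lemma holo_on_divide: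
  "holo_on U f \<Longrightarrow> holo_on U g \<Longrightarrow> (\<And>z. z \<in> U \<Longrightarrow> g z \<noteq> 0) \<Longrightarrow> holo_on U (\<lambda>x. f x / g x)"
  using holo_on_mult[of U f "\<lambda>x. inverse (g x)"] holo_on_inverse[of U g]
  by (simp add: divide_inverse)

lemma holo_on_diff: "holo_on U f \<Longrightarrow> holo_on U g \<Longrightarrow> holo_on U (\<lambda>x. f x - g x)"
  using holo_on_add[of U f "\<lambda>x. - 1 * g x"] holo_on_mult[of U "\<lambda>_. - 1" g] holo_on_const[of U "- 1"]
  by simp

lemma holo_on_sum: "(\<And>i. i \<in> I \<Longrightarrow> holo_on U (f i)) \<Longrightarrow> holo_on U (\<lambda>x. \<Sum>i\<in>I. f i x)"
  by (induction I rule: infinite_finite_induct) (auto intro: holo_on_const holo_on_add)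

lemma holo_on_prod: "(\<And>i. i \<in> I \<Longrightarrow> holo_on U (f i)) \<Longrightarrow> holo_on U (\<lambda>x. \<Prod>i\<in>I. f i x)"
  by (induction I rule: infinite_finite_induct) (auto intro: holo_on_const holo_on_mult)

text \<open>Multiplication by the complex scalar t when the pair (a, b) is read as a + i b;
  \<open>Jmul\<close> is multiplication by i.\<close>

definition complex_scale :: "complex \<Rightarrow> 'a::euclidean_space \<times> 'a \<Rightarrow> 'a \<times> 'a" where
  "complex_scale t v = Re t *\<^sub>R v + Im t *\<^sub>R Jmul v"

lemma bounded_linear_complex_scale: "bounded_linear (\<lambda>t. complex_scale t v)"
  unfolding complex_scale_def
  by (intro bounded_linear_add bounded_linear_scaleR_const bounded_linear_Re bounded_linear_Im)

lemma complex_scale_simps [simp]: "complex_scale 0 v = 0" "complex_scale 1 v = v"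
  by (auto simp: complex_scale_def)

lemma subspace_cplx: "subspace W \<Longrightarrow> subspace (cplx W)"
  unfolding cplx_def by (rule subspace_Times)

lemma complex_scale_in_cplx: "subspace W \<Longrightarrow> v \<in> cplx W \<Longrightarrow> complex_scale t v \<in> cplx W"
  unfolding complex_scale_def
  by (intro subspace_add subspace_scale subspace_cplx)
     (auto simp: cplx_def Jmul_def subspace_neg)

text \<open>Compatibility of the derivative with \<open>Jmul\<close> makes it complex linear along
  the line, so the composite has a complex derivative. This gives access to the theory of one
  complex variable.\<close>

lemma holo_on_restrict_complex_line:
  assumes G: "holo_on U G" and S: "open S" "\<And>t. t \<in> S \<Longrightarrow> z + complex_scale t v \<in> U"
  shows "(\<lambda>t. G (z + complex_scale t v)) holomorphic_on S"
proof -
  let ?l = "\<lambda>t. z + complex_scale t v"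
  obtain L where L: "\<And>z. z \<in> U \<Longrightarrow> (G has_derivative L z) (at z within U)"
      "\<And>z v. z \<in> U \<Longrightarrow> L z (Jmul v) = \<i> * L z v"
    using G by (rule holo_onE) blast
  show ?thesis unfolding holomorphic_on_def
  proof
    fix t assume t: "t \<in> S"
    let ?L = "L (?l t)"
    have "(?l has_derivative (\<lambda>h. complex_scale h v)) (at t within S)"
      by (auto intro!: derivative_eq_intros bounded_linear_imp_has_derivative bounded_linear_complex_scale)
    moreover have "(G has_derivative ?L) (at (?l t) within ?l ` S)"
      by (rule has_derivative_subset[OF L(1)]) (use S t in auto)
    ultimately have D: "((\<lambda>t. G (?l t)) has_derivative (\<lambda>h. ?L (complex_scale h v))) (at t within S)"
      by (rule has_derivative_in_compose)
    have lin: "linear ?L" using L(1) S t has_derivative_linear by blast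
    have "?L (complex_scale h v) = h * ?L v" for h
    proof -
      have "?L (complex_scale h v) = Re h *\<^sub>R ?L v + Im h *\<^sub>R (\<i> * ?L v)"
        unfolding complex_scale_def[of h]
        using L(2)[OF S(2)[OF t]] by (simp add: linear_add[OF lin] linear_scale[OF lin])
      also have "\<dots> = h * ?L v" by (simp add: complex_eq_iff)
      finally show ?thesis .
    qed
    then have "((\<lambda>t. G (?l t)) has_field_derivative ?L v) (at t within S)"
      using D by (simp add: has_field_derivative_def mult.commute[of _ "?L v"])
    then show "(\<lambda>t. G (?l t)) field_differentiable at t within S"
      by (auto simp: field_differentiable_def)
  qed
qed

text \<open>The identity theorem in one variable is applied on the complex line through a point of
  \<open>V\<close> and b. The parameters that stay in the ball form a convex set containing 0 and 1,
  hence a connected domain.\<close>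

lemma holo_on_ball_identity:
  fixes W :: "'a::euclidean_space set"
  assumes W: "subspace W" and g: "holo_on (ball z r \<inter> cplx W) g"
    and V: "openin (top_of_set (cplx W)) V" "V \<subseteq> ball z r" "V \<noteq> {}"
    and 0: "\<And>\<alpha>. \<alpha> \<in> V \<Longrightarrow> g \<alpha> = 0" and b: "b \<in> ball z r \<inter> cplx W"
  shows "g b = 0"
proof -
  obtain T where T: "open T" "V = cplx W \<inter> T" using V(1) by (auto simp: openin_open)
  obtain a where a: "a \<in> V" using V(3) by blast
  define v where "v = b - a"
  let ?l = "\<lambda>t. a + complex_scale t v"
  have aW: "a \<in> cplx W" "v \<in> cplx W"
    using a b T(2) subspace_cplx[OF W] by (auto simp: v_def subspace_diff)
  have lW: "?l t \<in> cplx W" for t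
    by (intro subspace_add subspace_cplx[OF W] aW complex_scale_in_cplx[OF W])
  have cont: "continuous_on UNIV ?l"
    by (intro continuous_intros linear_continuous_on bounded_linear_complex_scale)
  \<comment> \<open>The function vanishes for parameters in the neighbourhood S' of 0; the point b
    corresponds to the parameter 1 in S.\<close>
  define S where "S = ?l -` ball z r"
  define S' where "S' = ?l -` (T \<inter> ball z r)"
  have "open S" "open S'"
    unfolding S_def S'_def using T(1) by (auto intro!: open_vimage cont)
  moreover have "convex S"
  proof -
    have "linear (\<lambda>t. complex_scale t v)"
      using bounded_linear_complex_scale bounded_linear.linear by blast
    moreover have "S = (\<lambda>t. complex_scale t v) -` ((+) (- a) ` ball z r)"
      by (auto simp: S_def image_iff algebra_simps intro!: bexI[of _ "a + _"])
    ultimately show ?thesis by (simp add: convex_linear_vimage convex_translation)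
  qed
  moreover have "0 \<in> S'" using a T(2) V(2) by (auto simp: S'_def)
  moreover have "S' \<subseteq> S" by (auto simp: S_def S'_def)
  moreover have "(\<lambda>t. g (?l t)) holomorphic_on S"
    by (rule holo_on_restrict_complex_line[OF g \<open>open S\<close>]) (use lW in \<open>auto simp: S_def\<close>)
  moreover have "g (?l t) = 0" if "t \<in> S'" for t
    using that lW 0 T(2) by (auto simp: S'_def)
  moreover have "1 \<in> S" using b by (auto simp: S_def v_def)
  ultimately have "g (?l 1) = 0"
    by (intro analytic_continuation_open[of S' S "\<lambda>t. g (?l t)" "\<lambda>_. 0" 1])
       (auto intro: convex_connected)
  then show ?thesis by (simp add: v_def)
qed

section \<open>Generic statements, meromorphic functions and the identity theorem\<close>

definition open_dense :: "'a::euclidean_space set \<Rightarrow> ('a \<times> 'a) set \<Rightarrow> bool" where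
  "open_dense W D \<longleftrightarrow> openin (top_of_set (cplx W)) D \<and>
     (\<forall>U. openin (top_of_set (cplx W)) U \<and> U \<noteq> {} \<longrightarrow> U \<inter> D \<noteq> {})"

text \<open>Exceptional sets are left anonymous, so that finitely many statements can be combined
  without comparing the polar sets behind them.\<close>

definition generically :: "'a::euclidean_space set \<Rightarrow> ('a \<times> 'a \<Rightarrow> bool) \<Rightarrow> bool" where
  "generically W P \<longleftrightarrow> (\<exists>D. open_dense W D \<and> (\<forall>\<alpha>\<in>D. P \<alpha>))"

text \<open>Meromorphic functions on \<open>W\<^sub>\<complex>\<close>, with arbitrary values on a closed nowhere dense set.\<close>

definition mero :: "'a::euclidean_space set \<Rightarrow> ('a \<times> 'a \<Rightarrow> complex) \<Rightarrow> bool" where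
  "mero W R \<longleftrightarrow> (\<exists>D. open_dense W D \<and> (\<forall>z\<in>cplx W. \<exists>U g h.
     openin (top_of_set (cplx W)) U \<and> z \<in> U \<and> holo_on U g \<and> holo_on U h \<and>
     (\<forall>\<alpha>\<in>U \<inter> D. h \<alpha> \<noteq> 0 \<and> R \<alpha> = g \<alpha> / h \<alpha>)))"

lemma open_dense_cplx: "open_dense W (cplx W)"
  unfolding open_dense_def by (auto dest: openin_imp_subset)

lemma open_dense_Int: "open_dense W D \<Longrightarrow> open_dense W E \<Longrightarrow> open_dense W (D \<inter> E)"
  unfolding open_dense_def by (metis Int_assoc openin_Int)

lemma generically_mono: "generically W P \<Longrightarrow> (\<And>\<alpha>. \<alpha> \<in> cplx W \<Longrightarrow> P \<alpha> \<Longrightarrow> Q \<alpha>) \<Longrightarrow> generically W Q"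
  unfolding generically_def open_dense_def by (meson openin_imp_subset subsetD)

lemma generically_conj: "generically W P \<Longrightarrow> generically W Q \<Longrightarrow> generically W (\<lambda>\<alpha>. P \<alpha> \<and> Q \<alpha>)"
  unfolding generically_def by (meson IntD1 IntD2 open_dense_Int)

lemma generically_ball:
  assumes "finite I" "\<And>i. i \<in> I \<Longrightarrow> generically W (P i)"
  shows "generically W (\<lambda>\<alpha>. \<forall>i\<in>I. P i \<alpha>)"
  using assms
proof (induction I rule: finite_induct)
  case empty
  then show ?case unfolding generically_def using open_dense_cplx by auto
next
  case (insert i I)
  then have "generically W (\<lambda>\<alpha>. P i \<alpha> \<and> (\<forall>i\<in>I. P i \<alpha>))" by (intro generically_conj) auto
  then show ?case by (rule generically_mono) auto
qed

text \<open>Otherwise the set where f does not vanish would be a nonempty relatively open set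
  missing \<open>D\<close>. This is how generic identities become identities at every point of
  continuity.\<close>

lemma open_dense_continuous_zero:
  assumes D: "open_dense W D" and U: "openin (top_of_set (cplx W)) U" and f: "continuous_on U f"
    and 0: "\<And>\<alpha>. \<alpha> \<in> U \<inter> D \<Longrightarrow> f \<alpha> = (0::complex)" and \<alpha>: "\<alpha> \<in> U"
  shows "f \<alpha> = 0"
proof (rule ccontr)
  assume "f \<alpha> \<noteq> 0"
  have "openin (top_of_set U) (U \<inter> f -` (- {0}))"
    by (rule continuous_openin_preimage_gen[OF f]) auto
  then have "openin (top_of_set (cplx W)) (U \<inter> f -` (- {0}))"
    using U openin_trans by blast
  moreover have "\<alpha> \<in> U \<inter> f -` (- {0})" using \<alpha> \<open>f \<alpha> \<noteq> 0\<close> by simp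
  ultimately have "U \<inter> f -` (- {0}) \<inter> D \<noteq> {}" using D unfolding open_dense_def by blast
  then show False using 0 by auto
qed

text \<open>Connectedness argument: the points near which R vanishes generically form a set that is
  open by construction, and closed because a local numerator vanishing on part of a ball vanishes on
  all of it.\<close>

lemma mero_identity:
  assumes W: "subspace W" and R: "mero W R"
    and V: "openin (top_of_set (cplx W)) V" "V \<noteq> {}" and E: "open_dense W E"
    and 0: "\<And>\<alpha>. \<alpha> \<in> V \<inter> E \<Longrightarrow> R \<alpha> = 0"
  shows "generically W (\<lambda>\<alpha>. R \<alpha> = 0)"
proof -
  let ?X = "top_of_set (cplx W)"
  obtain D where D: "open_dense W D" and loc: "\<And>z. z \<in> cplx W \<Longrightarrow> \<exists>U g h.
     openin ?X U \<and> z \<in> U \<and> holo_on U g \<and> holo_on U h \<and> (\<forall>\<alpha>\<in>U \<inter> D. h \<alpha> \<noteq> 0 \<and> R \<alpha> = g \<alpha> / h \<alpha>)"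
    using R unfolding mero_def by metis
  define Q where "Q = D \<inter> E"
  have Q: "open_dense W Q" using D E by (simp add: Q_def open_dense_Int)
  \<comment> \<open>Vanishing is tested only on the fixed dense set Q, where the values of R are
    given by the local fractions.\<close>
  define A where "A = \<Union> {U. openin ?X U \<and> (\<forall>\<alpha>\<in>U \<inter> Q. R \<alpha> = 0)}"
  have "openin ?X A" unfolding A_def by (rule openin_Union) auto
  moreover have "V \<subseteq> A" using V 0 by (auto simp: A_def Q_def)
  moreover have "closedin ?X A"
  proof -
    have "z \<in> A" if z: "z \<in> cplx W" "z \<in> closure A" for z
    proof -
      obtain U g h where U: "openin ?X U" "z \<in> U" "holo_on U g" "holo_on U h"
        "\<And>\<alpha>. \<alpha> \<in> U \<inter> D \<Longrightarrow> h \<alpha> \<noteq> 0 \<and> R \<alpha> = g \<alpha> / h \<alpha>"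
        using loc[OF z(1)] by metis
      obtain T where T: "open T" "U = cplx W \<inter> T" using U(1) by (auto simp: openin_open)
      obtain r where r: "r > 0" "ball z r \<subseteq> T" using T U(2) by (metis IntD2 openE)
      let ?B = "ball z r \<inter> cplx W"
      have BU: "?B \<subseteq> U" using r T by auto
      obtain a where a: "a \<in> A" "a \<in> ball z r"
        using z(2) r(1) by (metis closure_approachable dist_commute mem_ball)
      then obtain Ua where Ua: "openin ?X Ua" "a \<in> Ua" "\<And>\<alpha>. \<alpha> \<in> Ua \<inter> Q \<Longrightarrow> R \<alpha> = 0"
        by (auto simp: A_def)
      have oB: "openin ?X ?B" by (auto simp: openin_open)
      have oV: "openin ?X (Ua \<inter> ?B)" using Ua(1) oB by (rule openin_Int)
      have gB: "holo_on ?B g" by (rule holo_on_subset[OF U(3) BU])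
      \<comment> \<open>On the part near a, the numerator vanishes on a dense set and hence, being
        continuous, everywhere; the ball version of the identity theorem spreads this to the whole
        ball.\<close>
      have g0: "g \<alpha> = 0" if "\<alpha> \<in> ?B" for \<alpha>
      proof (rule holo_on_ball_identity[OF W gB oV])
        show "Ua \<inter> ?B \<subseteq> ball z r" by auto
        show "Ua \<inter> ?B \<noteq> {}" using a Ua(1,2) openin_imp_subset by blast
        fix \<beta> assume "\<beta> \<in> Ua \<inter> ?B"
        then show "g \<beta> = 0"
        proof (rule open_dense_continuous_zero[OF Q oV, rotated -1])
          show "continuous_on (Ua \<inter> ?B) g"
            by (rule continuous_on_subset[OF holo_on_imp_continuous_on[OF gB]]) auto
          fix \<gamma> assume \<gamma>: "\<gamma> \<in> Ua \<inter> ?B \<inter> Q"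
          then have "R \<gamma> = 0" "h \<gamma> \<noteq> 0" "R \<gamma> = g \<gamma> / h \<gamma>"
            using Ua(3) U(5)[of \<gamma>] BU by (auto simp: Q_def)
          then show "g \<gamma> = 0" by simp
        qed
      qed (use that in auto)
      have "\<forall>\<alpha>\<in>?B \<inter> Q. R \<alpha> = 0"
        using g0 U(5) BU by (auto simp: Q_def)
      then show ?thesis using oB r z(1) unfolding A_def by (auto intro!: exI[of _ ?B])
    qed
    moreover have "A \<subseteq> cplx W" using \<open>openin ?X A\<close> openin_imp_subset by blast
    ultimately have "A = cplx W \<inter> closure A" using closure_subset by blast
    then show ?thesis by (metis closed_closure closedin_closed)
  qed
  moreover have "connected (cplx W)"
    using subspace_cplx[OF W] by (simp add: convex_connected subspace_imp_convex)
  ultimately have "A = cplx W" using V(2) connected_clopen by blast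
  have "R \<alpha> = 0" if "\<alpha> \<in> Q" for \<alpha>
  proof -
    have "\<alpha> \<in> cplx W" using Q that openin_imp_subset unfolding open_dense_def by blast
    then show ?thesis using that \<open>A = cplx W\<close> by (auto simp: A_def)
  qed
  then show ?thesis using Q by (auto simp: generically_def)
qed

lemma mero_holo:
  assumes "holo_on (cplx W) f" shows "mero W f"
proof -
  have "\<exists>U g h. openin (top_of_set (cplx W)) U \<and> z \<in> U \<and> holo_on U g \<and> holo_on U h \<and>
      (\<forall>\<alpha>\<in>U \<inter> cplx W. h \<alpha> \<noteq> 0 \<and> f \<alpha> = g \<alpha> / h \<alpha>)" if "z \<in> cplx W" for z
    by (rule exI[of _ "cplx W"], rule exI[of _ f], rule exI[of _ "\<lambda>_. 1"])
       (use assms that holo_on_const in auto)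
  then show ?thesis unfolding mero_def using open_dense_cplx by blast
qed

text \<open>Intersecting neighbourhoods and dense sets is the same for sums and products; only the
  arithmetic of two fractions, \<open>comb\<close>, differs.\<close>

lemma mero_binary:
  fixes W :: "'a::euclidean_space set"
  assumes "mero W R" "mero W S"
    and comb: "\<And>(U :: ('a \<times> 'a) set) g h g' h'. holo_on U g \<Longrightarrow> holo_on U h \<Longrightarrow> holo_on U g' \<Longrightarrow> holo_on U h' \<Longrightarrow>
      \<exists>p q. holo_on U p \<and> holo_on U q \<and> (\<forall>\<alpha>. h \<alpha> \<noteq> 0 \<longrightarrow> h' \<alpha> \<noteq> 0 \<longrightarrow>
         q \<alpha> \<noteq> 0 \<and> F (g \<alpha> / h \<alpha>) (g' \<alpha> / h' \<alpha>) = p \<alpha> / q \<alpha>)"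
  shows "mero W (\<lambda>\<alpha>. F (R \<alpha>) (S \<alpha>))"
proof -
  let ?X = "top_of_set (cplx W)"
  obtain D where D: "open_dense W D" and locR: "\<And>z. z \<in> cplx W \<Longrightarrow> \<exists>U g h.
     openin ?X U \<and> z \<in> U \<and> holo_on U g \<and> holo_on U h \<and> (\<forall>\<alpha>\<in>U \<inter> D. h \<alpha> \<noteq> 0 \<and> R \<alpha> = g \<alpha> / h \<alpha>)"
    using assms(1) unfolding mero_def by metis
  obtain E where E: "open_dense W E" and locS: "\<And>z. z \<in> cplx W \<Longrightarrow> \<exists>U g h.
     openin ?X U \<and> z \<in> U \<and> holo_on U g \<and> holo_on U h \<and> (\<forall>\<alpha>\<in>U \<inter> E. h \<alpha> \<noteq> 0 \<and> S \<alpha> = g \<alpha> / h \<alpha>)"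
    using assms(2) unfolding mero_def by metis
  have "\<exists>U p q. openin ?X U \<and> z \<in> U \<and> holo_on U p \<and> holo_on U q \<and>
       (\<forall>\<alpha>\<in>U \<inter> (D \<inter> E). q \<alpha> \<noteq> 0 \<and> F (R \<alpha>) (S \<alpha>) = p \<alpha> / q \<alpha>)" if z: "z \<in> cplx W" for z
  proof -
    obtain U g h where U: "openin ?X U" "z \<in> U" "holo_on U g" "holo_on U h"
        "\<And>\<alpha>. \<alpha> \<in> U \<inter> D \<Longrightarrow> h \<alpha> \<noteq> 0 \<and> R \<alpha> = g \<alpha> / h \<alpha>"
      using locR[OF z] by metis
    obtain V g' h' where V: "openin ?X V" "z \<in> V" "holo_on V g'" "holo_on V h'"
        "\<And>\<alpha>. \<alpha> \<in> V \<inter> E \<Longrightarrow> h' \<alpha> \<noteq> 0 \<and> S \<alpha> = g' \<alpha> / h' \<alpha>"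
      using locS[OF z] by metis
    have "holo_on (U \<inter> V) g" "holo_on (U \<inter> V) h" "holo_on (U \<inter> V) g'" "holo_on (U \<inter> V) h'"
      using U V by (auto elim: holo_on_subset)
    from comb[OF this] obtain p q where pq: "holo_on (U \<inter> V) p" "holo_on (U \<inter> V) q"
      "\<And>\<alpha>. h \<alpha> \<noteq> 0 \<Longrightarrow> h' \<alpha> \<noteq> 0 \<Longrightarrow> q \<alpha> \<noteq> 0 \<and> F (g \<alpha> / h \<alpha>) (g' \<alpha> / h' \<alpha>) = p \<alpha> / q \<alpha>"
      by blast
    show ?thesis
      by (rule exI[of _ "U \<inter> V"], rule exI[of _ p], rule exI[of _ q])
         (use U V pq in \<open>auto simp: openin_Int\<close>)
  qed
  then show ?thesis unfolding mero_def using open_dense_Int[OF D E] by blast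
qed

lemma mero_add:
  fixes W :: "'a::euclidean_space set"
  assumes "mero W R" "mero W S" shows "mero W (\<lambda>\<alpha>. R \<alpha> + S \<alpha>)"
proof (rule mero_binary[OF assms, where F = "(+)"])
  fix U g h g' h' assume "holo_on U g" "holo_on U h" "holo_on U g'" "holo_on (U :: ('a \<times> 'a) set) h'"
  then show "\<exists>p q. holo_on U p \<and> holo_on U q \<and> (\<forall>\<alpha>. h \<alpha> \<noteq> 0 \<longrightarrow> h' \<alpha> \<noteq> 0 \<longrightarrow>
         q \<alpha> \<noteq> 0 \<and> g \<alpha> / h \<alpha> + g' \<alpha> / h' \<alpha> = p \<alpha> / q \<alpha>)"
    by (intro exI[of _ "\<lambda>\<alpha>. g \<alpha> * h' \<alpha> + g' \<alpha> * h \<alpha>"] exI[of _ "\<lambda>\<alpha>. h \<alpha> * h' \<alpha>"])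
       (auto intro!: holo_on_add holo_on_mult simp: field_simps)
qed

lemma mero_mult:
  fixes W :: "'a::euclidean_space set"
  assumes "mero W R" "mero W S" shows "mero W (\<lambda>\<alpha>. R \<alpha> * S \<alpha>)"
proof (rule mero_binary[OF assms, where F = "(*)"])
  fix U g h g' h' assume "holo_on U g" "holo_on U h" "holo_on U g'" "holo_on (U :: ('a \<times> 'a) set) h'"
  then show "\<exists>p q. holo_on U p \<and> holo_on U q \<and> (\<forall>\<alpha>. h \<alpha> \<noteq> 0 \<longrightarrow> h' \<alpha> \<noteq> 0 \<longrightarrow>
         q \<alpha> \<noteq> 0 \<and> g \<alpha> / h \<alpha> * (g' \<alpha> / h' \<alpha>) = p \<alpha> / q \<alpha>)"
    by (intro exI[of _ "\<lambda>\<alpha>. g \<alpha> * g' \<alpha>"] exI[of _ "\<lambda>\<alpha>. h \<alpha> * h' \<alpha>"])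
       (auto intro!: holo_on_mult)
qed

lemma mero_diff: "mero W R \<Longrightarrow> mero W S \<Longrightarrow> mero W (\<lambda>\<alpha>. R \<alpha> - S \<alpha>)"
  using mero_add[of W R "\<lambda>\<alpha>. - 1 * S \<alpha>"] mero_mult[of W "\<lambda>_. - 1" S]
    mero_holo[OF holo_on_const[of "cplx W" "- 1"]] by simp

lemma mero_const: "mero W (\<lambda>_. c)"
  by (rule mero_holo[OF holo_on_const])

lemma mero_sum: "(\<And>i. i \<in> I \<Longrightarrow> mero W (f i)) \<Longrightarrow> mero W (\<lambda>x. \<Sum>i\<in>I. f i x)"
  by (induction I rule: infinite_finite_induct) (auto intro: mero_const mero_add)

text \<open>If d vanished on a nonempty open set, the identity theorem and continuity would make it
  vanish at z. This allows division by linear forms within \<open>mero\<close>.\<close>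

lemma open_dense_nonzero:
  assumes W: "subspace W" and d: "holo_on (cplx W) d" and z: "z \<in> cplx W" "d z \<noteq> 0"
  shows "open_dense W {\<alpha> \<in> cplx W. d \<alpha> \<noteq> 0}"
proof -
  note cont = holo_on_imp_continuous_on[OF d]
  have "{\<alpha> \<in> cplx W. d \<alpha> \<noteq> 0} = cplx W \<inter> d -` (- {0})" by auto
  moreover have "openin (top_of_set (cplx W)) (cplx W \<inter> d -` (- {0}))"
    by (rule continuous_openin_preimage_gen[OF cont]) auto
  moreover have False if V: "openin (top_of_set (cplx W)) V" "V \<noteq> {}"
    "V \<inter> {\<alpha> \<in> cplx W. d \<alpha> \<noteq> 0} = {}" for V
  proof -
    have "V \<subseteq> cplx W" using V(1) by (rule openin_imp_subset)
    then have "generically W (\<lambda>\<alpha>. d \<alpha> = 0)"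
      by (intro mero_identity[OF W mero_holo[OF d] V(1,2) open_dense_cplx]) (use V in auto)
    then obtain D where D: "open_dense W D" "\<And>\<alpha>. \<alpha> \<in> D \<Longrightarrow> d \<alpha> = 0" by (auto simp: generically_def)
    have "d z = 0"
      by (rule open_dense_continuous_zero[OF D(1) _ cont]) (use D z in auto)
    then show False using z by simp
  qed
  ultimately show ?thesis unfolding open_dense_def by auto
qed

lemma mero_divide_holo:
  assumes W: "subspace W" and R: "mero W R" and d: "holo_on (cplx W) d" and z: "z \<in> cplx W" "d z \<noteq> 0"
  shows "mero W (\<lambda>\<alpha>. R \<alpha> / d \<alpha>)"
proof -
  have "mero W (\<lambda>\<alpha>. 1 / d \<alpha>)"
  proof -
    have "\<exists>U g h. openin (top_of_set (cplx W)) U \<and> z \<in> U \<and> holo_on U g \<and> holo_on U h \<and>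
        (\<forall>\<alpha>\<in>U \<inter> {\<alpha> \<in> cplx W. d \<alpha> \<noteq> 0}. h \<alpha> \<noteq> 0 \<and> 1 / d \<alpha> = g \<alpha> / h \<alpha>)" if "z \<in> cplx W" for z
      by (rule exI[of _ "cplx W"], rule exI[of _ "\<lambda>_. 1"], rule exI[of _ d])
         (use d that holo_on_const in auto)
    then show ?thesis unfolding mero_def using open_dense_nonzero[OF W d z] by blast
  qed
  from mero_mult[OF R this] show ?thesis by simp
qed

section \<open>Transverse cones\<close>

lemma subspace_lin: "subspace (lin S)"
  by (simp add: lin_def)

lemma subspace_ocomp: "subspace (ocomp S)"
  by (auto simp: ocomp_def subspace_def inner_add_right)

lemma diff_in_lin: "x \<in> S \<Longrightarrow> y \<in> S \<Longrightarrow> x - y \<in> lin S"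
  unfolding lin_def by (rule span_base) auto

lemma lin_mono: "S \<subseteq> T \<Longrightarrow> lin S \<subseteq> lin T"
  unfolding lin_def by (rule span_mono) auto

lemma ocompD: "v \<in> ocomp S \<Longrightarrow> u \<in> S \<Longrightarrow> u \<bullet> v = 0"
  by (simp add: ocomp_def)

lemma ocomp_mono: "S \<subseteq> T \<Longrightarrow> ocomp T \<subseteq> ocomp S"
  by (auto simp: ocomp_def)

lemma in_ocomp_lin: "(\<And>x y. x \<in> S \<Longrightarrow> y \<in> S \<Longrightarrow> (x - y) \<bullet> v = 0) \<Longrightarrow> v \<in> ocomp (lin S)"
proof -
  assume *: "\<And>x y. x \<in> S \<Longrightarrow> y \<in> S \<Longrightarrow> (x - y) \<bullet> v = 0"
  have "orthogonal v u" if "u \<in> lin S" for u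
    using that unfolding lin_def
    by (rule orthogonal_to_span) (use * in \<open>auto simp: orthogonal_def inner_commute\<close>)
  then show ?thesis by (auto simp: ocomp_def orthogonal_def inner_commute)
qed

lemma lin_eq_span:
  assumes "a \<in> S" shows "lin S = span ((\<lambda>x. x - a) ` S)"
proof (rule span_eq[THEN iffD2, of "{x - y |x y. x \<in> S \<and> y \<in> S}", folded lin_def], intro conjI subsetI)
  fix v assume "v \<in> {x - y |x y. x \<in> S \<and> y \<in> S}"
  then obtain x y where "v = (x - a) - (y - a)" "x \<in> S" "y \<in> S" by auto
  then show "v \<in> span ((\<lambda>x. x - a) ` S)"
    by (metis span_diff span_base imageI)
next
  fix v assume "v \<in> (\<lambda>x. x - a) ` S"
  then show "v \<in> lin S" using assms by (auto intro: diff_in_lin)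
qed

lemma dim_lin: "S \<noteq> {} \<Longrightarrow> int (dim (lin S)) = aff_dim S"
  by (metis aff_dim_eq_dim_subtract dim_span equals0I hull_inc lin_eq_span)

lemma add_lin_in_affine_hull:
  assumes "x \<in> S" "w \<in> lin S" shows "x + w \<in> affine hull S"
  using affine_hull_span_gen[OF hull_inc[OF assms(1)]] assms lin_eq_span[OF assms(1)] by auto

lemma orthogonal_decomposition:
  assumes "subspace S"
  obtains y z where "y \<in> S" "z \<in> ocomp S" "x = y + z"
proof -
  obtain y z where yz: "y \<in> span S" "\<And>w. w \<in> span S \<Longrightarrow> orthogonal z w" "x = y + z"
    using orthogonal_subspace_decomp_exists by blast
  moreover have "span S = S" using assms span_eq_iff by blast
  ultimately have "y \<in> S" "z \<in> ocomp S"
    by (auto simp: ocomp_def orthogonal_def inner_commute simp del: span_eq_iff)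
  then show ?thesis using that yz(3) by blast
qed

lemma proj_eqI:
  assumes W: "subspace W" and y: "y \<in> W" and orth: "\<And>w. w \<in> W \<Longrightarrow> w \<bullet> (x - y) = 0"
  shows "proj W x = y"
proof -
  have "dist x y \<le> dist x z" if "z \<in> W" for z
  proof -
    have "(x - y) \<bullet> (y - z) = 0"
      using orth[OF subspace_diff[OF W y that]] by (simp add: inner_commute)
    then have "(norm ((x - y) + (y - z)))\<^sup>2 = (norm (x - y))\<^sup>2 + (norm (y - z))\<^sup>2"
      by (intro norm_add_Pythagorean) (simp add: orthogonal_def)
    then have "(dist x z)\<^sup>2 = (dist x y)\<^sup>2 + (norm (y - z))\<^sup>2" by (simp add: dist_norm)
    then have "(dist x y)\<^sup>2 \<le> (dist x z)\<^sup>2" by simp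
    then show ?thesis by (simp add: power_mono_iff)
  qed
  then show ?thesis unfolding proj_def
    by (intro closest_point_unique[symmetric])
       (use W y in \<open>auto intro: subspace_imp_convex closed_subspace\<close>)
qed

lemma proj_decomposition:
  assumes W: "subspace W" and "y \<in> W" "z \<in> ocomp W"
  shows "proj W (y + z) = y"
  by (rule proj_eqI[OF W]) (use assms in \<open>auto dest: ocompD\<close>)

lemma proj_in: "subspace W \<Longrightarrow> proj W x \<in> W"
  by (metis orthogonal_decomposition proj_decomposition)

lemma inner_proj: "subspace W \<Longrightarrow> w \<in> W \<Longrightarrow> w \<bullet> proj W x = w \<bullet> x"
  by (metis orthogonal_decomposition proj_decomposition inner_add_right ocompD add.right_neutral)

lemma proj_id: "subspace W \<Longrightarrow> x \<in> W \<Longrightarrow> proj W x = x"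
  by (rule proj_eqI) auto

lemma proj_add: "subspace W \<Longrightarrow> proj W (x + y) = proj W x + proj W y"
  by (rule proj_eqI) (auto simp: proj_in subspace_add inner_proj inner_diff_right inner_add_right)

lemma proj_ocomp:
  assumes "subspace S" "y \<in> S" "z \<in> ocomp S"
  shows "proj (ocomp S) (y + z) = z"
  by (rule proj_eqI[OF subspace_ocomp]) (use assms in \<open>auto simp: ocomp_def inner_commute\<close>)

text \<open>The directions w in the definition of \<open>tcone\<close>, separated from the base
  point and the projection.\<close>

definition feasible :: "'a::euclidean_space set \<Rightarrow> 'a \<Rightarrow> 'a set" where
  "feasible q x = {w. \<exists>e>0. \<forall>d. 0 < d \<and> d \<le> e \<longrightarrow> x + d *\<^sub>R w \<in> q}"

definition relint_point :: "'a::euclidean_space set \<Rightarrow> 'a" where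
  "relint_point f = (SOME x. x \<in> rel_interior f)"

lemma relint_point_in: "convex f \<Longrightarrow> f \<noteq> {} \<Longrightarrow> relint_point f \<in> rel_interior f"
  unfolding relint_point_def using rel_interior_eq_empty some_in_eq by blast

lemma relint_point_mem: "convex f \<Longrightarrow> f \<noteq> {} \<Longrightarrow> relint_point f \<in> f"
  using relint_point_in rel_interior_subset by blast

lemma feasible_add:
  assumes "convex q" "w \<in> feasible q x" "u \<in> feasible q x"
  shows "w + u \<in> feasible q x"
proof -
  obtain e e' where e: "e > 0" "\<And>d. 0 < d \<Longrightarrow> d \<le> e \<Longrightarrow> x + d *\<^sub>R w \<in> q"
    "e' > 0" "\<And>d. 0 < d \<Longrightarrow> d \<le> e' \<Longrightarrow> x + d *\<^sub>R u \<in> q"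
    using assms by (auto simp: feasible_def)
  have "x + d *\<^sub>R (w + u) \<in> q" if "0 < d" "d \<le> min e e' / 2" for d
  proof -
    have "(1/2) *\<^sub>R (x + (2 * d) *\<^sub>R w) + (1/2) *\<^sub>R (x + (2 * d) *\<^sub>R u) \<in> q"
      by (rule convexD[OF assms(1)]) (use that e in auto)
    moreover have "(1/2) *\<^sub>R (x + (2 * d) *\<^sub>R w) + (1/2) *\<^sub>R (x + (2 * d) *\<^sub>R u) = x + d *\<^sub>R (w + u)"
      by (simp add: algebra_simps flip: scaleR_add_left)
    ultimately show ?thesis by simp
  qed
  then show ?thesis using e unfolding feasible_def
    by (auto intro!: exI[of _ "min e e' / 2"])
qed

lemma lin_subset_feasible:
  assumes "x \<in> rel_interior f" "w \<in> lin f" shows "w \<in> feasible f x"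
proof -
  obtain e where e: "e > 0" "ball x e \<inter> affine hull f \<subseteq> f" and x: "x \<in> f"
    using assms(1) by (auto simp: mem_rel_interior_ball)
  \<comment> \<open>The summand 1 keeps the step length meaningful for w = 0 and the bound strict,
    as the open ball requires.\<close>
  have "x + d *\<^sub>R w \<in> f" if "0 < d" "d \<le> e / (norm w + 1)" for d
  proof -
    have "d * norm w < d * (norm w + 1)" using that by simp
    also have "\<dots> \<le> e" using that by (simp add: pos_le_divide_eq add_nonneg_pos)
    finally have "x + d *\<^sub>R w \<in> ball x e" using that by (simp add: dist_norm)
    moreover have "x + d *\<^sub>R w \<in> affine hull f"
      using x assms(2) by (intro add_lin_in_affine_hull subspace_scale subspace_lin)
    ultimately show ?thesis using e by blast
  qed
  moreover have "e / (norm w + 1) > 0" using e by (simp add: add_nonneg_pos)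
  ultimately show ?thesis unfolding feasible_def by blast
qed

lemma feasible_mono: "f \<subseteq> q \<Longrightarrow> feasible f x \<subseteq> feasible q x"
  unfolding feasible_def by blast

lemma feasible_subset_lin:
  assumes "x \<in> q" shows "feasible q x \<subseteq> lin q"
proof
  fix w assume "w \<in> feasible q x"
  then obtain e where e: "e > 0" "x + e *\<^sub>R w \<in> q" unfolding feasible_def by auto
  then have "(x + e *\<^sub>R w) - x \<in> lin q" using assms by (intro diff_in_lin)
  then have "(1 / e) *\<^sub>R (e *\<^sub>R w) \<in> lin q"
    using subspace_scale[OF subspace_lin, of "e *\<^sub>R w" q "1 / e"] by simp
  moreover have "(1 / e) *\<^sub>R (e *\<^sub>R w) = w" using e by simp
  ultimately show "w \<in> lin q" by metis
qed

text \<open>Since the base point is in the relative interior of f, both signs of every vector of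
  \<open>lin f\<close> are feasible. Removing the component in \<open>lin f\<close> thus keeps a
  direction feasible, and projecting amounts to intersecting. The projected base point cancels in
  \<open>tcone0\<close>.\<close>

lemma tcone0_eq_feasible:
  assumes q: "convex q" and f: "f face_of q" "f \<noteq> {}"
  shows "tcone0 q f = feasible q (relint_point f) \<inter> ocomp (lin f)"
proof -
  let ?x = "relint_point f" and ?P = "proj (ocomp (lin f))"
  have x: "?x \<in> rel_interior f" using f face_of_imp_convex relint_point_in by blast
  have "tcone0 q f = ?P ` feasible q ?x"
  proof -
    have "tcone0 q f = (\<lambda>w. ?P (?x + w) - ?P ?x) ` feasible q ?x"
      unfolding tcone0_def tcone_def Let_def feasible_def relint_point_def[symmetric] by blast
    then show ?thesis by (simp add: proj_add[OF subspace_ocomp])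
  qed
  also have "\<dots> = feasible q ?x \<inter> ocomp (lin f)"
  proof (intro equalityI subsetI)
    fix z assume "z \<in> ?P ` feasible q ?x"
    then obtain w where w: "w \<in> feasible q ?x" "z = ?P w" by blast
    obtain u v where uv: "u \<in> lin f" "v \<in> ocomp (lin f)" "w = u + v"
      using orthogonal_decomposition[OF subspace_lin] by blast
    then have "z = v" using w proj_ocomp[OF subspace_lin] by blast
    moreover have "- u \<in> feasible q ?x"
      using lin_subset_feasible[OF x, of "- u"] uv feasible_mono[OF face_of_imp_subset[OF f(1)]]
      by (auto simp: subspace_neg[OF subspace_lin])
    then have "w + - u \<in> feasible q ?x" by (intro feasible_add q w)
    ultimately show "z \<in> feasible q ?x \<inter> ocomp (lin f)" using uv by simp
  next
    fix z assume "z \<in> feasible q ?x \<inter> ocomp (lin f)"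
    then show "z \<in> ?P ` feasible q ?x" by (metis IntD1 IntD2 imageI proj_id subspace_ocomp)
  qed
  finally show ?thesis .
qed

text \<open>A facet of a polyhedron is exposed by some hyperplane with normal a. The projection of a
  to \<open>lin q\<close> has the same pairings with differences of points of q, and it is nonzero
  because otherwise the hyperplane would contain q. Its normalisation witnesses the choice in
  \<open>onormal\<close>.\<close>

lemma onormal_facet:
  fixes q :: "'a::euclidean_space set"
  assumes q: "polyhedron q" and q': "q' facet_of q"
  shows onormal_in_lin: "onormal q q' \<in> lin q" and norm_onormal: "norm (onormal q q') = 1"
    and onormal_orthogonal: "\<And>u. u \<in> lin q' \<Longrightarrow> u \<bullet> onormal q q' = 0"
    and onormal_outward: "\<And>x y. y \<in> q \<Longrightarrow> x \<in> q' \<Longrightarrow> (y - x) \<bullet> onormal q q' \<le> 0"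
proof -
  have face: "q' face_of q" "q' \<noteq> {}" "aff_dim q' = aff_dim q - 1"
    using q' by (auto simp: facet_of_def)
  then have "q' exposed_face_of q" using q exposed_face_of_polyhedron by blast
  then obtain a b where ab: "q \<subseteq> {x. a \<bullet> x \<le> b}" "q' = q \<inter> {x. a \<bullet> x = b}"
    by (auto simp: exposed_face_of_def)
  define n where "n = proj (lin q) a"
  have n_in: "n \<in> lin q" by (simp add: n_def proj_in subspace_lin)
  have n_inner: "u \<bullet> n = u \<bullet> a" if "u \<in> lin q" for u
    using that by (simp add: n_def inner_proj subspace_lin)
  have outward: "(y - x) \<bullet> n \<le> 0" if "y \<in> q" "x \<in> q'" for x y
  proof -
    have "(y - x) \<bullet> n = (y - x) \<bullet> a" using that ab by (intro n_inner diff_in_lin) auto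
    then show ?thesis using that ab by (auto simp: inner_diff inner_commute)
  qed
  have orth: "u \<bullet> n = 0" if "u \<in> lin q'" for u
  proof -
    have "n \<in> ocomp (lin q')"
    proof (rule in_ocomp_lin)
      fix x y assume "x \<in> q'" "y \<in> q'"
      then show "(x - y) \<bullet> n = 0"
        using n_inner[OF diff_in_lin, of x y] ab by (auto simp: inner_diff inner_commute)
    qed
    then show ?thesis using that by (rule ocompD)
  qed
  have "n \<noteq> 0"
  proof
    assume "n = 0"
    obtain x0 where x0: "x0 \<in> q'" using face by blast
    have "q \<subseteq> q'"
    proof
      fix y assume "y \<in> q"
      then have "(y - x0) \<bullet> a = 0" using n_inner[OF diff_in_lin, of y x0] x0 ab \<open>n = 0\<close> by auto
      then show "y \<in> q'" using x0 ab \<open>y \<in> q\<close> by (auto simp: inner_diff inner_commute)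
    qed
    then have "q' = q" using ab by blast
    then show False using face by simp
  qed
  let ?\<eta> = "n /\<^sub>R norm n"
  have "?\<eta> \<in> lin q \<and> norm ?\<eta> = 1 \<and> (\<forall>u\<in>lin q'. u \<bullet> ?\<eta> = 0) \<and> (\<forall>y\<in>q. \<forall>x\<in>q'. (y - x) \<bullet> ?\<eta> \<le> 0)"
    using n_in orth outward \<open>n \<noteq> 0\<close>
    by (auto simp: subspace_scale[OF subspace_lin] divide_simps mult_le_0_iff)
  then have "\<exists>\<eta>. \<eta> \<in> lin q \<and> norm \<eta> = 1 \<and> (\<forall>u\<in>lin q'. u \<bullet> \<eta> = 0) \<and> (\<forall>y\<in>q. \<forall>x\<in>q'. (y - x) \<bullet> \<eta> \<le> 0)"
    by blast
  from someI_ex[OF this] show "onormal q q' \<in> lin q" "norm (onormal q q') = 1"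
    "\<And>u. u \<in> lin q' \<Longrightarrow> u \<bullet> onormal q q' = 0"
    "\<And>x y. y \<in> q \<Longrightarrow> x \<in> q' \<Longrightarrow> (y - x) \<bullet> onormal q q' \<le> 0"
    unfolding onormal_def by auto
qed

text \<open>The supporting hyperplane with normal \<open>onormal q q'\<close> cuts out a face of q
  that contains q'. This face is proper, since the normal lies in \<open>lin q\<close>, and between
  q' and q there is no room for another dimension.\<close>

lemma onormal_zero_imp_mem:
  fixes q :: "'a::euclidean_space set"
  assumes q: "polyhedron q" and q': "q' facet_of q"
    and yx: "y \<in> q" "x \<in> q'" "(y - x) \<bullet> onormal q q' = 0"
  shows "y \<in> q'"
proof -
  let ?\<eta> = "onormal q q'"
  note \<eta> = onormal_facet[OF q q']
  have face: "q' face_of q" "q' \<noteq> {}" "aff_dim q' = aff_dim q - 1"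
    using q' by (auto simp: facet_of_def)
  have cq: "convex q" using q polyhedron_imp_convex by blast
  define r where "r = q \<inter> {z. ?\<eta> \<bullet> z = ?\<eta> \<bullet> x}"
  have r: "r face_of q"
    unfolding r_def
  proof (rule face_of_Int_supporting_hyperplane_le[OF cq])
    fix z assume "z \<in> q"
    then show "?\<eta> \<bullet> z \<le> ?\<eta> \<bullet> x" using \<eta>(4)[of z x] yx by (simp add: inner_diff inner_commute)
  qed
  have "r \<noteq> q"
  proof
    assume "r = q"
    then have "?\<eta> \<bullet> z = ?\<eta> \<bullet> x" if "z \<in> q" for z using that by (auto simp: r_def)
    then have "?\<eta> \<in> ocomp (lin q)"
      by (intro in_ocomp_lin) (simp add: inner_diff inner_commute)
    then have "?\<eta> \<bullet> ?\<eta> = 0" using \<eta>(1) by (rule ocompD)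
    then show False using \<eta>(2) by (simp add: norm_eq_1)
  qed
  then have "aff_dim r < aff_dim q" using face_of_aff_dim_lt[OF cq r] by blast
  have "q' \<subseteq> r"
  proof
    fix z assume "z \<in> q'"
    then have "(z - x) \<bullet> ?\<eta> = 0" using yx by (intro \<eta>(3) diff_in_lin)
    then show "z \<in> r" using \<open>z \<in> q'\<close> face_of_imp_subset[OF face(1)]
      by (auto simp: r_def inner_diff inner_commute)
  qed
  then have "q' face_of r" using face(1) r face_of_subset face_of_imp_subset by blast
  then have "q' = r"
    using face_of_aff_dim_lt[of r q'] face_of_imp_convex[OF r] face(3) \<open>aff_dim r < aff_dim q\<close> by linarith
  then show ?thesis using yx by (auto simp: r_def inner_diff inner_commute)
qed

text \<open>The segment from a relative interior point y to z leaves q through some facet at a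
  parameter d < 1. The height over that facet then grows linearly and equals (1 - d) times the
  positive slope at z. Consequently a point of the affine hull that satisfies all facet inequalities
  lies in q.\<close>

lemma facet_separates:
  fixes q :: "'a::euclidean_space set"
  assumes q: "polytope q" and z: "z \<in> affine hull q" "z \<notin> q"
  obtains q' where "q' facet_of q" "\<And>x. x \<in> q' \<Longrightarrow> (z - x) \<bullet> onormal q q' > 0"
proof -
  note poly = polytope_imp_polyhedron[OF q]
  have cq: "convex q" "q \<noteq> {}" using q z polytope_imp_convex by auto
  then obtain y where y: "y \<in> rel_interior q" using rel_interior_eq_empty by blast
  then have yq: "y \<in> q" using rel_interior_subset by blast
  define l where "l = z - y"
  have "l \<noteq> 0" "y + l \<in> affine hull q" using yq z by (auto simp: l_def)
  then obtain d where d: "0 < d" "y + d *\<^sub>R l \<in> rel_frontier q"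
    "\<And>e. 0 \<le> e \<Longrightarrow> e < d \<Longrightarrow> y + e *\<^sub>R l \<in> rel_interior q"
    using ray_to_rel_frontier[OF polytope_imp_bounded[OF q] y] by metis
  obtain q' where q': "q' facet_of q" "y + d *\<^sub>R l \<in> q'"
    using d(2) rel_frontier_of_polyhedron[OF poly] by blast
  have sub: "q' \<subseteq> q" using q'(1) facet_of_imp_subset by blast
  have "d < 1"
  proof (rule ccontr)
    assume "\<not> d < 1"
    then consider "d = 1" | "d > 1" by linarith
    then have "y + 1 *\<^sub>R l \<in> q"
      using d(3)[of 1] q'(2) sub rel_interior_subset[of q] by cases auto
    then show False using z by (simp add: l_def)
  qed
  let ?\<eta> = "onormal q q'"
  note \<eta> = onormal_facet[OF poly q'(1)]
  have "q' \<noteq> q" using q'(1) by (auto simp: facet_of_def)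
  then have "y \<notin> q'" using y q'(1) face_of_disjoint_rel_interior[of q' q] by (auto simp: facet_of_def)
  then have "(y - (y + d *\<^sub>R l)) \<bullet> ?\<eta> \<noteq> 0"
    using onormal_zero_imp_mem[OF poly q'(1) yq q'(2)] by blast
  moreover have "(y - (y + d *\<^sub>R l)) \<bullet> ?\<eta> \<le> 0" using \<eta>(4) yq q'(2) by blast
  ultimately have pos: "l \<bullet> ?\<eta> > 0" using d(1)
    by (auto simp: inner_diff_left mult_le_0_iff zero_le_mult_iff)
  have "(z - x) \<bullet> ?\<eta> > 0" if "x \<in> q'" for x
  proof -
    have "((y + d *\<^sub>R l) - x) \<bullet> ?\<eta> = 0" using that q'(2) by (intro \<eta>(3) diff_in_lin)
    moreover have "z - x = ((y + d *\<^sub>R l) - x) + (1 - d) *\<^sub>R l" by (simp add: l_def algebra_simps)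
    ultimately have "(z - x) \<bullet> ?\<eta> = (1 - d) * (l \<bullet> ?\<eta>)" by (metis inner_add_left inner_scaleR_left add_0)
    then show ?thesis using pos \<open>d < 1\<close> by simp
  qed
  then show ?thesis using that q'(1) by blast
qed

section \<open>The transverse cone of a polytope along a face\<close>

definition facets_above :: "'a::euclidean_space set \<Rightarrow> 'a set \<Rightarrow> 'a set set" where
  "facets_above f q = {q'. q' facet_of q \<and> f \<subseteq> q'}"

lemma finite_facets_above: "polytope q \<Longrightarrow> finite (facets_above f q)"
  unfolding facets_above_def using finite_polytope_facets
  by (rule finite_subset[rotated]) auto

text \<open>A model of the quotient of \<open>lin q\<close> by \<open>lin f\<close>. It is the
  ambient space of the transverse cone of q along f, whose Lebesgue measure enters the
  integral.\<close>

definition lin_quot :: "'a::euclidean_space set \<Rightarrow> 'a set \<Rightarrow> 'a set" where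
  "lin_quot f q = lin q \<inter> ocomp (lin f)"

lemma subspace_lin_quot: "subspace (lin_quot f q)"
  by (simp add: lin_quot_def subspace_lin subspace_ocomp subspace_inter)

locale face_pair =
  fixes f q :: "'a::euclidean_space set"
  assumes polytope: "polytope q" and face: "f face_of q" and nonempty: "f \<noteq> {}"
begin

abbreviation "x0 \<equiv> relint_point f"
abbreviation "K \<equiv> tcone0 q f"
abbreviation "\<eta> \<equiv> onormal q"

lemma polyhedron: "polyhedron q" using polytope polytope_imp_polyhedron by blast
lemma convex: "convex q" using polytope polytope_imp_convex by blast
lemma subset: "f \<subseteq> q" using face face_of_imp_subset by blast
lemma x0: "x0 \<in> rel_interior f" "x0 \<in> f" "x0 \<in> q"
  using relint_point_in relint_point_mem face face_of_imp_convex nonempty subset by blast+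

lemma facets_aboveD: "q' \<in> facets_above f q \<Longrightarrow> q' facet_of q" "q' \<in> facets_above f q \<Longrightarrow> f \<subseteq> q'"
  by (auto simp: facets_above_def)

lemmas K_eq = tcone0_eq_feasible[OF convex face nonempty]

lemma face_pair_facet:
  assumes "q' \<in> facets_above f q" shows "face_pair f q'"
proof
  show "polytope q'" using assms polytope face_of_polytope_polytope
    by (auto simp: facets_above_def facet_of_def)
  show "f face_of q'"
    using assms face_of_subset[OF face] facet_of_imp_subset by (auto simp: facets_above_def)
qed (rule nonempty)

lemma onormal_in_lin_quot:
  assumes "q' \<in> facets_above f q" shows "\<eta> q' \<in> lin_quot f q"
proof -
  have "\<eta> q' \<in> ocomp (lin f)"
    unfolding ocomp_def using assms lin_mono[of f q'] onormal_orthogonal[OF polyhedron, of q']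
    by (auto simp: facets_above_def)
  then show ?thesis using onormal_in_lin[OF polyhedron facets_aboveD(1)[OF assms]]
    by (simp add: lin_quot_def)
qed

text \<open>Facets that do not contain f stay away from the base point and put no condition on short
  steps; the others bound w by a homogeneous inequality. There are finitely many facets, so one step
  length serves all of them.\<close>

lemma mem_K_iff: "w \<in> K \<longleftrightarrow> w \<in> lin_quot f q \<and> (\<forall>q'\<in>facets_above f q. w \<bullet> \<eta> q' \<le> 0)"
proof (intro iffI conjI ballI)
  assume w: "w \<in> K"
  then show "w \<in> lin_quot f q"
    using K_eq feasible_subset_lin[OF x0(3)] by (auto simp: lin_quot_def)
  fix q' assume q': "q' \<in> facets_above f q"
  from w obtain e where e: "e > 0" "x0 + e *\<^sub>R w \<in> q" unfolding K_eq feasible_def by auto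
  have "((x0 + e *\<^sub>R w) - x0) \<bullet> \<eta> q' \<le> 0"
    using onormal_outward[OF polyhedron facets_aboveD(1)[OF q'] e(2)] x0(2) facets_aboveD(2)[OF q'] by blast
  then show "w \<bullet> \<eta> q' \<le> 0" using e by (simp add: mult_le_0_iff)
next
  assume w: "w \<in> lin_quot f q \<and> (\<forall>q'\<in>facets_above f q. w \<bullet> \<eta> q' \<le> 0)"
  have "\<exists>e>0. \<forall>d. 0 < d \<and> d \<le> e \<longrightarrow> (\<forall>x\<in>q'. (x0 + d *\<^sub>R w - x) \<bullet> \<eta> q' \<le> 0)"
    if q': "q' facet_of q" for q'
  proof (cases "f \<subseteq> q'")
    case True
    have "(x0 + d *\<^sub>R w - x) \<bullet> \<eta> q' \<le> 0" if "0 < d" "x \<in> q'" for d x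
    proof -
      have "(x0 - x) \<bullet> \<eta> q' = 0"
        using True x0(2) that by (intro onormal_orthogonal[OF polyhedron q'] diff_in_lin) auto
      moreover have "w \<bullet> \<eta> q' \<le> 0" using w q' True by (auto simp: facets_above_def)
      ultimately show ?thesis
        using that by (simp add: inner_diff_left inner_add_left mult_nonneg_nonpos)
    qed
    then show ?thesis by (intro exI[of _ 1]) auto
  next
    case False
    obtain x1 where x1: "x1 \<in> q'" using q' by (auto simp: facet_of_def)
    \<comment> \<open>A face that meets the relative interior of f contains all of f.\<close>
    have "x0 \<notin> q'"
      using False subset_of_face_of[OF facet_of_imp_face_of[OF q'] subset] x0(1) by blast
    then have "(x0 - x1) \<bullet> \<eta> q' \<noteq> 0" "(x0 - x1) \<bullet> \<eta> q' \<le> 0"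
      using onormal_zero_imp_mem[OF polyhedron q' x0(3) x1] onormal_outward[OF polyhedron q' x0(3) x1] by auto
    then have neg: "(x0 - x1) \<bullet> \<eta> q' < 0" by simp
    \<comment> \<open>The slack at the base point divided by a bound on the speed towards the facet;
      the summand 1 avoids division by 0.\<close>
    define e where "e = - ((x0 - x1) \<bullet> \<eta> q') / (\<bar>w \<bullet> \<eta> q'\<bar> + 1)"
    have "e > 0" unfolding e_def using neg by (intro divide_pos_pos) auto
    moreover have "(x0 + d *\<^sub>R w - x) \<bullet> \<eta> q' \<le> 0" if "0 < d" "d \<le> e" "x \<in> q'" for d x
    proof -
      have "(x1 - x) \<bullet> \<eta> q' = 0"
        using x1 that by (intro onormal_orthogonal[OF polyhedron q'] diff_in_lin) auto
      moreover have "d * (w \<bullet> \<eta> q') \<le> - ((x0 - x1) \<bullet> \<eta> q')"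
      proof -
        have "d * (w \<bullet> \<eta> q') \<le> d * (\<bar>w \<bullet> \<eta> q'\<bar> + 1)" using that by (intro mult_left_mono) auto
        also have "\<dots> \<le> e * (\<bar>w \<bullet> \<eta> q'\<bar> + 1)" using that by (intro mult_right_mono) auto
        also have "\<dots> = - ((x0 - x1) \<bullet> \<eta> q')"
          unfolding e_def by (simp add: add_nonneg_eq_0_iff)
        finally show ?thesis .
      qed
      ultimately show ?thesis by (simp add: inner_diff_left inner_add_left)
    qed
    ultimately show ?thesis by blast
  qed
  then obtain e where e: "\<And>q'. q' facet_of q \<Longrightarrow> e q' > 0"
    "\<And>q' d x. q' facet_of q \<Longrightarrow> 0 < d \<Longrightarrow> d \<le> e q' \<Longrightarrow> x \<in> q' \<Longrightarrow> (x0 + d *\<^sub>R w - x) \<bullet> \<eta> q' \<le> 0"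
    by metis
  \<comment> \<open>The inserted 1 covers a polytope without facets.\<close>
  define E where "E = Min (insert 1 (e ` {q'. q' facet_of q}))"
  have fin: "finite (insert 1 (e ` {q'. q' facet_of q}))"
    using finite_polytope_facets[OF polytope] by auto
  have "E > 0" unfolding E_def using fin e(1) by (subst Min_gr_iff) auto
  moreover have "x0 + d *\<^sub>R w \<in> q" if d: "0 < d" "d \<le> E" for d
  proof (rule ccontr)
    assume "x0 + d *\<^sub>R w \<notin> q"
    moreover have "x0 + d *\<^sub>R w \<in> affine hull q"
      using w x0(3) by (intro add_lin_in_affine_hull subspace_scale subspace_lin) (auto simp: lin_quot_def)
    ultimately obtain q' where q': "q' facet_of q" "\<And>x. x \<in> q' \<Longrightarrow> (x0 + d *\<^sub>R w - x) \<bullet> \<eta> q' > 0"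
      using facet_separates[OF polytope] by metis
    obtain x1 where x1: "x1 \<in> q'" using q' by (auto simp: facet_of_def)
    have "E \<le> e q'" unfolding E_def using fin q'(1) by (intro Min_le) auto
    then show False using e(2)[OF q'(1) d(1) _ x1] q'(2)[OF x1] d by linarith
  qed
  ultimately have "w \<in> feasible q x0" unfolding feasible_def by blast
  then show "w \<in> K" using w by (simp add: K_eq lin_quot_def)
qed

lemma closed_K: "closed K"
proof -
  have "K = lin_quot f q \<inter> (\<Inter>q'\<in>facets_above f q. {w. \<eta> q' \<bullet> w \<le> 0})"
    by (auto simp: mem_K_iff inner_commute)
  then show ?thesis
    by (simp add: closed_Int closed_INT closed_halfspace_le closed_subspace subspace_lin_quot)
qed

lemma K_add: "x \<in> K \<Longrightarrow> y \<in> K \<Longrightarrow> x + y \<in> K"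
  by (auto simp: mem_K_iff inner_add_left subspace_add[OF subspace_lin_quot] add_nonpos_nonpos)

lemma K_scale: "x \<in> K \<Longrightarrow> t \<ge> 0 \<Longrightarrow> t *\<^sub>R x \<in> K"
  by (auto simp: mem_K_iff subspace_scale[OF subspace_lin_quot] mult_nonneg_nonpos)

text \<open>If w and -w are both feasible, the base point is the midpoint of a segment in q. The
  face property puts the segment into f, so w lies in \<open>lin f\<close> and is also orthogonal to
  it.\<close>

lemma K_pointed:
  assumes "w \<in> K" "- w \<in> K" shows "w = 0"
proof -
  obtain e where e: "e > 0" "\<And>d. 0 < d \<Longrightarrow> d \<le> e \<Longrightarrow> x0 + d *\<^sub>R w \<in> q"
    using assms(1) unfolding K_eq feasible_def by auto
  obtain e' where e': "e' > 0" "\<And>d. 0 < d \<Longrightarrow> d \<le> e' \<Longrightarrow> x0 + d *\<^sub>R (- w) \<in> q"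
    using assms(2) unfolding K_eq feasible_def by auto
  define d where "d = min e e'"
  have d: "d > 0" "x0 + d *\<^sub>R w \<in> q" "x0 - d *\<^sub>R w \<in> q"
    using e(1) e'(1) e(2)[of d] e'(2)[of d] by (auto simp: d_def)
  show ?thesis
  proof (rule ccontr)
    assume "w \<noteq> 0"
    then have "x0 \<in> open_segment (x0 - d *\<^sub>R w) (x0 + d *\<^sub>R w)"
      using d(1) by (auto simp: in_segment algebra_simps intro!: exI[of _ "1/2"]
            simp flip: scaleR_add_left)
    then have "x0 + d *\<^sub>R w \<in> f" using face d x0(2) unfolding face_of_def by blast
    then have "(x0 + d *\<^sub>R w) - x0 \<in> lin f" using x0(2) by (intro diff_in_lin)
    then have "(d *\<^sub>R w) \<bullet> w = 0" using assms(1) K_eq by (auto dest: ocompD)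
    then show False using d(1) \<open>w \<noteq> 0\<close> by simp
  qed
qed

text \<open>A short step in q in a direction orthogonal to the facet normal stays on the supporting
  hyperplane, hence in the facet.\<close>

lemma K_facet:
  assumes q': "q' \<in> facets_above f q"
  shows "tcone0 q' f = {w \<in> K. w \<bullet> \<eta> q' = 0}"
proof -
  interpret F: face_pair f q' by (rule face_pair_facet[OF q'])
  note facet = facets_aboveD[OF q']
  have "feasible q' x0 = {w \<in> feasible q x0. w \<bullet> \<eta> q' = 0}"
  proof (intro equalityI subsetI CollectI conjI)
    fix w assume w: "w \<in> feasible q' x0"
    show "w \<in> feasible q x0" using w feasible_mono[OF facet_of_imp_subset[OF facet(1)]] by blast
    show "w \<bullet> \<eta> q' = 0"
      using w feasible_subset_lin[OF F.x0(3)] onormal_orthogonal[OF polyhedron facet(1)] by blast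
  next
    fix w assume "w \<in> {w \<in> feasible q x0. w \<bullet> \<eta> q' = 0}"
    then obtain e where e: "e > 0" "\<And>d. 0 < d \<Longrightarrow> d \<le> e \<Longrightarrow> x0 + d *\<^sub>R w \<in> q" and w: "w \<bullet> \<eta> q' = 0"
      by (auto simp: feasible_def)
    have "x0 + d *\<^sub>R w \<in> q'" if "0 < d" "d \<le> e" for d
      by (rule onormal_zero_imp_mem[OF polyhedron facet(1) e(2)[OF that] F.x0(3)]) (simp add: w)
    then show "w \<in> feasible q' x0" using e(1) by (auto simp: feasible_def)
  qed
  then show ?thesis by (auto simp: K_eq F.K_eq)
qed

text \<open>\<open>lin q'\<close> is contained in the hyperplane of \<open>lin q\<close> orthogonal
  to the normal, and the dimensions agree because q' has codimension 1.\<close>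

lemma lin_quot_facet:
  assumes q': "q' \<in> facets_above f q"
  shows "lin_quot f q' = {y \<in> lin_quot f q. y \<bullet> \<eta> q' = 0}"
proof -
  note facet = facets_aboveD[OF q'] and \<eta> = onormal_facet[OF polyhedron facets_aboveD(1)[OF q']]
  define H where "H = {y \<in> lin q. y \<bullet> \<eta> q' = 0}"
  have subH: "subspace H"
    using subspace_lin[of q] by (auto simp: H_def subspace_def inner_add_left)
  have sub: "lin q' \<subseteq> H"
    using lin_mono[OF facet_of_imp_subset[OF facet(1)]] \<eta>(3) by (auto simp: H_def)
  have "dim H \<noteq> dim (lin q)"
  proof
    assume "dim H = dim (lin q)"
    then have "H = lin q" by (intro subspace_dim_equal subH subspace_lin) (auto simp: H_def)
    then have "\<eta> q' \<in> H" using \<eta>(1) by blast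
    then show False using \<eta>(2) by (simp add: H_def norm_eq_1)
  qed
  moreover have "dim H \<le> dim (lin q)" by (rule dim_subset) (auto simp: H_def)
  moreover have "int (dim (lin q')) = int (dim (lin q)) - 1"
  proof -
    have "q' \<noteq> {}" "q \<noteq> {}" using facet(1) subset nonempty by (auto simp: facet_of_def)
    then show ?thesis using dim_lin[of q'] dim_lin[of q] facet(1) by (simp add: facet_of_def)
  qed
  ultimately have "lin q' = H"
    by (intro subspace_dim_equal subspace_lin subH sub) linarith
  then show ?thesis by (auto simp: lin_quot_def H_def)
qed

lemma facets_above_nonempty: "f \<noteq> q \<Longrightarrow> facets_above f q \<noteq> {}"
  using face_of_polyhedron_subset_facet[OF polyhedron face nonempty] by (auto simp: facets_above_def)

text \<open>Take the step from the base point of f to a relative interior point of q and drop its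
  component in \<open>lin f\<close>. The facet normals involved are orthogonal to
  \<open>lin f\<close>, so the strict inequalities survive.\<close>

lemma interior_direction:
  obtains c where "c \<in> lin_quot f q" "\<And>q'. q' \<in> facets_above f q \<Longrightarrow> c \<bullet> \<eta> q' < 0"
proof -
  obtain y where y: "y \<in> rel_interior q" "y \<in> q"
    using rel_interior_eq_empty[OF convex] subset nonempty rel_interior_subset by blast
  obtain u c where uc: "u \<in> lin f" "c \<in> ocomp (lin f)" "y - x0 = u + c"
    using orthogonal_decomposition[OF subspace_lin] by blast
  have "c = (y - x0) - u" using uc by simp
  then have "c \<in> lin q"
    using uc(1) lin_mono[OF subset] diff_in_lin[OF y(2) x0(3)] subspace_diff[OF subspace_lin] by blast
  moreover have "c \<bullet> \<eta> q' < 0" if q': "q' \<in> facets_above f q" for q'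
  proof -
    note facet = facets_aboveD[OF q']
    have "u \<bullet> \<eta> q' = 0"
      using onormal_orthogonal[OF polyhedron facet(1)] uc(1) lin_mono[OF facet(2)] by blast
    moreover have "q' \<noteq> q" using facet(1) by (auto simp: facet_of_def)
    then have "y \<notin> q'"
      using y(1) face_of_disjoint_rel_interior[of q' q] facet(1) by (auto simp: facet_of_def)
    then have "(y - x0) \<bullet> \<eta> q' \<noteq> 0"
      using onormal_zero_imp_mem[OF polyhedron facet(1) y(2)] x0(2) facet(2) by blast
    moreover have "(y - x0) \<bullet> \<eta> q' \<le> 0"
      using onormal_outward[OF polyhedron facet(1) y(2)] x0(2) facet(2) by blast
    ultimately show ?thesis by (simp add: uc(3) inner_add_left)
  qed
  ultimately show ?thesis using that uc(2) by (simp add: lin_quot_def)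
qed

text \<open>Both facets contain the base point of f, so equal normals give the same supporting
  hyperplane, whose intersection with q is each of the two facets.\<close>

lemma onormal_inj:
  assumes "q1 \<in> facets_above f q" "q2 \<in> facets_above f q" "\<eta> q1 = \<eta> q2"
  shows "q1 = q2"
proof -
  have sub: "q1 \<subseteq> q2" if q: "q1 \<in> facets_above f q" "q2 \<in> facets_above f q" "\<eta> q1 = \<eta> q2" for q1 q2
  proof
    fix y assume "y \<in> q1"
    have "(y - x0) \<bullet> \<eta> q1 = 0"
      using \<open>y \<in> q1\<close> facets_aboveD[OF q(1)] x0(2)
      by (intro onormal_orthogonal[OF polyhedron] diff_in_lin) auto
    moreover have "y \<in> q"
      using \<open>y \<in> q1\<close> facet_of_imp_subset[OF facets_aboveD(1)[OF q(1)]] by blast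
    moreover have "x0 \<in> q2" using x0(2) facets_aboveD(2)[OF q(2)] by blast
    ultimately show "y \<in> q2"
      using onormal_zero_imp_mem[OF polyhedron facets_aboveD(1)[OF q(2)]] q(3) by simp
  qed
  show ?thesis
    by (rule subset_antisym[OF sub[OF assms] sub[OF assms(2,1) assms(3)[symmetric]]])
qed

end

text \<open>A uniform bound on the modulus of the exponential, which depends only on the real part
  of \<open>\<alpha>\<close>. Unlike integrability it is visibly open in \<open>\<alpha>\<close> and
  inherited by subcones; for transverse cones it implies integrability.\<close>

definition decays :: "'a::euclidean_space \<times> 'a \<Rightarrow> 'a set \<Rightarrow> bool" where
  "decays \<alpha> M \<longleftrightarrow> (\<exists>e>0. \<forall>w\<in>M. fst \<alpha> \<bullet> w \<le> - e * norm w)"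

lemma decays_subset: "decays \<alpha> M \<Longrightarrow> N \<subseteq> M \<Longrightarrow> decays \<alpha> N"
  unfolding decays_def by blast

text \<open>Half of the decay rate is spent on absorbing the perturbation of the real part.\<close>

lemma open_decays: "open {\<alpha>. decays \<alpha> M}"
proof (unfold open_contains_ball, intro ballI)
  fix \<alpha> assume "\<alpha> \<in> {\<alpha>. decays \<alpha> M}"
  then obtain e where e: "e > 0" "\<And>w. w \<in> M \<Longrightarrow> fst \<alpha> \<bullet> w \<le> - e * norm w" by (auto simp: decays_def)
  have "decays \<beta> M" if "\<beta> \<in> ball \<alpha> (e / 2)" for \<beta>
  proof -
    have "norm (fst \<beta> - fst \<alpha>) \<le> e / 2"
      using that dist_fst_le[of \<beta> \<alpha>] by (simp add: dist_norm norm_minus_commute)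
    have "fst \<beta> \<bullet> w \<le> - (e / 2) * norm w" if "w \<in> M" for w
    proof -
      have "fst \<beta> \<bullet> w = fst \<alpha> \<bullet> w + (fst \<beta> - fst \<alpha>) \<bullet> w" by (simp add: inner_diff_left)
      also have "(fst \<beta> - fst \<alpha>) \<bullet> w \<le> norm (fst \<beta> - fst \<alpha>) * norm w" by (rule norm_cauchy_schwarz)
      also have "\<dots> \<le> (e / 2) * norm w" by (rule mult_right_mono) (use \<open>_ \<le> e / 2\<close> in auto)
      also have "fst \<alpha> \<bullet> w \<le> - e * norm w" using e that by blast
      finally show ?thesis by simp
    qed
    then show ?thesis using e(1) unfolding decays_def by (auto intro!: exI[of _ "e/2"])
  qed
  then show "\<exists>e>0. ball \<alpha> e \<subseteq> {\<alpha>. decays \<alpha> M}" using e(1) by (intro exI[of _ "e/2"]) auto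
qed

text \<open>The sum of the outward normals works: every summand is nonpositive on the cone, and all
  of them vanish only at 0 because the cone is pointed. Compactness of the unit sphere turns strict
  negativity into a uniform rate.\<close>

lemma (in face_pair) exists_decays:
  obtains a where "a \<in> lin_quot f q" "\<And>b. decays (a, b) K"
proof -
  define a where "a = (\<Sum>q'\<in>facets_above f q. \<eta> q')"
  have fin: "finite (facets_above f q)" by (rule finite_facets_above[OF polytope])
  have a: "a \<in> lin_quot f q"
    unfolding a_def by (intro subspace_sum subspace_lin_quot onormal_in_lin_quot)
  have aw: "a \<bullet> w = (\<Sum>q'\<in>facets_above f q. w \<bullet> \<eta> q')" for w
    unfolding a_def by (subst inner_commute) (rule inner_sum_right)
  have neg: "a \<bullet> w < 0" if "w \<in> K" "w \<noteq> 0" for w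
  proof -
    have le: "w \<bullet> \<eta> q' \<le> 0" if "q' \<in> facets_above f q" for q' using \<open>w \<in> K\<close> that by (simp add: mem_K_iff)
    then have "a \<bullet> w \<le> 0" unfolding aw by (rule sum_nonpos)
    moreover have "a \<bullet> w \<noteq> 0"
    proof
      assume "a \<bullet> w = 0"
      then have "(\<Sum>q'\<in>facets_above f q. - (w \<bullet> \<eta> q')) = 0" by (simp add: aw sum_negf)
      then have "\<forall>q'\<in>facets_above f q. w \<bullet> \<eta> q' = 0"
        using fin le by (subst (asm) sum_nonneg_eq_0_iff) auto
      then have "- w \<in> K" using \<open>w \<in> K\<close> by (auto simp: mem_K_iff subspace_neg[OF subspace_lin_quot])
      then show False using K_pointed that by blast
    qed
    ultimately show ?thesis by simp
  qed
  have "\<exists>e>0. \<forall>w\<in>K \<inter> sphere 0 1. a \<bullet> w \<le> - e"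
  proof (cases "K \<inter> sphere 0 1 = {}")
    case False
    have "compact (K \<inter> sphere 0 1)" by (simp add: closed_Int_compact closed_K)
    moreover have "continuous_on (K \<inter> sphere 0 1) (\<lambda>w. a \<bullet> w)" by (intro continuous_intros)
    ultimately obtain w0 where w0: "w0 \<in> K \<inter> sphere 0 1" "\<And>w. w \<in> K \<inter> sphere 0 1 \<Longrightarrow> a \<bullet> w \<le> a \<bullet> w0"
      using continuous_attains_sup[OF _ False] by blast
    then have "a \<bullet> w0 < 0" by (intro neg) auto
    then show ?thesis using w0(2) by (intro exI[of _ "- (a \<bullet> w0)"]) auto
  qed (auto intro!: exI[of _ 1])
  then obtain e where e: "e > 0" "\<And>w. w \<in> K \<Longrightarrow> norm w = 1 \<Longrightarrow> a \<bullet> w \<le> - e" by auto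
  have "a \<bullet> w \<le> - e * norm w" if "w \<in> K" for w
  proof (cases "w = 0")
    case False
    have "(inverse (norm w)) *\<^sub>R w \<in> K" by (rule K_scale[OF that]) simp
    then have "a \<bullet> ((inverse (norm w)) *\<^sub>R w) \<le> - e" by (rule e(2)) (use False in auto)
    then show ?thesis using False by (simp add: field_simps)
  qed simp
  then have "\<And>b. decays (a, b) K" using e(1) by (auto simp: decays_def)
  then show ?thesis using that a by blast
qed

section \<open>Stokes' formula for exponential integrals over transverse cones\<close>

abbreviation cone_exp :: "'a::euclidean_space set \<Rightarrow> 'a \<times> 'a \<Rightarrow> 'a \<Rightarrow> complex" where
  "cone_exp M \<alpha> x \<equiv> indicator M x *\<^sub>R exp (cpair \<alpha> x)"

abbreviation face_int :: "'a::euclidean_space set \<Rightarrow> 'a set \<Rightarrow> 'a \<times> 'a \<Rightarrow> complex" where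
  "face_int f q \<alpha> \<equiv> cone_int (lin_quot f q) (tcone0 q f) \<alpha>"

lemma continuous_cpair: "continuous_on UNIV (cpair \<alpha>)"
  using linear_cpair by (rule linear_continuous_on[OF linear_conv_bounded_linear[THEN iffD1]])

lemma cone_exp_measurable: "M \<in> sets borel \<Longrightarrow> cone_exp M \<alpha> \<in> borel_measurable borel"
proof -
  have "(\<lambda>x. exp (cpair \<alpha> x)) \<in> borel_measurable borel"
    by (intro borel_measurable_continuous_onI continuous_intros continuous_cpair)
  then show "M \<in> sets borel \<Longrightarrow> ?thesis"
    by (intro borel_measurable_scaleR borel_measurable_indicator)
qed

lemma Re_cpair [simp]: "Re (cpair \<alpha> x) = fst \<alpha> \<bullet> x"
  by (simp add: cpair_def)

lemma cpair_add: "cpair \<alpha> (x + y) = cpair \<alpha> x + cpair \<alpha> y"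
  by (rule linear_add[OF linear_cpair])

lemma cpair_scale: "cpair \<alpha> (t *\<^sub>R x) = of_real t * cpair \<alpha> x"
  by (simp add: linear_scale[OF linear_cpair] scaleR_conv_of_real)

lemma decays_imp_neg: "decays \<alpha> M \<Longrightarrow> w \<in> M \<Longrightarrow> w \<noteq> 0 \<Longrightarrow> fst \<alpha> \<bullet> w < 0"
  unfolding decays_def by (smt (verit) mult_pos_pos mult_minus_left zero_less_norm_iff)

context face_pair
begin

context
  fixes c assumes c: "c \<in> lin_quot f q" and c_neg: "\<And>q'. q' \<in> facets_above f q \<Longrightarrow> c \<bullet> \<eta> q' < 0"
begin

text \<open>The part of the cone that is swept out from the facet \<open>q'\<close> in direction \<open>c\<close>.\<close>

definition slab :: "'a set \<Rightarrow> 'a set" where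
  "slab q' = {x \<in> K. x - (x \<bullet> \<eta> q' / (c \<bullet> \<eta> q')) *\<^sub>R c \<in> tcone0 q' f}"

lemma c_in_K: "c \<in> K"
  using c c_neg by (auto simp: mem_K_iff less_imp_le)

lemma slab_borel: "q' \<in> facets_above f q \<Longrightarrow> slab q' \<in> sets borel"
proof -
  assume q': "q' \<in> facets_above f q"
  interpret F: face_pair f q' by (rule face_pair_facet[OF q'])
  have "slab q' = K \<inter> (\<lambda>x. x - (x \<bullet> \<eta> q' / (c \<bullet> \<eta> q')) *\<^sub>R c) -` tcone0 q' f"
    by (auto simp: slab_def)
  also have "closed \<dots>"
    by (intro closed_Int closed_K closed_vimage F.closed_K continuous_intros) (use c_neg[OF q'] in auto)
  finally show ?thesis by (rule borel_closed)
qed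

text \<open>In the coordinates (y, t) the slab is the product of the facet cone and a half-line,
  which is what lets its integral factor. The sign of t is read off from the facet inequality, as c
  points strictly inwards.\<close>

lemma mem_slab_iff:
  assumes q': "q' \<in> facets_above f q" and y: "y \<in> lin_quot f q'"
  shows "y + t *\<^sub>R c \<in> slab q' \<longleftrightarrow> y \<in> tcone0 q' f \<and> t \<ge> 0"
proof -
  have y0: "y \<bullet> \<eta> q' = 0" using y lin_quot_facet[OF q'] by auto
  note neg = c_neg[OF q']
  have "y + t *\<^sub>R c - ((y + t *\<^sub>R c) \<bullet> \<eta> q' / (c \<bullet> \<eta> q')) *\<^sub>R c = y"
    using neg by (simp add: inner_add_left y0)
  moreover have "t \<ge> 0" if "y + t *\<^sub>R c \<in> K"
    using that q' neg by (auto simp: mem_K_iff inner_add_left y0 mult_le_0_iff)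
  moreover have "y + t *\<^sub>R c \<in> K" if "y \<in> tcone0 q' f" "t \<ge> 0"
    using that K_facet[OF q'] by (intro K_add K_scale c_in_K) auto
  ultimately show ?thesis by (auto simp: slab_def)
qed

text \<open>Move from x backwards along c until the first facet hyperplane is met. The ratio
  \<open>?\<tau> q'\<close> is the time at which the hyperplane of q' is reached, and a facet with
  minimal time contains the exit point.\<close>

lemma slab_cover:
  assumes "f \<noteq> q" "x \<in> K" shows "\<exists>q'\<in>facets_above f q. x \<in> slab q'"
proof -
  let ?\<tau> = "\<lambda>q'. x \<bullet> \<eta> q' / (c \<bullet> \<eta> q')"
  have fin: "finite (facets_above f q)" by (rule finite_facets_above[OF polytope])
  obtain q' where q': "q' \<in> facets_above f q" "\<And>r. r \<in> facets_above f q \<Longrightarrow> ?\<tau> q' \<le> ?\<tau> r"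
    using ex_is_arg_min_if_finite[OF fin facets_above_nonempty[OF assms(1)], of ?\<tau>]
    by (auto simp: is_arg_min_linorder)
  define y where "y = x - ?\<tau> q' *\<^sub>R c"
  have "y \<bullet> \<eta> r \<le> 0" if "r \<in> facets_above f q" for r
  proof -
    have "x \<bullet> \<eta> r \<le> ?\<tau> q' * (c \<bullet> \<eta> r)"
      using q'(2)[OF that] c_neg[OF that] by (simp add: neg_le_divide_eq)
    then show ?thesis by (simp add: y_def inner_diff_left)
  qed
  moreover have "y \<in> lin_quot f q"
    using assms(2) c by (auto simp: y_def mem_K_iff intro!: subspace_diff subspace_scale subspace_lin_quot)
  moreover have "y \<bullet> \<eta> q' = 0" using c_neg[OF q'(1)] by (simp add: y_def inner_diff_left)
  ultimately have "y \<in> tcone0 q' f" using K_facet[OF q'(1)] mem_K_iff by auto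
  then show ?thesis using q'(1) assms(2) by (auto simp: slab_def y_def)
qed

text \<open>Membership in a slab makes its exit time minimal. In an overlap both times are minimal,
  hence equal, which is a linear equation in x.\<close>

lemma slab_overlap:
  assumes r: "r1 \<in> facets_above f q" "r2 \<in> facets_above f q" and x: "x \<in> slab r1" "x \<in> slab r2"
  shows "x \<bullet> (\<eta> r1 /\<^sub>R (c \<bullet> \<eta> r1) - \<eta> r2 /\<^sub>R (c \<bullet> \<eta> r2)) = 0"
proof -
  have "x \<bullet> \<eta> s / (c \<bullet> \<eta> s) \<ge> x \<bullet> \<eta> r / (c \<bullet> \<eta> r)"
    if "r \<in> facets_above f q" "s \<in> facets_above f q" "x \<in> slab r" for r s
  proof -
    have "x - (x \<bullet> \<eta> r / (c \<bullet> \<eta> r)) *\<^sub>R c \<in> K" using that K_facet by (auto simp: slab_def)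
    then have "(x - (x \<bullet> \<eta> r / (c \<bullet> \<eta> r)) *\<^sub>R c) \<bullet> \<eta> s \<le> 0" using that(2) by (simp add: mem_K_iff)
    then show ?thesis using c_neg[OF that(2)] by (simp add: inner_diff_left neg_le_divide_eq)
  qed
  then have "x \<bullet> \<eta> r1 / (c \<bullet> \<eta> r1) = x \<bullet> \<eta> r2 / (c \<bullet> \<eta> r2)" using r x by (meson order_antisym)
  then show ?thesis by (simp add: inner_diff_right divide_inverse mult.commute)
qed

text \<open>Both normals have length 1 and a negative product with c, so proportionality would make
  them equal, against \<open>onormal_inj\<close>. Thus the equation for an overlap is
  nontrivial.\<close>

lemma slab_separating_normal:
  assumes r: "r1 \<in> facets_above f q" "r2 \<in> facets_above f q" "r1 \<noteq> r2"
  shows "\<eta> r1 /\<^sub>R (c \<bullet> \<eta> r1) - \<eta> r2 /\<^sub>R (c \<bullet> \<eta> r2) \<noteq> 0"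
proof
  assume "\<eta> r1 /\<^sub>R (c \<bullet> \<eta> r1) - \<eta> r2 /\<^sub>R (c \<bullet> \<eta> r2) = 0"
  then have eq: "\<eta> r1 /\<^sub>R (c \<bullet> \<eta> r1) = \<eta> r2 /\<^sub>R (c \<bullet> \<eta> r2)" by simp
  then have "norm (\<eta> r1 /\<^sub>R (c \<bullet> \<eta> r1)) = norm (\<eta> r2 /\<^sub>R (c \<bullet> \<eta> r2))" by simp
  then have "c \<bullet> \<eta> r1 = c \<bullet> \<eta> r2"
    using norm_onormal[OF polyhedron facets_aboveD(1)] r c_neg[OF r(1)] c_neg[OF r(2)] by simp
  then have "\<eta> r1 = \<eta> r2" using eq c_neg[OF r(1)] by simp
  then show False using onormal_inj r by blast
qed

text \<open>Off finitely many hyperplanes a point of the cone lies in exactly one slab. The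
  condition f \<noteq> q guarantees that there is a facet to exit through.\<close>

lemma AE_slab_decomposition:
  assumes "f \<noteq> q"
  shows "AE x in lebW (lin_quot f q). (indicator K x :: real) = (\<Sum>q'\<in>facets_above f q. indicator (slab q') x)"
proof -
  have fin: "finite (facets_above f q)" by (rule finite_facets_above[OF polytope])
  let ?n = "\<lambda>r1 r2. \<eta> r1 /\<^sub>R (c \<bullet> \<eta> r1) - \<eta> r2 /\<^sub>R (c \<bullet> \<eta> r2)"
  have "AE x in lebW (lin_quot f q). \<forall>r1\<in>facets_above f q. \<forall>r2\<in>facets_above f q. r1 \<noteq> r2 \<longrightarrow> x \<bullet> ?n r1 r2 \<noteq> 0"
  proof (intro AE_finite_allI fin)
    fix r1 r2 assume r: "r1 \<in> facets_above f q" "r2 \<in> facets_above f q"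
    show "AE x in lebW (lin_quot f q). r1 \<noteq> r2 \<longrightarrow> x \<bullet> ?n r1 r2 \<noteq> 0"
    proof (cases "r1 = r2")
      case False
      have "AE x in lebW (lin_quot f q). x \<bullet> ?n r1 r2 \<noteq> 0"
        by (intro AE_lebW_not_hyperplane subspace_lin_quot subspace_diff subspace_scale
              onormal_in_lin_quot r slab_separating_normal False)
      then show ?thesis by simp
    qed simp
  qed
  then show ?thesis
  proof eventually_elim
    case (elim x)
    show ?case
    proof (cases "x \<in> K")
      case True
      then obtain r where r: "r \<in> facets_above f q" "x \<in> slab r" using slab_cover[OF assms] by blast
      have "x \<in> slab s \<longleftrightarrow> s = r" if "s \<in> facets_above f q" for s
        using slab_overlap[OF that r(1)] elim r that by blast
      then have "(\<Sum>q'\<in>facets_above f q. indicator (slab q') x) = (\<Sum>q'\<in>facets_above f q. if q' = r then 1 else (0::real))"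
        by (intro sum.cong) (auto simp: indicator_def)
      then show ?thesis using True fin r(1) by simp
    next
      case False
      then have "x \<notin> slab s" for s by (simp add: slab_def)
      then show ?thesis using False by simp
    qed
  qed
qed

lemma slab_integral:
  assumes \<alpha>: "decays \<alpha> K" and q': "q' \<in> facets_above f q"
    and int: "integrable (lebW (lin_quot f q')) (cone_exp (tcone0 q' f) \<alpha>)"
  shows "has_bochner_integral (lebW (lin_quot f q)) (cone_exp (slab q') \<alpha>)
           (of_real (c \<bullet> \<eta> q') * face_int f q' \<alpha> / cpair \<alpha> c)"
proof -
  interpret F: face_pair f q' by (rule face_pair_facet[OF q'])
  note neg = c_neg[OF q'] and \<eta> = onormal_facet[OF polyhedron facets_aboveD(1)[OF q']]
  \<comment> \<open>Rescaled to have product -1 with the outward normal: c' then differs from the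
    inward unit normal by a vector in the space of the facet, as the shear formula requires.\<close>
  define c' where "c' = (- inverse (c \<bullet> \<eta> q')) *\<^sub>R c"
  have c'\<eta>: "c' \<bullet> \<eta> q' = - 1" using neg by (simp add: c'_def)
  have c'_in: "c' \<in> lin_quot f q" unfolding c'_def by (intro subspace_scale subspace_lin_quot c)
  have "c \<noteq> 0" using neg by auto
  then have cneg: "fst \<alpha> \<bullet> c < 0" using decays_imp_neg[OF \<alpha> c_in_K] by blast
  have cpair_c: "cpair \<alpha> c \<noteq> 0" using cneg by (metis Re_cpair less_irrefl zero_complex.simps(1))
  have L: "lin_quot f q = {y + t *\<^sub>R c' | y t. y \<in> lin_quot f q'}"
  proof (intro equalityI subsetI)
    fix x assume x: "x \<in> lin_quot f q"
    have "x + (x \<bullet> \<eta> q') *\<^sub>R c' \<in> lin_quot f q'"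
      using x c'_in unfolding lin_quot_facet[OF q']
      by (auto simp: inner_add_left c'\<eta> intro!: subspace_add subspace_scale subspace_lin_quot)
    moreover have "x = (x + (x \<bullet> \<eta> q') *\<^sub>R c') + (- (x \<bullet> \<eta> q')) *\<^sub>R c'" by simp
    ultimately show "x \<in> {y + t *\<^sub>R c' | y t. y \<in> lin_quot f q'}" by blast
  next
    fix x assume "x \<in> {y + t *\<^sub>R c' | y t. y \<in> lin_quot f q'}"
    then show "x \<in> lin_quot f q"
      using c'_in lin_quot_facet[OF q'] by (auto intro!: subspace_add subspace_scale subspace_lin_quot)
  qed
  have eq: "lebW (lin_quot f q)
      = distr (lebW (lin_quot f q') \<Otimes>\<^sub>M lborel) borel (\<lambda>(y, t). y + t *\<^sub>R c')"
  proof (rule lebW_shear[where \<eta> = "- \<eta> q'"])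
    show "c' - - \<eta> q' \<in> lin_quot f q'"
      using c'_in onormal_in_lin_quot[OF q'] \<eta>(2) unfolding lin_quot_facet[OF q']
      by (auto simp: inner_add_left c'\<eta> norm_eq_1 intro!: subspace_add subspace_lin_quot)
    show "norm (- \<eta> q') = 1" using \<eta>(2) by simp
    show "y \<bullet> - \<eta> q' = 0" if "y \<in> lin_quot f q'" for y
      using that by (simp add: lin_quot_facet[OF q'])
  qed (rule subspace_lin_quot L)+
  have "Re (cpair \<alpha> c') < 0" using cneg neg by (simp add: c'_def mult_less_0_iff zero_less_mult_iff)
  have "has_bochner_integral (lebW (lin_quot f q)) (cone_exp (slab q') \<alpha>)
      (face_int f q' \<alpha> * (- 1 / cpair \<alpha> c'))"
    unfolding eq
  proof (rule has_bochner_integral_distr_pair)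
    show "has_bochner_integral (lebW (lin_quot f q')) (cone_exp (tcone0 q' f) \<alpha>) (face_int f q' \<alpha>)"
      unfolding cone_int_def by (rule has_bochner_integral_integrable[OF int])
    show "has_bochner_integral lborel (\<lambda>t::real. indicator {0..} t *\<^sub>R exp (of_real t * cpair \<alpha> c')) (- 1 / cpair \<alpha> c')"
      by (rule has_bochner_integral_exp_half_line) fact
    show "AE y in lebW (lin_quot f q'). y \<in> lin_quot f q'" by (rule AE_lebW[OF subspace_lin_quot])
    show "AE t in lborel. t \<in> (UNIV :: real set)" by simp
    show "cone_exp (slab q') \<alpha> \<in> borel_measurable borel" by (rule cone_exp_measurable[OF slab_borel[OF q']])
    fix y :: 'a and t :: real assume y: "y \<in> lin_quot f q'"
    have "y + t *\<^sub>R c' \<in> slab q' \<longleftrightarrow> y \<in> tcone0 q' f \<and> t \<ge> 0"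
      using mem_slab_iff[OF q' y, of "t * (- inverse (c \<bullet> \<eta> q'))"] neg
      by (simp add: c'_def zero_le_mult_iff mult_le_0_iff)
    then show "cone_exp (slab q') \<alpha> (case (y, t) of (y, t) \<Rightarrow> y + t *\<^sub>R c')
       = cone_exp (tcone0 q' f) \<alpha> y * (indicator {0..} t *\<^sub>R exp (of_real t * cpair \<alpha> c'))"
      by (auto simp: indicator_def cpair_add cpair_scale exp_add)
  qed (auto simp: sigma_finite_lebW subspace_lin_quot sigma_finite_lborel)
  moreover have "cpair \<alpha> c' = - (cpair \<alpha> c / of_real (c \<bullet> \<eta> q'))"
    unfolding c'_def cpair_scale by (simp add: divide_inverse)
  \<comment> \<open>Undoing the rescaling turns the half-line integral into the coefficient of
    Stokes' formula, divided by the pairing with c.\<close>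
  then have "- 1 / cpair \<alpha> c' = of_real (c \<bullet> \<eta> q') / cpair \<alpha> c"
    using neg cpair_c by simp
  ultimately have "has_bochner_integral (lebW (lin_quot f q)) (cone_exp (slab q') \<alpha>)
      (face_int f q' \<alpha> * (of_real (c \<bullet> \<eta> q') / cpair \<alpha> c))"
    by (simp only:)
  then show ?thesis by (simp add: mult.commute)
qed

lemma cone_integral_step:
  assumes "f \<noteq> q" and \<alpha>: "decays \<alpha> K"
    and int: "\<And>q'. q' \<in> facets_above f q \<Longrightarrow> integrable (lebW (lin_quot f q')) (cone_exp (tcone0 q' f) \<alpha>)"
  shows "has_bochner_integral (lebW (lin_quot f q)) (cone_exp K \<alpha>)
           (\<Sum>q'\<in>facets_above f q. of_real (c \<bullet> \<eta> q') * face_int f q' \<alpha> / cpair \<alpha> c)"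
proof -
  have sum: "has_bochner_integral (lebW (lin_quot f q))
      (\<lambda>x. \<Sum>q'\<in>facets_above f q. cone_exp (slab q') \<alpha> x)
      (\<Sum>q'\<in>facets_above f q. of_real (c \<bullet> \<eta> q') * face_int f q' \<alpha> / cpair \<alpha> c)"
    by (intro has_bochner_integral_sum slab_integral \<alpha> int)
  have "AE x in lebW (lin_quot f q). (\<Sum>q'\<in>facets_above f q. cone_exp (slab q') \<alpha> x) = cone_exp K \<alpha> x"
    using AE_slab_decomposition[OF assms(1)]
    by eventually_elim (simp flip: scaleR_sum_left)
  then show ?thesis
    using sum has_bochner_integral_cong_AE[of "\<lambda>x. \<Sum>q'\<in>facets_above f q. cone_exp (slab q') \<alpha> x"
        "lebW (lin_quot f q)" "cone_exp K \<alpha>"]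
      cone_exp_measurable[OF borel_closed[OF closed_K], of \<alpha>]
      cone_exp_measurable[OF slab_borel, of _ \<alpha>]
    by (simp add: borel_measurable_sum measurable_cong_sets[OF sets_lebW refl])
qed

end

end

section \<open>Integrability, and Stokes' formula in arbitrary directions\<close>

lemma lin_quot_self: "lin_quot q q = {0}"
  by (auto simp: lin_quot_def subspace_0 subspace_lin subspace_ocomp) (use ocompD inner_eq_zero_iff in blast)

lemma (in face_pair) K_self: "f = q \<Longrightarrow> K = {0}"
  using mem_K_iff lin_quot_self[of q] by (auto simp: subspace_0[OF subspace_lin_quot])

text \<open>The product over the empty index set is a unit point mass, so \<open>lebW {0}\<close> is
  the Dirac measure at 0. This starts the recursions with the value 1.\<close>

lemma has_bochner_integral_lebW_zero:
  fixes h :: "'a::euclidean_space \<Rightarrow> complex"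
  assumes [measurable]: "h \<in> borel_measurable borel"
  shows "has_bochner_integral (lebW {0}) h (h 0)"
proof -
  have "has_bochner_integral (PiM {..<dim {0::'a}} (\<lambda>_::nat. lborel :: real measure))
      (\<lambda>t. h (\<Sum>i<dim {0::'a}. t i *\<^sub>R onb {0} i)) (h 0)"
    by (simp add: PiM_empty has_bochner_integral_iff integrable_count_space lebesgue_integral_count_space_finite)
  then show ?thesis
    unfolding lebW_def by (subst has_bochner_integral_distr) auto
qed

lemma cone_exp_integrable:
  assumes "face_pair f q" "decays \<alpha> (tcone0 q f)"
  shows "integrable (lebW (lin_quot f q)) (cone_exp (tcone0 q f) \<alpha>)"
  using assms
proof (induction "nat (aff_dim q)" arbitrary: q rule: less_induct)
  case less
  interpret face_pair f q by fact
  show ?case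
  proof (cases "f = q")
    case True
    then show ?thesis
      using has_bochner_integral_lebW_zero[OF cone_exp_measurable, of "{0}" \<alpha>] K_self
      by (auto simp: has_bochner_integral_iff lin_quot_self)
  next
    case False
    obtain c where c: "c \<in> lin_quot f q" "\<And>q'. q' \<in> facets_above f q \<Longrightarrow> c \<bullet> \<eta> q' < 0"
      using interior_direction by blast
    have "integrable (lebW (lin_quot f q')) (cone_exp (tcone0 q' f) \<alpha>)" if q': "q' \<in> facets_above f q" for q'
    proof (rule less.hyps)
      \<comment> \<open>\<open>nat\<close> does not distinguish -1 from 0, so nonemptiness of the
        facet is needed for a strict decrease.\<close>
      have "aff_dim q' \<ge> 0" "aff_dim q' = aff_dim q - 1"
        using facets_aboveD(1)[OF q'] aff_dim_geq[of q'] aff_dim_empty[of q'] by (auto simp: facet_of_def)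
      then show "nat (aff_dim q') < nat (aff_dim q)" by linarith
      show "face_pair f q'" by (rule face_pair_facet[OF q'])
      show "decays \<alpha> (tcone0 q' f)" using less.prems(2) by (rule decays_subset) (use K_facet[OF q'] in auto)
    qed
    from cone_integral_step[OF c False less.prems(2) this] show ?thesis
      by (auto simp: has_bochner_integral_iff)
  qed
qed

context face_pair
begin

lemma decays_facet: "q' \<in> facets_above f q \<Longrightarrow> decays \<alpha> K \<Longrightarrow> decays \<alpha> (tcone0 q' f)"
  by (erule decays_subset) (use K_facet in auto)

lemma face_int_self: "f = q \<Longrightarrow> face_int f q \<alpha> = 1"
  using has_bochner_integral_lebW_zero[OF cone_exp_measurable, of "{0}" \<alpha>] K_self
  by (auto simp: lin_quot_self has_bochner_integral_iff cone_int_def cpair_def zero_complex.code[symmetric])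

lemma face_int_interior_step:
  assumes "f \<noteq> q" and \<alpha>: "decays \<alpha> K"
    and c: "c \<in> lin_quot f q" "\<And>q'. q' \<in> facets_above f q \<Longrightarrow> c \<bullet> \<eta> q' < 0"
  shows "cpair \<alpha> c \<noteq> 0"
    and "face_int f q \<alpha> = (\<Sum>q'\<in>facets_above f q. of_real (c \<bullet> \<eta> q') * face_int f q' \<alpha>) / cpair \<alpha> c"
proof -
  have "c \<noteq> 0" using facets_above_nonempty[OF assms(1)] c(2) by fastforce
  then have "fst \<alpha> \<bullet> c < 0" using decays_imp_neg[OF \<alpha> c_in_K[OF c]] by blast
  then show "cpair \<alpha> c \<noteq> 0" by (metis Re_cpair less_irrefl zero_complex.simps(1))
  show "face_int f q \<alpha> = (\<Sum>q'\<in>facets_above f q. of_real (c \<bullet> \<eta> q') * face_int f q' \<alpha>) / cpair \<alpha> c"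
    using cone_integral_step[OF c assms(1) \<alpha> cone_exp_integrable[OF face_pair_facet decays_facet[OF _ \<alpha>]]]
    by (simp add: has_bochner_integral_iff cone_int_def sum_divide_distrib)
qed

text \<open>For small e > 0 the direction c + e v still points strictly inwards. The formula is
  known for c and for c + e v, and both sides are linear in the direction, so subtracting gives it
  for v.\<close>

lemma face_int_stokes:
  assumes "f \<noteq> q" and \<alpha>: "decays \<alpha> K" and v: "v \<in> lin_quot f q"
  shows "cpair \<alpha> v * face_int f q \<alpha> = (\<Sum>q'\<in>facets_above f q. of_real (v \<bullet> \<eta> q') * face_int f q' \<alpha>)"
proof -
  obtain c where c: "c \<in> lin_quot f q" "\<And>q'. q' \<in> facets_above f q \<Longrightarrow> c \<bullet> \<eta> q' < 0"
    using interior_direction by blast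
  have fin: "finite (facets_above f q)" by (rule finite_facets_above[OF polytope])
  have "eventually (\<lambda>e. (c + e *\<^sub>R v) \<bullet> \<eta> q' < 0) (at_right 0)" if "q' \<in> facets_above f q" for q'
  proof -
    have "((\<lambda>e. (c + e *\<^sub>R v) \<bullet> \<eta> q') \<longlongrightarrow> (c + 0 *\<^sub>R v) \<bullet> \<eta> q') (at_right 0)"
      by (intro tendsto_intros)
    then show ?thesis using c(2)[OF that] by (intro order_tendstoD(2)) auto
  qed
  then have "eventually (\<lambda>e. \<forall>q'\<in>facets_above f q. (c + e *\<^sub>R v) \<bullet> \<eta> q' < 0) (at_right 0)"
    using fin by (simp add: eventually_ball_finite)
  then have "eventually (\<lambda>e. e > 0 \<and> (\<forall>q'\<in>facets_above f q. (c + e *\<^sub>R v) \<bullet> \<eta> q' < 0)) (at_right (0::real))"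
    using eventually_at_right_less by (rule eventually_conj[rotated])
  then obtain e :: real where e: "e > 0" "\<And>q'. q' \<in> facets_above f q \<Longrightarrow> (c + e *\<^sub>R v) \<bullet> \<eta> q' < 0"
    using eventually_happens'[OF trivial_limit_at_right_real] by blast
  have ce: "c + e *\<^sub>R v \<in> lin_quot f q" by (intro subspace_add subspace_scale subspace_lin_quot c v)
  let ?S = "\<lambda>u. \<Sum>q'\<in>facets_above f q. of_real (u \<bullet> \<eta> q') * face_int f q' \<alpha>"
  have 1: "cpair \<alpha> c * face_int f q \<alpha> = ?S c"
    using face_int_interior_step[OF assms(1) \<alpha> c] by simp
  have 2: "cpair \<alpha> (c + e *\<^sub>R v) * face_int f q \<alpha> = ?S (c + e *\<^sub>R v)"
    using face_int_interior_step[OF assms(1) \<alpha> ce e(2)] by simp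
  have "?S (c + e *\<^sub>R v) = ?S c + of_real e * ?S v"
    by (simp add: inner_add_left algebra_simps sum.distrib sum_distrib_left)
  then have "of_real e * (cpair \<alpha> v * face_int f q \<alpha>) = of_real e * ?S v"
    using 1 2 by (simp add: cpair_add cpair_scale algebra_simps)
  then show ?thesis using e(1) by simp
qed

end

section \<open>Meromorphic continuation\<close>

text \<open>Decay on \<open>M\<close> is an open condition, and a shows that it can be met inside
  \<open>W\<close>; the identity theorem does the rest.\<close>

lemma mero_eq_generically:
  assumes W: "subspace W" and R: "mero W R" and S: "mero W S"
    and a: "a \<in> W" "decays (a, 0) M" and E: "open_dense W E"
    and eq: "\<And>\<alpha>. \<alpha> \<in> E \<Longrightarrow> \<alpha> \<in> cplx W \<Longrightarrow> decays \<alpha> M \<Longrightarrow> R \<alpha> = S \<alpha>"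
  shows "generically W (\<lambda>\<alpha>. R \<alpha> = S \<alpha>)"
proof -
  have "generically W (\<lambda>\<alpha>. R \<alpha> - S \<alpha> = 0)"
  proof (rule mero_identity[OF W mero_diff[OF R S] _ _ E])
    show "openin (top_of_set (cplx W)) (cplx W \<inter> {\<alpha>. decays \<alpha> M})"
      by (rule openin_open_Int[OF open_decays])
    show "cplx W \<inter> {\<alpha>. decays \<alpha> M} \<noteq> {}"
      using a subspace_0[OF W] by (auto simp: cplx_def)
  qed (use eq in auto)
  then show ?thesis by (rule generically_mono) simp
qed

text \<open>The formula for one interior direction, read as a recursion over facets, expresses the
  integral by divisions by linear forms, and these make sense for generic \<open>\<alpha>\<close>. A
  space \<open>W\<close> larger than \<open>lin_quot f q\<close> is allowed so that the factors of a
  chain become functions on one common space.\<close>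

lemma exists_face_mero:
  assumes "subspace W" "face_pair f q" "lin_quot f q \<subseteq> W"
  shows "\<exists>J. mero W J \<and> (\<forall>\<alpha>. decays \<alpha> (tcone0 q f) \<longrightarrow> J \<alpha> = face_int f q \<alpha>)"
  using assms(2,3)
proof (induction "nat (aff_dim q)" arbitrary: q rule: less_induct)
  case less
  interpret face_pair f q by fact
  show ?case
  proof (cases "f = q")
    case True
    then show ?thesis by (intro exI[of _ "\<lambda>_. 1"]) (use face_int_self[OF True] mero_const in auto)
  next
    case False
    obtain c where c: "c \<in> lin_quot f q" "\<And>q'. q' \<in> facets_above f q \<Longrightarrow> c \<bullet> \<eta> q' < 0"
      using interior_direction by blast
    have "\<exists>J. mero W J \<and> (\<forall>\<alpha>. decays \<alpha> (tcone0 q' f) \<longrightarrow> J \<alpha> = face_int f q' \<alpha>)"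
      if q': "q' \<in> facets_above f q" for q'
    proof (rule less.hyps)
      have "aff_dim q' \<ge> 0" "aff_dim q' = aff_dim q - 1"
        using facets_aboveD(1)[OF q'] aff_dim_geq[of q'] aff_dim_empty[of q'] by (auto simp: facet_of_def)
      then show "nat (aff_dim q') < nat (aff_dim q)" by linarith
      show "face_pair f q'" by (rule face_pair_facet[OF q'])
      show "lin_quot f q' \<subseteq> W" using less.prems(2) lin_quot_facet[OF q'] by blast
    qed
    then obtain J where J: "\<And>q'. q' \<in> facets_above f q \<Longrightarrow> mero W (J q')"
      "\<And>q' \<alpha>. q' \<in> facets_above f q \<Longrightarrow> decays \<alpha> (tcone0 q' f) \<Longrightarrow> J q' \<alpha> = face_int f q' \<alpha>"
      by metis
    define R where "R \<alpha> = (\<Sum>q'\<in>facets_above f q. of_real (c \<bullet> \<eta> q') * J q' \<alpha>) / cpair \<alpha> c" for \<alpha>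
    have "c \<noteq> 0" using facets_above_nonempty[OF False] c(2) by fastforce
    \<comment> \<open>Witness that the linear form in the denominator is not identically zero on
      \<open>W\<close>.\<close>
    then have "(c, 0) \<in> cplx W" "cpair (c, 0) c \<noteq> 0"
      using c(1) less.prems(2) subspace_0[OF assms(1)] by (auto simp: cplx_def cpair_def complex_eq_iff)
    then have "mero W R"
      unfolding R_def
      by (intro mero_divide_holo[OF assms(1) _ holo_on_cpair] mero_sum mero_mult mero_const J(1))
    moreover have "R \<alpha> = face_int f q \<alpha>" if "decays \<alpha> K" for \<alpha>
      using face_int_interior_step(2)[OF False that c] J(2)[OF _ decays_facet[OF _ that]]
      by (simp add: R_def)
    ultimately show ?thesis by blast
  qed
qed

text \<open>Values are prescribed only where the cone decays; elsewhere the identity theorem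
  determines them generically, which is all that is used.\<close>

definition face_mero :: "'a::euclidean_space set \<Rightarrow> 'a set \<Rightarrow> 'a set \<Rightarrow> 'a \<times> 'a \<Rightarrow> complex" where
  "face_mero W f q = (SOME J. mero W J \<and> (\<forall>\<alpha>. decays \<alpha> (tcone0 q f) \<longrightarrow> J \<alpha> = face_int f q \<alpha>))"

lemma
  assumes "subspace W" "face_pair f q" "lin_quot f q \<subseteq> W"
  shows mero_face_mero: "mero W (face_mero W f q)"
    and face_mero_eq: "\<And>\<alpha>. decays \<alpha> (tcone0 q f) \<Longrightarrow> face_mero W f q \<alpha> = face_int f q \<alpha>"
  using someI_ex[OF exists_face_mero[OF assms]] unfolding face_mero_def by blast+

text \<open>Every \<open>\<alpha>\<close> decays on the cone {0}, so the value is 1 everywhere and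
  not only generically.\<close>

lemma face_mero_self:
  assumes "subspace W" "face_pair f f" shows "face_mero W f f \<alpha> = 1"
proof -
  interpret face_pair f f by fact
  have "decays \<alpha> K" by (simp add: K_self decays_def) (metis zero_less_one)
  then show ?thesis
    using face_mero_eq[OF assms] face_int_self subspace_0[OF assms(1)] by (simp add: lin_quot_self)
qed

lemma face_mero_stokes:
  assumes W: "subspace W" and fq: "face_pair f q" "lin_quot f q \<subseteq> W" "f \<noteq> q" and v: "v \<in> lin_quot f q"
  shows "generically W (\<lambda>\<alpha>. cpair \<alpha> v * face_mero W f q \<alpha>
           = (\<Sum>q'\<in>facets_above f q. of_real (v \<bullet> onormal q q') * face_mero W f q' \<alpha>))"
proof -
  interpret face_pair f q by fact
  obtain a where a: "a \<in> lin_quot f q" "decays (a, 0) K" using exists_decays by blast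
  have sub: "lin_quot f q' \<subseteq> W" if "q' \<in> facets_above f q" for q'
    using lin_quot_facet[OF that] fq(2) by blast
  show ?thesis
  proof (rule mero_eq_generically[OF W _ _ _ a(2) open_dense_cplx])
    show "mero W (\<lambda>\<alpha>. cpair \<alpha> v * face_mero W f q \<alpha>)"
      by (intro mero_mult mero_holo[OF holo_on_cpair] mero_face_mero W fq)
    show "mero W (\<lambda>\<alpha>. \<Sum>q'\<in>facets_above f q. of_real (v \<bullet> onormal q q') * face_mero W f q' \<alpha>)"
      by (intro mero_sum mero_mult mero_const mero_face_mero W face_pair_facet sub)
    show "a \<in> W" using a fq(2) by blast
    fix \<alpha> assume \<alpha>: "decays \<alpha> K"
    have "face_mero W f q' \<alpha> = face_int f q' \<alpha>" if "q' \<in> facets_above f q" for q'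
      by (rule face_mero_eq[OF W face_pair_facet[OF that] sub[OF that] decays_facet[OF that \<alpha>]])
    then show "cpair \<alpha> v * face_mero W f q \<alpha>
        = (\<Sum>q'\<in>facets_above f q. of_real (v \<bullet> onormal q q') * face_mero W f q' \<alpha>)"
      using face_int_stokes[OF fq(3) \<alpha> v] face_mero_eq[OF W fq(1,2) \<alpha>] by simp
  qed
qed

section \<open>Products of cones along a chain of faces\<close>

definition minkowski :: "'a::euclidean_space set \<Rightarrow> 'a set \<Rightarrow> 'a set" where
  "minkowski A B = {a + b | a b. a \<in> A \<and> b \<in> B}"

lemma mem_minkowski_orthogonal:
  assumes "subspace W1" "subspace W2" and orth: "\<And>x y. x \<in> W1 \<Longrightarrow> y \<in> W2 \<Longrightarrow> x \<bullet> y = 0"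
    and "A \<subseteq> W1" "B \<subseteq> W2" "x \<in> W1" "y \<in> W2"
  shows "x + y \<in> minkowski A B \<longleftrightarrow> x \<in> A \<and> y \<in> B"
proof
  assume "x + y \<in> minkowski A B"
  then obtain a b where ab: "a \<in> A" "b \<in> B" "x + y = a + b" by (auto simp: minkowski_def)
  then have d: "x - a \<in> W1" "b - y \<in> W2" "x - a = b - y"
    using assms by (auto simp: subspace_diff subset_iff algebra_simps)
  then have "(x - a) \<bullet> (x - a) = 0" using orth by metis
  then show "x \<in> A \<and> y \<in> B" using d(3) ab by auto
qed (auto simp: minkowski_def)

text \<open>Sums of closed sets need not be closed. In orthogonal subspaces the sum is cut out by
  conditions on the two continuous projections.\<close>

lemma closed_minkowski_orthogonal:
  assumes W1: "subspace W1" and W2: "subspace W2" and orth: "\<And>x y. x \<in> W1 \<Longrightarrow> y \<in> W2 \<Longrightarrow> x \<bullet> y = 0"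
    and "A \<subseteq> W1" "B \<subseteq> W2" "closed A" "closed B"
  shows "closed (minkowski A B)"
proof -
  have cont: "continuous_on UNIV (proj W1)" "continuous_on UNIV (proj W2)"
    unfolding proj_def
    using W1 W2 subspace_0 by (auto intro!: continuous_on_closest_point subspace_imp_convex closed_subspace)
  have proj: "proj W1 (x + y) = x" "proj W2 (x + y) = y" if "x \<in> W1" "y \<in> W2" for x y
    using that orth orth[THEN trans[OF inner_commute]] by (auto intro!: proj_eqI W1 W2)
  have "minkowski A B = proj W1 -` A \<inter> proj W2 -` B \<inter> {z. proj W1 z + proj W2 z = z}"
    using assms(4,5) proj by (auto simp: minkowski_def subset_iff) (metis)
  moreover have "closed {z. proj W1 z + proj W2 z = z}"
    by (intro closed_Collect_eq continuous_intros cont)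
  ultimately show ?thesis
    using assms(6,7) by (auto intro!: closed_Int closed_vimage cont)
qed

lemma decays_minkowski:
  assumes "decays \<alpha> A" "decays \<alpha> B" shows "decays \<alpha> (minkowski A B)"
proof -
  obtain e e' where e: "e > 0" "\<And>w. w \<in> A \<Longrightarrow> fst \<alpha> \<bullet> w \<le> - e * norm w"
    "e' > 0" "\<And>w. w \<in> B \<Longrightarrow> fst \<alpha> \<bullet> w \<le> - e' * norm w"
    using assms unfolding decays_def by blast
  have "fst \<alpha> \<bullet> (a + b) \<le> - min e e' * norm (a + b)" if "a \<in> A" "b \<in> B" for a b
  proof -
    have "min e e' * norm (a + b) \<le> min e e' * (norm a + norm b)"
      using e by (intro mult_left_mono norm_triangle_ineq) auto
    also have "\<dots> \<le> e * norm a + e' * norm b"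
      by (simp add: distrib_left add_mono mult_right_mono)
    finally show ?thesis using e(2)[OF that(1)] e(4)[OF that(2)] by (simp add: inner_add_right)
  qed
  then show ?thesis using e unfolding decays_def minkowski_def
    by (intro exI[of _ "min e e'"]) auto
qed

text \<open>Along a line the norm grows in both directions while the linear term changes sign. This
  excludes the degenerate branch of \<open>is_mero_cont\<close>, in which the continuation is
  0.\<close>

lemma decays_imp_no_line:
  assumes "decays \<alpha> M" shows "\<not> contains_line M"
proof
  assume "contains_line M"
  then obtain x v where xv: "v \<noteq> 0" "\<And>t::real. x + t *\<^sub>R v \<in> M" by (auto simp: contains_line_def)
  obtain e where e: "e > 0" "\<And>w. w \<in> M \<Longrightarrow> fst \<alpha> \<bullet> w \<le> - e * norm w" using assms by (auto simp: decays_def)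
  \<comment> \<open>Chosen so that averaging the bounds at b and -b exceeds the absolute value of
    the constant term by exactly 1.\<close>
  define b where "b = (norm (fst \<alpha> \<bullet> x) + e * norm x + 1) / (e * norm v)"
  have lower: "e * (\<bar>t\<bar> * norm v - norm x) \<le> - (fst \<alpha> \<bullet> x) - t * (fst \<alpha> \<bullet> v)" for t
  proof -
    have "\<bar>t\<bar> * norm v - norm x \<le> norm (x + t *\<^sub>R v)"
      using norm_diff_ineq[of "t *\<^sub>R v" x] by (simp add: add.commute)
    then have "e * (\<bar>t\<bar> * norm v - norm x) \<le> e * norm (x + t *\<^sub>R v)" using e(1) by simp
    then show ?thesis using e(2)[OF xv(2)[of t]] by (simp add: inner_add_right)
  qed
  have "e * (\<bar>b\<bar> * norm v - norm x) \<le> - (fst \<alpha> \<bullet> x)" using lower[of b] lower[of "- b"] by simp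
  moreover have "b > 0" unfolding b_def using e xv by (intro divide_pos_pos add_nonneg_pos) auto
  moreover have "e * (b * norm v) = norm (fst \<alpha> \<bullet> x) + e * norm x + 1"
    using e(1) xv(1) by (simp add: b_def)
  ultimately show False by (simp add: right_diff_distrib)
qed

lemma decays_cong: "(\<And>w. w \<in> M \<Longrightarrow> fst \<alpha> \<bullet> w = fst \<beta> \<bullet> w) \<Longrightarrow> decays \<alpha> M \<longleftrightarrow> decays \<beta> M"
  unfolding decays_def by simp

text \<open>The index pairs of the factors in \<open>LC_cone\<close>. A chain that ends in p itself
  yields the last pair (p, p), whose cone is {0}.\<close>

definition chain_pairs :: "'a set \<Rightarrow> 'a set list \<Rightarrow> ('a set \<times> 'a set) list" where
  "chain_pairs p hs = zip hs (tl hs @ [p])"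

lemma chain_pairs_simps [simp]:
  "chain_pairs p [h] = [(h, p)]"
  "chain_pairs p (h # h1 # hs) = (h, h1) # chain_pairs p (h1 # hs)"
  by (auto simp: chain_pairs_def)

lemma LC_cone_simps:
  "LC_cone p [h] = tcone0 p h"
  "LC_cone p (h # h1 # hs) = minkowski (tcone0 h1 h) (LC_cone p (h1 # hs))"
  by (auto simp: LC_cone_def msum_def minkowski_def)

text \<open>The part of \<open>LC_chains\<close> that matters for integration: \<open>\<xi>\<close>
  does not occur.\<close>

definition face_chain :: "'a::euclidean_space set \<Rightarrow> 'a set list \<Rightarrow> bool" where
  "face_chain p hs \<longleftrightarrow> hs \<noteq> [] \<and> sorted_wrt (\<subset>) hs \<and> (\<forall>h\<in>set hs. h face_of p \<and> h \<noteq> {})"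

lemma face_chain_Cons: "face_chain p (h # h1 # hs) \<longleftrightarrow>
    face_chain p (h1 # hs) \<and> h \<subset> h1 \<and> h face_of p \<and> h \<noteq> {}"
  unfolding face_chain_def by auto

lemma face_chain_pairs:
  assumes "polytope p" "face_chain p hs" "(x, y) \<in> set (chain_pairs p hs)"
  shows "face_pair x y" "hd hs \<subseteq> x"
proof -
  have "face_pair x y \<and> hd hs \<subseteq> x" using assms(2,3)
  proof (induction hs rule: induct_list012)
    case (2 h)
    then show ?case using assms(1) by (auto simp: face_chain_def face_pair_def)
  next
    case (3 h h1 hs)
    have "face_pair h h1"
      using 3(3) assms(1) face_of_subset[of h p h1] face_of_polytope_polytope[of p h1] face_of_imp_subset
      by (auto simp: face_chain_def face_pair_def)
    then show ?case using 3 by (auto simp: face_chain_Cons)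
  qed (simp add: face_chain_def)
  then show "face_pair x y" "hd hs \<subseteq> x" by auto
qed

lemma ocomp_lin_decomposition:
  assumes "h \<subseteq> h1"
  shows "ocomp (lin h) = {x + y | x y. x \<in> lin_quot h h1 \<and> y \<in> ocomp (lin h1)}"
proof (intro equalityI subsetI)
  fix v assume v: "v \<in> ocomp (lin h)"
  obtain y z where yz: "y \<in> lin h1" "z \<in> ocomp (lin h1)" "v = y + z"
    using orthogonal_decomposition[OF subspace_lin] by blast
  have "y = v - z" using yz by simp
  then have "y \<in> ocomp (lin h)"
    using v yz(2) ocomp_mono[OF lin_mono[OF assms]] subspace_diff[OF subspace_ocomp] by blast
  then show "v \<in> {x + y | x y. x \<in> lin_quot h h1 \<and> y \<in> ocomp (lin h1)}"
    using yz by (auto simp: lin_quot_def)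
next
  fix v assume "v \<in> {x + y | x y. x \<in> lin_quot h h1 \<and> y \<in> ocomp (lin h1)}"
  then show "v \<in> ocomp (lin h)"
    using ocomp_mono[OF lin_mono[OF assms]] by (auto simp: lin_quot_def intro!: subspace_add subspace_ocomp)
qed

lemma lin_quot_orthogonal: "x \<in> lin_quot h h1 \<Longrightarrow> y \<in> ocomp (lin h1) \<Longrightarrow> x \<bullet> y = 0"
  by (auto simp: lin_quot_def dest: ocompD)

text \<open>Fubini over the orthogonal decomposition, peeling off the smallest face. Closedness, the
  ambient space, a common decaying covector and the integral are proved together because the
  induction step uses all of them.\<close>

lemma LC_cone_integral:
  fixes p :: "'a::euclidean_space set"
  assumes p: "polytope p" "lin p = UNIV" and hs: "face_chain p hs"
  shows "closed (LC_cone p hs) \<and> LC_cone p hs \<subseteq> ocomp (lin (hd hs)) \<and>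
    (\<exists>a\<in>ocomp (lin (hd hs)). \<forall>(x, y)\<in>set (chain_pairs p hs). \<forall>b. decays (a, b) (tcone0 y x)) \<and>
    (\<forall>\<alpha>. (\<forall>(x, y)\<in>set (chain_pairs p hs). decays \<alpha> (tcone0 y x)) \<longrightarrow>
      decays \<alpha> (LC_cone p hs) \<and>
      has_bochner_integral (lebW (ocomp (lin (hd hs)))) (cone_exp (LC_cone p hs) \<alpha>)
        (\<Prod>(x, y)\<leftarrow>chain_pairs p hs. face_int x y \<alpha>))"
  using hs
proof (induction hs rule: induct_list012)
  case 1
  then show ?case by (simp add: face_chain_def)
next
  case (2 h)
  interpret face_pair h p using face_chain_pairs[OF p(1) 2] by simp
  have eq: "lin_quot h p = ocomp (lin h)" by (simp add: lin_quot_def p)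
  obtain a where "a \<in> lin_quot h p" "\<And>b. decays (a, b) K" using exists_decays by blast
  moreover have "K \<subseteq> ocomp (lin h)" using mem_K_iff eq by blast
  ultimately show ?case
    using closed_K cone_exp_integrable[OF face_pair_axioms]
    by (auto simp: LC_cone_simps eq has_bochner_integral_iff cone_int_def)
next
  case (3 h h1 hs)
  have hs1: "face_chain p (h1 # hs)" "h \<subseteq> h1" using 3(3) by (auto simp: face_chain_Cons)
  interpret face_pair h h1 using face_chain_pairs[OF p(1) 3(3)] by simp
  let ?M = "LC_cone p (h1 # hs)" and ?W = "ocomp (lin h1)"
  let ?P = "\<lambda>\<alpha>. \<Prod>(x, y)\<leftarrow>chain_pairs p (h1 # hs). face_int x y \<alpha>"
  from 3(2)[OF hs1(1)] obtain a where IH: "closed ?M" "?M \<subseteq> ?W" "a \<in> ?W"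
    "\<And>x y b. (x, y) \<in> set (chain_pairs p (h1 # hs)) \<Longrightarrow> decays (a, b) (tcone0 y x)"
    "\<And>\<alpha>. \<forall>(x, y)\<in>set (chain_pairs p (h1 # hs)). decays \<alpha> (tcone0 y x) \<Longrightarrow> decays \<alpha> ?M"
    "\<And>\<alpha>. \<forall>(x, y)\<in>set (chain_pairs p (h1 # hs)). decays \<alpha> (tcone0 y x) \<Longrightarrow>
       has_bochner_integral (lebW ?W) (cone_exp ?M \<alpha>) (?P \<alpha>)"
    by fastforce
  obtain a1 where a1: "a1 \<in> lin_quot h h1" "\<And>b. decays (a1, b) K" using exists_decays by blast
  have KL: "K \<subseteq> lin_quot h h1" using mem_K_iff by blast
  note dec = ocomp_lin_decomposition[OF hs1(2)]
  have cl: "closed (minkowski K ?M)"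
    by (rule closed_minkowski_orthogonal[OF subspace_lin_quot subspace_ocomp lin_quot_orthogonal KL IH(2) closed_K IH(1)])
  have sub: "minkowski K ?M \<subseteq> ocomp (lin h)"
    unfolding dec minkowski_def using KL IH(2) by blast
  have mem: "a1 + a \<in> ocomp (lin h)" unfolding dec using a1(1) IH(3) by blast
  \<comment> \<open>By orthogonality a does not act on the first cone and a1 does not act on the
    remaining ones, so the sum decays on every factor.\<close>
  have decay: "decays (a1 + a, b) (tcone0 y x)"
    if "(x, y) \<in> set (chain_pairs p (h # h1 # hs))" for x y b
  proof (cases "(x, y) = (h, h1)")
    case True
    have "decays (a1 + a, b) K \<longleftrightarrow> decays (a1, b) K"
    proof (rule decays_cong)
      fix w assume "w \<in> K"
      then have "w \<bullet> a = 0" using KL IH(3) lin_quot_orthogonal by blast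
      then show "fst (a1 + a, b) \<bullet> w = fst (a1, b) \<bullet> w" by (simp add: inner_add_left inner_commute[of a])
    qed
    then show ?thesis using True a1(2) by simp
  next
    case False
    then have xy: "(x, y) \<in> set (chain_pairs p (h1 # hs))" using that by auto
    interpret xy: face_pair x y by (rule face_chain_pairs[OF p(1) hs1(1) xy])
    have "h1 \<subseteq> x" using face_chain_pairs(2)[OF p(1) hs1(1) xy] by simp
    have "decays (a1 + a, b) (tcone0 y x) \<longleftrightarrow> decays (a, b) (tcone0 y x)"
    proof (rule decays_cong)
      fix w assume "w \<in> tcone0 y x"
      then have "w \<in> ocomp (lin x)" using xy.K_eq by blast
      then have "w \<in> ?W" using ocomp_mono[OF lin_mono[OF \<open>h1 \<subseteq> x\<close>]] by blast
      then have "a1 \<bullet> w = 0" using a1(1) lin_quot_orthogonal by blast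
      then show "fst (a1 + a, b) \<bullet> w = fst (a, b) \<bullet> w" by (simp add: inner_add_left)
    qed
    then show ?thesis using IH(4)[OF xy] by simp
  qed
  have int: "decays \<alpha> (minkowski K ?M) \<and>
      has_bochner_integral (lebW (ocomp (lin h))) (cone_exp (minkowski K ?M) \<alpha>) (face_int h h1 \<alpha> * ?P \<alpha>)"
    if \<alpha>: "\<forall>(x, y)\<in>set (chain_pairs p (h # h1 # hs)). decays \<alpha> (tcone0 y x)" for \<alpha>
  proof
    have \<alpha>1: "decays \<alpha> K" "\<forall>(x, y)\<in>set (chain_pairs p (h1 # hs)). decays \<alpha> (tcone0 y x)" using \<alpha> by auto
    show "decays \<alpha> (minkowski K ?M)" by (rule decays_minkowski[OF \<alpha>1(1) IH(5)[OF \<alpha>1(2)]])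
    have eq: "lebW (ocomp (lin h)) = distr (lebW (lin_quot h h1) \<Otimes>\<^sub>M lebW ?W) borel (\<lambda>(x, y). x + y)"
      by (rule lebW_orthogonal_sum[OF subspace_lin_quot subspace_ocomp lin_quot_orthogonal dec])
    show "has_bochner_integral (lebW (ocomp (lin h))) (cone_exp (minkowski K ?M) \<alpha>) (face_int h h1 \<alpha> * ?P \<alpha>)"
      unfolding eq
    proof (rule has_bochner_integral_distr_pair)
      show "has_bochner_integral (lebW (lin_quot h h1)) (cone_exp K \<alpha>) (face_int h h1 \<alpha>)"
        unfolding cone_int_def
        by (rule has_bochner_integral_integrable[OF cone_exp_integrable[OF face_pair_axioms \<alpha>1(1)]])
      show "has_bochner_integral (lebW ?W) (cone_exp ?M \<alpha>) (?P \<alpha>)" by (rule IH(6)[OF \<alpha>1(2)])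
      show "AE y in lebW (lin_quot h h1). y \<in> lin_quot h h1" by (rule AE_lebW[OF subspace_lin_quot])
      show "AE y in lebW ?W. y \<in> ?W" by (rule AE_lebW[OF subspace_ocomp])
      show "cone_exp (minkowski K ?M) \<alpha> \<in> borel_measurable borel"
        by (rule cone_exp_measurable[OF borel_closed[OF cl]])
      fix x y assume xy: "x \<in> lin_quot h h1" "y \<in> ?W"
      have "x + y \<in> minkowski K ?M \<longleftrightarrow> x \<in> K \<and> y \<in> ?M"
        by (rule mem_minkowski_orthogonal[OF subspace_lin_quot subspace_ocomp lin_quot_orthogonal KL IH(2) xy])
      then show "cone_exp (minkowski K ?M) \<alpha> (case (x, y) of (x, y) \<Rightarrow> x + y) = cone_exp K \<alpha> x * cone_exp ?M \<alpha> y"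
        by (auto simp: indicator_def cpair_add exp_add)
    qed (auto simp: sigma_finite_lebW subspace_lin_quot subspace_ocomp)
  qed
  show ?case
    unfolding LC_cone_simps(2) list.sel(1)
  proof (intro conjI allI impI bexI[of _ "a1 + a"])
    show "\<forall>(x, y)\<in>set (chain_pairs p (h # h1 # hs)). \<forall>b. decays (a1 + a, b) (tcone0 y x)"
      using decay by blast
    fix \<alpha> assume "\<forall>(x, y)\<in>set (chain_pairs p (h # h1 # hs)). decays \<alpha> (tcone0 y x)"
    from int[OF this] show "decays \<alpha> (minkowski K ?M)"
      "has_bochner_integral (lebW (ocomp (lin h))) (cone_exp (minkowski K ?M) \<alpha>)
        (\<Prod>(x, y)\<leftarrow>chain_pairs p (h # h1 # hs). face_int x y \<alpha>)"
      by simp_all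
  qed (rule cl sub mem)+
qed

section \<open>Continuations of the integrals over cones of chains\<close>

lemma mero_prod_list: "(\<And>i. i \<in> set xs \<Longrightarrow> mero W (f i)) \<Longrightarrow> mero W (\<lambda>\<alpha>. \<Prod>i\<leftarrow>xs. f i \<alpha>)"
  by (induction xs) (auto intro: mero_const mero_mult)

lemma is_mero_cont_open_dense:
  assumes "is_mero_cont W M F Z" "\<not> contains_line M"
  shows "open_dense W (cplx W - Z)"
proof -
  have Z: "Z \<subseteq> cplx W" "closedin (top_of_set (cplx W)) Z"
    "\<And>U. openin (top_of_set (cplx W)) U \<Longrightarrow> U \<subseteq> Z \<Longrightarrow> U = {}"
    using assms unfolding is_mero_cont_def by auto
  have "openin (top_of_set (cplx W)) (cplx W - Z)"
    using Z(2) by (metis closedin_def topspace_euclidean_subtopology)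
  moreover have "U \<inter> (cplx W - Z) \<noteq> {}" if U: "openin (top_of_set (cplx W)) U" "U \<noteq> {}" for U
    using Z(3)[OF U(1)] U(2) openin_imp_subset[OF U(1)] by blast
  ultimately show ?thesis unfolding open_dense_def by blast
qed

lemma is_mero_cont_mero:
  assumes "is_mero_cont W M F Z" "\<not> contains_line M"
  shows "mero W F"
proof -
  have "\<exists>U g h. openin (top_of_set (cplx W)) U \<and> z \<in> U \<and> holo_on U g \<and> holo_on U h \<and>
      (\<forall>\<alpha>\<in>U \<inter> (cplx W - Z). h \<alpha> \<noteq> 0 \<and> F \<alpha> = g \<alpha> / h \<alpha>)" if "z \<in> cplx W" for z
  proof -
    from assms that obtain U g h where "openin (top_of_set (cplx W)) U" "z \<in> U" "holo_on U g" "holo_on U h"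
      "\<forall>\<alpha>\<in>U - Z. h \<alpha> \<noteq> 0 \<and> F \<alpha> = g \<alpha> / h \<alpha>"
      unfolding is_mero_cont_def by (auto split: if_splits)
    then show ?thesis by blast
  qed
  then show ?thesis unfolding mero_def using is_mero_cont_open_dense[OF assms] by blast
qed

text \<open>Off \<open>Z\<close> the local fractions give the values of F exactly and their
  denominators do not vanish. This is what fixes F at every point off \<open>Z\<close> once it is
  known generically.\<close>

lemma is_mero_cont_continuous_on:
  assumes F: "is_mero_cont W M F Z" and "\<not> contains_line M"
  shows "continuous_on (cplx W - Z) F"
  unfolding continuous_on_eq_continuous_within
proof
  fix z assume z: "z \<in> cplx W - Z"
  from assms z obtain U g h where U: "openin (top_of_set (cplx W)) U" "z \<in> U" "holo_on U g" "holo_on U h"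
      "\<And>\<alpha>. \<alpha> \<in> U - Z \<Longrightarrow> h \<alpha> \<noteq> 0 \<and> F \<alpha> = g \<alpha> / h \<alpha>"
    unfolding is_mero_cont_def by (auto split: if_splits)
  obtain T where T: "open T" "U = cplx W \<inter> T" using U(1) by (auto simp: openin_open)
  have "continuous_on (U - Z) (\<lambda>\<alpha>. g \<alpha> / h \<alpha>)"
    using U by (intro continuous_intros continuous_on_subset[OF holo_on_imp_continuous_on]) auto
  then have "continuous_on (U - Z) F" using U(5) by (subst continuous_on_cong[OF refl]) auto
  then have "continuous (at z within U - Z) F"
    using z U(2) by (auto simp: continuous_on_eq_continuous_within)
  moreover have "at z within U - Z = at z within cplx W - Z"
    by (rule at_within_nhd[of z T]) (use T U(2) in auto)
  ultimately show "continuous (at z within cplx W - Z) F" by simp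
qed

lemma LC_cone_no_line:
  assumes "polytope p" "lin p = UNIV" "face_chain p hs"
  shows "\<not> contains_line (LC_cone p hs)"
  using LC_cone_integral[OF assms] decays_imp_no_line by fast

lemma is_mero_cont_LC_cone_eq:
  assumes p: "polytope p" "lin p = UNIV" and hs: "face_chain p hs" and W: "W = ocomp (lin (hd hs))"
    and F: "is_mero_cont W (LC_cone p hs) F Z"
  shows "generically W (\<lambda>\<alpha>. F \<alpha> = (\<Prod>(x, y)\<leftarrow>chain_pairs p hs. face_mero W x y \<alpha>))"
proof -
  note LC = LC_cone_integral[OF p hs] and nl = LC_cone_no_line[OF p hs]
  have sW: "subspace W" by (simp add: W subspace_ocomp)
  obtain a where a: "a \<in> W" "\<And>x y b. (x, y) \<in> set (chain_pairs p hs) \<Longrightarrow> decays (a, b) (tcone0 y x)"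
    using LC W by blast
  \<comment> \<open>The union of the factors, not their product: decay on it means decay on all
    factors with one rate, the least of finitely many.\<close>
  define M where "M = (\<Union>(x, y)\<in>set (chain_pairs p hs). tcone0 y x)"
  have sub: "lin_quot x y \<subseteq> W" if "(x, y) \<in> set (chain_pairs p hs)" for x y
    using face_chain_pairs(2)[OF p(1) hs that] ocomp_mono[OF lin_mono] W by (auto simp: lin_quot_def)
  show ?thesis
  proof (rule mero_eq_generically[OF sW is_mero_cont_mero[OF F nl] _ a(1) _ is_mero_cont_open_dense[OF F nl]])
    show "mero W (\<lambda>\<alpha>. \<Prod>(x, y)\<leftarrow>chain_pairs p hs. face_mero W x y \<alpha>)"
      unfolding case_prod_beta
      by (intro mero_prod_list mero_face_mero[OF sW]) (use face_chain_pairs[OF p(1) hs] sub in auto)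
    show "decays (a, 0) M"
    proof -
      have "\<exists>e>0. \<forall>w\<in>tcone0 (snd z) (fst z). a \<bullet> w \<le> - e * norm w" if "z \<in> set (chain_pairs p hs)" for z
        using a(2)[of "fst z" "snd z" 0] that by (auto simp: decays_def)
      then obtain e where e: "\<And>z. z \<in> set (chain_pairs p hs) \<Longrightarrow> e z > 0"
        "\<And>z w. z \<in> set (chain_pairs p hs) \<Longrightarrow> w \<in> tcone0 (snd z) (fst z) \<Longrightarrow> a \<bullet> w \<le> - e z * norm w"
        by metis
      define E where "E = Min (insert 1 (e ` set (chain_pairs p hs)))"
      have "E > 0" using e(1) by (auto simp: E_def Min_gr_iff)
      moreover have "a \<bullet> w \<le> - E * norm w" if "z \<in> set (chain_pairs p hs)" "w \<in> tcone0 (snd z) (fst z)" for z w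
      proof -
        have "E \<le> e z" using that by (auto simp: E_def intro: Min_le)
        then have "E * norm w \<le> e z * norm w" by (rule mult_right_mono) simp
        then show ?thesis using e(2)[OF that] by simp
      qed
      ultimately show ?thesis unfolding decays_def M_def by fastforce
    qed
    fix \<alpha> assume \<alpha>: "\<alpha> \<in> cplx W - Z" "decays \<alpha> M"
    have dec: "decays \<alpha> (tcone0 y x)" if "(x, y) \<in> set (chain_pairs p hs)" for x y
      by (rule decays_subset[OF \<alpha>(2)]) (use that in \<open>auto simp: M_def\<close>)
    then have hb: "has_bochner_integral (lebW W) (cone_exp (LC_cone p hs) \<alpha>) (\<Prod>(x, y)\<leftarrow>chain_pairs p hs. face_int x y \<alpha>)"
      using LC W by blast
    then have "\<alpha> \<in> conv_region W (LC_cone p hs) - Z"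
      using \<alpha> by (auto simp: conv_region_def has_bochner_integral_iff)
    then have "F \<alpha> = cone_int W (LC_cone p hs) \<alpha>"
      using F nl unfolding is_mero_cont_def by auto
    also have "\<dots> = (\<Prod>(x, y)\<leftarrow>chain_pairs p hs. face_int x y \<alpha>)"
      using hb by (simp add: cone_int_def has_bochner_integral_iff)
    also have "\<dots> = (\<Prod>(x, y)\<leftarrow>chain_pairs p hs. face_mero W x y \<alpha>)"
      by (intro arg_cong[where f = prod_list] map_cong refl)
         (use face_mero_eq[OF sW face_chain_pairs(1)[OF p(1) hs] sub dec] in auto)
    finally show "F \<alpha> = (\<Prod>(x, y)\<leftarrow>chain_pairs p hs. face_mero W x y \<alpha>)" .
  qed
qed

section \<open>Sums over chains and flags\<close>

lemma sorted_wrt_psubset_distinct: "sorted_wrt (\<subset>) hs \<Longrightarrow> distinct hs"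
  by (induction hs) auto

lemma sorted_wrt_psubset_last: "sorted_wrt (\<subset>) hs \<Longrightarrow> h \<in> set hs \<Longrightarrow> h \<subseteq> last hs"
  by (induction hs) (auto split: if_splits)

lemma sorted_wrt_psubset_hd: "sorted_wrt (\<subset>) hs \<Longrightarrow> h \<in> set hs \<Longrightarrow> hd hs \<subseteq> h"
  by (cases hs) auto

lemma chain_pairs_last: "hs \<noteq> [] \<Longrightarrow> chain_pairs q hs = zip hs (tl hs) @ [(last hs, q)]"
  by (induction hs rule: induct_list012) auto

lemma chain_pairs_snoc: "hs \<noteq> [] \<Longrightarrow> chain_pairs q (hs @ [r]) = chain_pairs r hs @ [(r, q)]"
  by (induction hs rule: induct_list012) auto

lemma finite_LC_chains:
  assumes "polytope q" shows "finite (LC_chains q g \<xi>)"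
  by (rule finite_subset[OF _ finite_subset_distinct[OF finite_polytope_faces[OF assms]]])
     (auto simp: LC_chains_def sorted_wrt_psubset_distinct)

lemma nth_mono_subset:
  assumes "\<And>i. Suc i < length hs \<Longrightarrow> hs ! i \<subseteq> hs ! Suc i" "i \<le> j" "j < length hs"
  shows "hs ! i \<subseteq> hs ! j"
  using assms(2,3)
proof (induction j rule: dec_induct)
  case (step n)
  then show ?case using assms(1)[of n] by fastforce
qed simp

lemma finite_sFl:
  assumes "polytope q" shows "finite (sFl q g \<xi>)"
proof (rule finite_subset[OF _ finite_subset_distinct[OF finite_polytope_faces[OF assms]]])
  show "sFl q g \<xi> \<subseteq> {xs. set xs \<subseteq> {F. F face_of q} \<and> distinct xs}"
  proof safe
    fix hs h assume "hs \<in> sFl q g \<xi>" "h \<in> set hs"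
    then show "h face_of q" by (auto simp: sFl_def in_set_conv_nth)
  next
    fix hs assume hs: "hs \<in> sFl q g \<xi>"
    show "distinct hs" unfolding distinct_conv_nth
    proof (intro allI impI)
      fix i j assume ij: "i < length hs" "j < length hs" "i \<noteq> j"
      then have "aff_dim (hs ! i) \<noteq> aff_dim (hs ! j)" using hs by (auto simp: sFl_def)
      then show "hs ! i \<noteq> hs ! j" by auto
    qed
  qed
qed

text \<open>The denominators d are kept free: \<open>restr_normsq\<close> gives \<open>DBI0\<close>,
  and \<open>conj_pair\<close> at a point \<open>\<alpha>\<close> gives its holomorphic
  extension.\<close>

definition flag_term :: "'a::euclidean_space \<times> 'a \<Rightarrow> ('a set \<Rightarrow> complex) \<Rightarrow> 'a set list \<Rightarrow> complex" where
  "flag_term \<xi> d hs = (\<Prod>j\<in>{1..<length hs}. hpair \<xi> (onormal (hs ! j) (hs ! (j - 1))) / d (hs ! j))"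

definition flag_sum :: "'a::euclidean_space set \<Rightarrow> 'a \<times> 'a \<Rightarrow> ('a set \<Rightarrow> complex) \<Rightarrow> 'a set \<Rightarrow> complex" where
  "flag_sum g \<xi> d q = (\<Sum>hs\<in>sFl q g \<xi>. flag_term \<xi> d hs)"

lemma DBI0_eq_flag_sum: "DBI0 p g \<xi> = flag_sum g \<xi> (\<lambda>h. of_real (restr_normsq \<xi> h)) p"
  by (simp add: DBI0_def flag_sum_def flag_term_def)

lemma flag_term_snoc:
  assumes "hs \<noteq> []"
  shows "flag_term \<xi> d (hs @ [q]) = hpair \<xi> (onormal q (last hs)) / d q * flag_term \<xi> d hs"
proof -
  have eq: "{1..<length (hs @ [q])} = insert (length hs) {1..<length hs}"
    using assms by (auto simp: Suc_le_eq)
  have "(\<Prod>j\<in>{1..<length hs}. hpair \<xi> (onormal ((hs @ [q]) ! j) ((hs @ [q]) ! (j - 1))) / d ((hs @ [q]) ! j))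
      = flag_term \<xi> d hs"
    unfolding flag_term_def by (intro prod.cong) (auto simp: nth_append)
  moreover have "(hs @ [q]) ! (length hs - 1) = last hs"
    using assms by (simp add: nth_append last_conv_nth)
  ultimately show ?thesis unfolding flag_term_def[of _ _ "hs @ [q]"] eq by simp
qed

lemma sFl_self:
  assumes "convex g" shows "sFl g g \<xi> = {[g]}"
proof
  show "sFl g g \<xi> \<subseteq> {[g]}"
  proof
    fix hs assume hs: "hs \<in> sFl g g \<xi>"
    then have "hs \<noteq> []" "hd hs = g" "last hs = g"
      "aff_dim (hs ! (length hs - 1)) = aff_dim g + int (length hs - 1)"
      by (auto simp: sFl_def)
    then have "length hs - 1 = 0" by (simp add: last_conv_nth)
    then have "length hs = 1" using \<open>hs \<noteq> []\<close> by (cases hs) auto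
    then show "hs \<in> {[g]}" using \<open>hd hs = g\<close> by (cases hs) auto
  qed
  show "{[g]} \<subseteq> sFl g g \<xi>" using assms by (auto simp: sFl_def face_of_refl)
qed

text \<open>The last face of such a flag has positive index, so it would have to be
  non-constant.\<close>

lemma sFl_xi_const:
  assumes "xi_const \<xi> q" "q \<noteq> g" shows "sFl q g \<xi> = {}"
proof -
  have False if hs: "hs \<in> sFl q g \<xi>" for hs
  proof -
    have *: "hs \<noteq> []" "hs ! 0 = g" "hs ! (length hs - 1) = q"
      using hs by (auto simp: sFl_def hd_conv_nth last_conv_nth)
    then have "length hs - 1 > 0" using assms(2) by (cases "length hs - 1 = 0") auto
    then show False using hs * assms(1) by (auto simp: sFl_def)
  qed
  then show ?thesis by blast
qed

text \<open>Delete the top face. The dimension condition makes the face below it a facet, and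
  conversely q can always be appended because it is not \<open>\<xi>\<close>-constant.\<close>

lemma sFl_decomposition:
  fixes q g :: "'a::euclidean_space set"
  assumes q: "polytope q" and g: "g face_of q" "g \<noteq> {}" "xi_const \<xi> g" and nc: "\<not> xi_const \<xi> q"
  shows "sFl q g \<xi> = (\<Union>q'\<in>facets_above g q. (\<lambda>hs. hs @ [q]) ` sFl q' g \<xi>)"
proof (intro equalityI subsetI)
  fix hs assume hs: "hs \<in> sFl q g \<xi>"
  have ne: "hs \<noteq> []" "hd hs = g" "last hs = q" using hs by (auto simp: sFl_def)
  define bs where "bs = butlast hs"
  have hs_eq: "hs = bs @ [q]" using ne by (auto simp: bs_def)
  have bs: "bs \<noteq> []" using ne g(3) nc hs_eq by (cases bs) auto
  have len: "length hs = Suc (length bs)" by (simp add: hs_eq)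
  have nth: "hs ! i = bs ! i" if "i < length bs" for i using that by (simp add: hs_eq nth_append)
  have face: "bs ! i face_of q" "aff_dim (bs ! i) = aff_dim g + int i" if "i < length bs" for i
    using hs that nth[OF that] len unfolding sFl_def by (auto dest!: spec[of _ i])
  have step: "bs ! i \<subseteq> bs ! Suc i" if "Suc i < length bs" for i
    using hs that nth[of i] nth[of "Suc i"] len unfolding sFl_def by (auto dest!: spec[of _ i])
  have nonconst: "\<not> xi_const \<xi> (bs ! i)" if "0 < i" "i < length bs" for i
    using hs that nth[of i] len unfolding sFl_def by auto
  define q' where "q' = last bs"
  have q'_nth: "q' = bs ! (length bs - 1)" using bs by (simp add: q'_def last_conv_nth)
  have sub: "bs ! i \<subseteq> q'" if "i < length bs" for i
    unfolding q'_nth by (rule nth_mono_subset[OF step]) (use that in auto)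
  have bs0: "bs ! 0 = g" using ne(2) bs by (simp add: hs_eq hd_conv_nth nth_append)
  have gq': "g \<subseteq> q'" using sub[of 0] bs bs0 by simp
  have "aff_dim q = aff_dim g + int (length bs)"
    using hs len unfolding sFl_def by (auto dest!: spec[of _ "length bs"] simp: hs_eq)
  \<comment> \<open>The index of q is \<open>length bs\<close> and that of q' is one less, so the
    dimension drops by exactly one.\<close>
  then have "aff_dim q' = aff_dim q - 1"
    using face(2)[of "length bs - 1"] bs by (simp add: q'_nth of_nat_diff Suc_le_eq)
  moreover have q'face: "q' face_of q" using face(1)[of "length bs - 1"] bs by (simp add: q'_nth)
  ultimately have "q' \<in> facets_above g q"
    using gq' g(2) by (auto simp: facets_above_def facet_of_def)
  moreover have "bs \<in> sFl q' g \<xi>"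
    unfolding sFl_def using bs face step nonconst sub bs0 face_of_face[OF q'face]
    by (auto simp: q'_def hd_conv_nth)
  ultimately show "hs \<in> (\<Union>q'\<in>facets_above g q. (\<lambda>hs. hs @ [q]) ` sFl q' g \<xi>)" using hs_eq by blast
next
  fix hs assume "hs \<in> (\<Union>q'\<in>facets_above g q. (\<lambda>hs. hs @ [q]) ` sFl q' g \<xi>)"
  then obtain q' bs where q': "q' \<in> facets_above g q" and bs: "bs \<in> sFl q' g \<xi>" and hs: "hs = bs @ [q]" by blast
  have facet: "q' face_of q" "aff_dim q' = aff_dim q - 1" using q' by (auto simp: facets_above_def facet_of_def)
  have b: "bs \<noteq> []" "hd bs = g" "last bs = q'"
     "\<And>i. i < length bs \<Longrightarrow> bs ! i face_of q' \<and> aff_dim (bs ! i) = aff_dim g + int i"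
     "\<And>i. Suc i < length bs \<Longrightarrow> bs ! i \<subseteq> bs ! Suc i"
     "\<And>i. 0 < i \<Longrightarrow> i < length bs \<Longrightarrow> \<not> xi_const \<xi> (bs ! i)"
    using bs by (auto simp: sFl_def)
  have last: "bs ! (length bs - 1) = q'" using b by (simp add: last_conv_nth)
  then have dim: "aff_dim q = aff_dim g + int (length bs)"
    using b(4)[of "length bs - 1"] b(1) facet(2) by (simp add: of_nat_diff Suc_le_eq)
  have "(bs @ [q]) ! i face_of q \<and> aff_dim ((bs @ [q]) ! i) = aff_dim g + int i" if "i < Suc (length bs)" for i
  proof (cases "i < length bs")
    case True
    then show ?thesis using b(4) face_of_trans[OF _ facet(1)] by (simp add: nth_append)
  next
    case False
    then have "i = length bs" using that by simp
    then show ?thesis using dim q by (simp add: face_of_refl polytope_imp_convex)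
  qed
  moreover have "(bs @ [q]) ! i \<subseteq> (bs @ [q]) ! Suc i" if "i < length bs" for i
  proof (cases "Suc i < length bs")
    case True
    then show ?thesis using b(5)[OF True] by (simp add: nth_append)
  next
    case False
    then have "i = length bs - 1" "Suc i = length bs" using that by auto
    then show ?thesis using last that face_of_imp_subset[OF facet(1)] by (simp add: nth_append)
  qed
  moreover have "\<not> xi_const \<xi> ((bs @ [q]) ! i)" if "0 < i" "i < Suc (length bs)" for i
    using that b(6) nc by (cases "i < length bs") (auto simp: nth_append)
  ultimately show "hs \<in> sFl q g \<xi>" unfolding hs sFl_def using b(1,2) by simp
qed

text \<open>The families for different facets are disjoint since the last face of the shortened flag
  is the facet, and the top factor depends on that facet alone.\<close>

lemma flag_sum_step:
  fixes q g :: "'a::euclidean_space set"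
  assumes q: "polytope q" and g: "g face_of q" "g \<noteq> {}" "xi_const \<xi> g" and nc: "\<not> xi_const \<xi> q"
  shows "flag_sum g \<xi> d q = (\<Sum>q'\<in>facets_above g q. hpair \<xi> (onormal q q') / d q * flag_sum g \<xi> d q')"
proof -
  let ?snoc = "\<lambda>hs. hs @ [q]"
  have fin: "finite (facets_above g q)" by (rule finite_facets_above[OF q])
  have fin': "finite (sFl q' g \<xi>)" if "q' \<in> facets_above g q" for q'
    by (rule finite_sFl) (use that q face_of_polytope_polytope in \<open>auto simp: facets_above_def facet_of_def\<close>)
  have last: "last hs = q'" "hs \<noteq> []" if "hs \<in> sFl q' g \<xi>" for hs q' using that by (auto simp: sFl_def)
  have "flag_sum g \<xi> d q = (\<Sum>q'\<in>facets_above g q. \<Sum>hs\<in>?snoc ` sFl q' g \<xi>. flag_term \<xi> d hs)"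
    unfolding flag_sum_def sFl_decomposition[OF assms]
  proof (rule sum.UNION_disjoint)
    show "\<forall>i\<in>facets_above g q. \<forall>j\<in>facets_above g q. i \<noteq> j \<longrightarrow> ?snoc ` sFl i g \<xi> \<inter> ?snoc ` sFl j g \<xi> = {}"
    proof (intro ballI impI)
      fix i j :: "'a set" assume "i \<noteq> j"
      then have "sFl i g \<xi> \<inter> sFl j g \<xi> = {}" using last(1) by blast
      then show "?snoc ` sFl i g \<xi> \<inter> ?snoc ` sFl j g \<xi> = {}" by auto
    qed
  qed (use fin fin' in auto)
  also have "\<dots> = (\<Sum>q'\<in>facets_above g q. hpair \<xi> (onormal q q') / d q * flag_sum g \<xi> d q')"
  proof (rule sum.cong[OF refl])
    fix q'
    have "(\<Sum>hs\<in>?snoc ` sFl q' g \<xi>. flag_term \<xi> d hs) = (\<Sum>hs\<in>sFl q' g \<xi>. flag_term \<xi> d (?snoc hs))"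
      by (rule sum.reindex_cong[of ?snoc]) (auto simp: inj_on_def)
    also have "\<dots> = (\<Sum>hs\<in>sFl q' g \<xi>. hpair \<xi> (onormal q q') / d q * flag_term \<xi> d hs)"
      by (intro sum.cong refl) (use last in \<open>simp add: flag_term_snoc\<close>)
    also have "\<dots> = hpair \<xi> (onormal q q') / d q * flag_sum g \<xi> d q'"
      by (simp add: flag_sum_def sum_distrib_left)
    finally show "(\<Sum>hs\<in>?snoc ` sFl q' g \<xi>. flag_term \<xi> d hs) = hpair \<xi> (onormal q q') / d q * flag_sum g \<xi> d q'" .
  qed
  finally show ?thesis .
qed

text \<open>\<open>J\<close> stands for the continued integrals at one fixed
  \<open>\<alpha>\<close>, so that the case q = p is the alternating sum of the theorem. The top
  face q varies because the recursion descends to facets.\<close>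

definition chain_sum :: "('a set \<Rightarrow> 'a set \<Rightarrow> complex) \<Rightarrow> 'a::euclidean_space set \<Rightarrow> 'a \<times> 'a \<Rightarrow> 'a set \<Rightarrow> complex" where
  "chain_sum J g \<xi> q = (\<Sum>hs\<in>LC_chains q g \<xi>. (- 1) ^ (length hs - 1) * (\<Prod>(x, y)\<leftarrow>chain_pairs q hs. J x y))"

lemma chain_sum_self:
  assumes "convex g" "xi_const \<xi> g"
  shows "chain_sum J g \<xi> g = J g g"
proof -
  have "LC_chains g g \<xi> = {[g]}"
  proof (intro equalityI subsetI)
    fix hs assume hs: "hs \<in> LC_chains g g \<xi>"
    then obtain bs where bs: "hs = g # bs" by (cases hs) (auto simp: LC_chains_def)
    have False if "b \<in> set bs" for b
      using hs that face_of_imp_subset[of b g] by (auto simp: LC_chains_def bs)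
    then have "bs = []" by (cases bs) auto
    then show "hs \<in> {[g]}" using bs by simp
  qed (use assms in \<open>auto simp: LC_chains_def face_of_refl\<close>)
  then show ?thesis by (simp add: chain_sum_def)
qed

text \<open>Chains that end in \<open>q\<close> cancel against those that do not.\<close>

lemma chain_sum_xi_const:
  assumes q: "polytope q" "xi_const \<xi> q" "q \<noteq> g" and J: "J q q = 1"
  shows "chain_sum J g \<xi> q = 0"
proof -
  let ?snoc = "\<lambda>hs. hs @ [q]"
  let ?t = "\<lambda>hs. (- 1) ^ (length hs - 1) * (\<Prod>(x, y)\<leftarrow>chain_pairs q hs. J x y)"
  define A where "A = {hs \<in> LC_chains q g \<xi>. q \<notin> set hs}"
  have A: "hs \<noteq> []" if "hs \<in> A" for hs using that by (auto simp: A_def LC_chains_def)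
  have fin: "finite A" using finite_LC_chains[OF q(1)] by (simp add: A_def)
  have "LC_chains q g \<xi> = A \<union> ?snoc ` A"
  proof (intro equalityI subsetI)
    fix hs assume hs: "hs \<in> LC_chains q g \<xi>"
    show "hs \<in> A \<union> ?snoc ` A"
    proof (cases "q \<in> set hs")
      case True
      have s: "sorted_wrt (\<subset>) hs" "hs \<noteq> []" "hd hs = g" "\<And>h. h \<in> set hs \<Longrightarrow> h \<subseteq> q"
        using hs face_of_imp_subset by (auto simp: LC_chains_def)
      \<comment> \<open>All members of the chain are contained in q, so q can occur only at the
        end.\<close>
      have "last hs = q"
        by (rule subset_antisym[OF s(4)[OF last_in_set[OF s(2)]] sorted_wrt_psubset_last[OF s(1) True]])
      then have eq: "hs = butlast hs @ [q]" using s(2) by (metis append_butlast_last_id)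
      then have ne: "butlast hs \<noteq> []" using s(3) q(3) by (metis append_Nil list.sel(1))
      have "sorted_wrt (\<subset>) (butlast hs @ [q])" using s(1) eq by simp
      then have "q \<notin> set (butlast hs)" "sorted_wrt (\<subset>) (butlast hs)" by (auto simp: sorted_wrt_append)
      moreover have "hd (butlast hs) = g" using eq ne s(3) by (metis hd_append2)
      ultimately have "butlast hs \<in> A" using hs ne by (auto simp: A_def LC_chains_def dest: in_set_butlastD)
      then show ?thesis using eq by blast
    qed (use hs in \<open>simp add: A_def\<close>)
  next
    fix hs assume "hs \<in> A \<union> ?snoc ` A"
    then show "hs \<in> LC_chains q g \<xi>"
    proof
      assume "hs \<in> ?snoc ` A"
      then obtain bs where bs: "bs \<in> A" "hs = bs @ [q]" by blast
      have "\<forall>h\<in>set bs. h \<subset> q" using bs(1) face_of_imp_subset by (fastforce simp: A_def LC_chains_def)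
      then show ?thesis using bs q by (auto simp: A_def LC_chains_def sorted_wrt_append face_of_refl polytope_imp_convex)
    qed (simp add: A_def)
  qed
  moreover have "A \<inter> ?snoc ` A = {}" by (auto simp: A_def)
  ultimately have "chain_sum J g \<xi> q = sum ?t A + sum ?t (?snoc ` A)"
    unfolding chain_sum_def using fin by (simp add: sum.union_disjoint)
  also have "sum ?t (?snoc ` A) = (\<Sum>hs\<in>A. ?t (?snoc hs))"
    by (rule sum.reindex_cong[of ?snoc]) (auto simp: inj_on_def)
  also have "\<dots> = (\<Sum>hs\<in>A. - ?t hs)"
  proof (rule sum.cong[OF refl])
    fix hs assume "hs \<in> A"
    then have "hs \<noteq> []" by (rule A)
    then have "(- 1 :: complex) ^ (length (?snoc hs) - 1) = - ((- 1) ^ (length hs - 1))" by (cases hs) auto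
    then show "?t (?snoc hs) = - ?t hs"
      using \<open>hs \<noteq> []\<close> J by (simp add: chain_pairs_snoc)
  qed
  finally show ?thesis by (simp add: sum_negf)
qed

text \<open>Only the last factor of a chain involves q. With D and c independent of the last face f,
  Stokes' formula can be applied under the sum; exchanging the sums then collects, for each facet,
  the chains that lie in it.\<close>

lemma chain_sum_step:
  fixes q g :: "'a::euclidean_space set"
  assumes q: "polytope q"
    and stokes: "\<And>f. f face_of q \<Longrightarrow> g \<subseteq> f \<Longrightarrow> xi_const \<xi> f \<Longrightarrow>
      D * J f q = (\<Sum>q'\<in>facets_above f q. c q' * J f q')"
  shows "D * chain_sum J g \<xi> q = (\<Sum>q'\<in>facets_above g q. c q' * chain_sum J g \<xi> q')"
proof -
  let ?z = "\<lambda>hs. (- 1) ^ (length hs - 1) * (\<Prod>(x, y)\<leftarrow>zip hs (tl hs). J x y)"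
  have t: "(- 1) ^ (length hs - 1) * (\<Prod>(x, y)\<leftarrow>chain_pairs r hs. J x y) = ?z hs * J (last hs) r"
    if "hs \<noteq> []" for hs r using that by (simp add: chain_pairs_last)
  have fin: "finite (facets_above f q)" for f by (rule finite_facets_above[OF q])
  have finC: "finite (LC_chains q g \<xi>)" by (rule finite_LC_chains[OF q])
  have ne: "hs \<noteq> []" and last: "last hs face_of q" "g \<subseteq> last hs" "xi_const \<xi> (last hs)"
    if "hs \<in> LC_chains q g \<xi>" for hs
    using that sorted_wrt_psubset_hd[of hs "last hs"] by (auto simp: LC_chains_def)
  \<comment> \<open>Chains increase, so it suffices to test the last member; faces of q inside q'
    are the faces of q'.\<close>
  have sub: "{hs \<in> LC_chains q g \<xi>. last hs \<subseteq> q'} = LC_chains q' g \<xi>" if q': "q' \<in> facets_above g q" for q'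
  proof -
    have face: "q' face_of q" using q' by (auto simp: facets_above_def facet_of_def)
    show ?thesis
    proof (intro equalityI subsetI)
      fix hs assume "hs \<in> {hs \<in> LC_chains q g \<xi>. last hs \<subseteq> q'}"
      then have hs: "hs \<in> LC_chains q g \<xi>" "last hs \<subseteq> q'" by auto
      then have "h \<subseteq> q'" if "h \<in> set hs" for h
        using sorted_wrt_psubset_last[of hs h] that by (auto simp: LC_chains_def)
      then show "hs \<in> LC_chains q' g \<xi>" using hs by (auto simp: LC_chains_def face_of_face[OF face])
    next
      fix hs assume hs: "hs \<in> LC_chains q' g \<xi>"
      then have "last hs face_of q'" by (auto simp: LC_chains_def)
      then show "hs \<in> {hs \<in> LC_chains q g \<xi>. last hs \<subseteq> q'}"
        using hs face_of_imp_subset by (auto simp: LC_chains_def face_of_face[OF face])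
    qed
  qed
  have "D * chain_sum J g \<xi> q = (\<Sum>hs\<in>LC_chains q g \<xi>. ?z hs * (D * J (last hs) q))"
    unfolding chain_sum_def sum_distrib_left
  proof (rule sum.cong[OF refl])
    fix hs assume "hs \<in> LC_chains q g \<xi>"
    from t[OF ne[OF this], of q]
    show "D * ((- 1) ^ (length hs - 1) * (\<Prod>(x, y)\<leftarrow>chain_pairs q hs. J x y)) = ?z hs * (D * J (last hs) q)"
      by (simp only: mult.left_commute[of D])
  qed
  also have "\<dots> = (\<Sum>hs\<in>LC_chains q g \<xi>. \<Sum>q'\<in>facets_above g q. if last hs \<subseteq> q' then ?z hs * (c q' * J (last hs) q') else 0)"
  proof (rule sum.cong[OF refl])
    fix hs assume hs: "hs \<in> LC_chains q g \<xi>"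
    have "facets_above (last hs) q = {q' \<in> facets_above g q. last hs \<subseteq> q'}"
      using last(2)[OF hs] by (auto simp: facets_above_def)
    then have "?z hs * (D * J (last hs) q) = (\<Sum>q'\<in>{q' \<in> facets_above g q. last hs \<subseteq> q'}. ?z hs * (c q' * J (last hs) q'))"
      unfolding stokes[OF last[OF hs]] sum_distrib_left by (rule arg_cong)
    then show "?z hs * (D * J (last hs) q) = (\<Sum>q'\<in>facets_above g q. if last hs \<subseteq> q' then ?z hs * (c q' * J (last hs) q') else 0)"
      by (simp only: sum.inter_filter[OF fin])
  qed
  also have "\<dots> = (\<Sum>q'\<in>facets_above g q. \<Sum>hs\<in>LC_chains q g \<xi>. if last hs \<subseteq> q' then ?z hs * (c q' * J (last hs) q') else 0)"
    by (rule sum.swap)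
  also have "\<dots> = (\<Sum>q'\<in>facets_above g q. c q' * chain_sum J g \<xi> q')"
  proof (rule sum.cong[OF refl])
    fix q' assume q': "q' \<in> facets_above g q"
    have "(\<Sum>hs\<in>LC_chains q g \<xi>. if last hs \<subseteq> q' then ?z hs * (c q' * J (last hs) q') else 0)
        = (\<Sum>hs\<in>LC_chains q' g \<xi>. ?z hs * (c q' * J (last hs) q'))"
      using finC by (simp add: sum.inter_filter[symmetric] sub[OF q'])
    also have "\<dots> = c q' * chain_sum J g \<xi> q'"
      unfolding chain_sum_def sum_distrib_left
    proof (rule sum.cong[OF refl])
      fix hs assume "hs \<in> LC_chains q' g \<xi>"
      then have "hs \<noteq> []" by (auto simp: LC_chains_def)
      from t[OF this, of q'] show "?z hs * (c q' * J (last hs) q')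
          = c q' * ((- 1) ^ (length hs - 1) * (\<Prod>(x, y)\<leftarrow>chain_pairs q' hs. J x y))"
        by (simp only: mult.left_commute[of "c q'"])
    qed
    finally show "(\<Sum>hs\<in>LC_chains q g \<xi>. if last hs \<subseteq> q' then ?z hs * (c q' * J (last hs) q') else 0)
        = c q' * chain_sum J g \<xi> q'" .
  qed
  finally show ?thesis .
qed

text \<open>A purely algebraic comparison at a fixed \<open>\<alpha>\<close>, by induction on the
  dimension of q. All analysis enters through \<open>one\<close>, \<open>stokes\<close> and
  \<open>nz\<close>.\<close>

lemma chain_sum_eq_flag_sum:
  fixes p g :: "'a::euclidean_space set"
  assumes p: "polytope p" and g: "g face_of p" "g \<noteq> {}" "xi_const \<xi> g"
    and one: "\<And>f. f face_of p \<Longrightarrow> g \<subseteq> f \<Longrightarrow> J f f = 1"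
    and stokes: "\<And>f q. q face_of p \<Longrightarrow> f face_of q \<Longrightarrow> g \<subseteq> f \<Longrightarrow> xi_const \<xi> f \<Longrightarrow> \<not> xi_const \<xi> q \<Longrightarrow>
      d q * J f q = (\<Sum>q'\<in>facets_above f q. hpair \<xi> (onormal q q') * J f q')"
    and nz: "\<And>q. q face_of p \<Longrightarrow> g \<subseteq> q \<Longrightarrow> \<not> xi_const \<xi> q \<Longrightarrow> d q \<noteq> 0"
    and q: "q face_of p" "g \<subseteq> q"
  shows "chain_sum J g \<xi> q = flag_sum g \<xi> d q"
  using q
proof (induction "nat (aff_dim q)" arbitrary: q rule: less_induct)
  case less
  have poly: "polytope q" using p less.prems face_of_polytope_polytope by blast
  have gq: "g face_of q" using g(1) less.prems face_of_face by blast
  have cg: "convex g" using g(1) face_of_imp_convex by blast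
  consider "q = g" | "q \<noteq> g" "xi_const \<xi> q" | "\<not> xi_const \<xi> q" by blast
  then show ?case
  proof cases
    case 1
    then show ?thesis
      using chain_sum_self[OF cg g(3)] one[OF g(1)] sFl_self[OF cg, of \<xi>]
      by (simp add: flag_sum_def flag_term_def)
  next
    case 2
    then show ?thesis
      using chain_sum_xi_const[where J = J, OF poly 2(2,1) one[OF less.prems]] sFl_xi_const[OF 2(2,1)]
      by (simp add: flag_sum_def)
  next
    case 3
    have "d q * chain_sum J g \<xi> q = (\<Sum>q'\<in>facets_above g q. hpair \<xi> (onormal q q') * chain_sum J g \<xi> q')"
      by (rule chain_sum_step[OF poly]) (use stokes less.prems 3 in blast)
    also have "\<dots> = (\<Sum>q'\<in>facets_above g q. hpair \<xi> (onormal q q') * flag_sum g \<xi> d q')"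
    proof (rule sum.cong[OF refl])
      fix q' assume q': "q' \<in> facets_above g q"
      then have facet: "q' face_of q" "aff_dim q' = aff_dim q - 1" "g \<subseteq> q'"
        by (auto simp: facets_above_def facet_of_def)
      then have "aff_dim q' \<ge> 0"
        using g(2) aff_dim_geq[of q'] aff_dim_empty[of q'] by auto
      then have "chain_sum J g \<xi> q' = flag_sum g \<xi> d q'"
        by (intro less.hyps) (use facet face_of_trans less.prems in auto)
      then show "hpair \<xi> (onormal q q') * chain_sum J g \<xi> q' = hpair \<xi> (onormal q q') * flag_sum g \<xi> d q'" by simp
    qed
    finally have "chain_sum J g \<xi> q = (\<Sum>q'\<in>facets_above g q. hpair \<xi> (onormal q q') * flag_sum g \<xi> d q') / d q"
      using nz[OF less.prems 3] by (simp add: field_simps)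
    also have "\<dots> = flag_sum g \<xi> d q"
      unfolding flag_sum_step[OF poly gq g(2,3) 3] by (simp add: sum_divide_distrib)
    finally show ?thesis .
  qed
qed

text \<open>The pairing of \<open>\<alpha>\<close> with the orthogonal projection of \<open>\<xi>\<close>'s complex conjugate to \<open>lin h\<close>.\<close>

definition conj_pair :: "'a::euclidean_space \<times> 'a \<Rightarrow> 'a set \<Rightarrow> 'a \<times> 'a \<Rightarrow> complex" where
  "conj_pair \<xi> h \<alpha> = cpair \<alpha> (proj (lin h) (fst \<xi>)) - \<i> * cpair \<alpha> (proj (lin h) (snd \<xi>))"

lemma holo_on_conj_pair: "holo_on U (conj_pair \<xi> h)"
  unfolding conj_pair_def by (intro holo_on_diff holo_on_mult holo_on_const holo_on_cpair)

text \<open>The orthogonal projection is symmetric, so the two mixed terms, which make up the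
  imaginary part, cancel.\<close>

lemma conj_pair_self: "conj_pair \<xi> h \<xi> = of_real (restr_normsq \<xi> h)"
proof -
  let ?P = "proj (lin h)"
  have P: "?P x \<bullet> y = ?P x \<bullet> ?P y" for x y
    by (rule inner_proj[OF subspace_lin proj_in[OF subspace_lin], symmetric])
  have "fst \<xi> \<bullet> ?P (fst \<xi>) = (norm (?P (fst \<xi>)))\<^sup>2" "snd \<xi> \<bullet> ?P (snd \<xi>) = (norm (?P (snd \<xi>)))\<^sup>2"
    using P[of "fst \<xi>" "fst \<xi>"] P[of "snd \<xi>" "snd \<xi>"] by (simp_all add: inner_commute power2_norm_eq_inner)
  moreover have "snd \<xi> \<bullet> ?P (fst \<xi>) = fst \<xi> \<bullet> ?P (snd \<xi>)"
    using P[of "fst \<xi>" "snd \<xi>"] P[of "snd \<xi>" "fst \<xi>"] by (simp add: inner_commute)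
  ultimately show ?thesis
    by (simp add: conj_pair_def cpair_def restr_normsq_def complex_eq_iff)
qed

lemma xi_const_ocomp:
  assumes "xi_const \<xi> f" shows "fst \<xi> \<in> ocomp (lin f)" "snd \<xi> \<in> ocomp (lin f)"
proof -
  have eq: "x \<bullet> fst \<xi> = y \<bullet> fst \<xi>" "x \<bullet> snd \<xi> = y \<bullet> snd \<xi>" if "x \<in> f" "y \<in> f" for x y
  proof -
    have "cpair \<xi> x = cpair \<xi> y" using assms that unfolding xi_const_def by blast
    then show "x \<bullet> fst \<xi> = y \<bullet> fst \<xi>" "x \<bullet> snd \<xi> = y \<bullet> snd \<xi>"
      by (simp_all add: cpair_def inner_commute)
  qed
  show "fst \<xi> \<in> ocomp (lin f)"
  proof (rule in_ocomp_lin)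
    fix x y assume "x \<in> f" "y \<in> f"
    from eq(1)[OF this] show "(x - y) \<bullet> fst \<xi> = 0" by (simp add: inner_diff_left)
  qed
  show "snd \<xi> \<in> ocomp (lin f)"
  proof (rule in_ocomp_lin)
    fix x y assume "x \<in> f" "y \<in> f"
    from eq(2)[OF this] show "(x - y) \<bullet> snd \<xi> = 0" by (simp add: inner_diff_left)
  qed
qed

lemma restr_normsq_nonzero:
  assumes "\<not> xi_const \<xi> h" shows "restr_normsq \<xi> h \<noteq> 0"
proof
  assume "restr_normsq \<xi> h = 0"
  then have P: "proj (lin h) (fst \<xi>) = 0" "proj (lin h) (snd \<xi>) = 0"
    by (auto simp: restr_normsq_def sum_power2_eq_zero_iff)
  have "xi_const \<xi> h" unfolding xi_const_def
  proof (intro ballI)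
    fix x y assume "x \<in> h" "y \<in> h"
    then have "x - y \<in> lin h" by (rule diff_in_lin)
    then have "(x - y) \<bullet> fst \<xi> = 0" "(x - y) \<bullet> snd \<xi> = 0"
      using P inner_proj[OF subspace_lin] by (metis inner_zero_right)+
    then show "cpair \<xi> x = cpair \<xi> y" by (simp add: cpair_def inner_diff inner_commute)
  qed
  then show False using assms by simp
qed

text \<open>Stokes' formula for the projected real part minus i times the one for the projected
  imaginary part. The projections stay orthogonal to \<open>lin f\<close>, as f is
  \<open>\<xi>\<close>-constant and \<open>lin f\<close> lies in \<open>lin q\<close>; they do not
  change pairings with facet normals, which lie in \<open>lin q\<close>.\<close>

lemma conj_pair_stokes:
  assumes W: "subspace W" and fq: "face_pair f q" "lin_quot f q \<subseteq> W" and \<xi>: "xi_const \<xi> f" "\<not> xi_const \<xi> q"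
  shows "generically W (\<lambda>\<alpha>. conj_pair \<xi> q \<alpha> * face_mero W f q \<alpha>
           = (\<Sum>q'\<in>facets_above f q. hpair \<xi> (onormal q q') * face_mero W f q' \<alpha>))"
proof -
  interpret face_pair f q by fact
  let ?u = "proj (lin q) (fst \<xi>)" and ?v = "proj (lin q) (snd \<xi>)"
  have in_quot: "proj (lin q) x \<in> lin_quot f q" if "x \<in> ocomp (lin f)" for x
    using that lin_mono[OF subset] inner_proj[OF subspace_lin, of _ q x]
    by (auto simp: lin_quot_def proj_in[OF subspace_lin] ocomp_def subset_iff)
  have "f \<noteq> q" using \<xi> by auto
  note st = face_mero_stokes[OF W fq \<open>f \<noteq> q\<close> in_quot]
  have "generically W (\<lambda>\<alpha>. cpair \<alpha> ?u * face_mero W f q \<alpha>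
         = (\<Sum>q'\<in>facets_above f q. of_real (?u \<bullet> onormal q q') * face_mero W f q' \<alpha>) \<and>
       cpair \<alpha> ?v * face_mero W f q \<alpha>
         = (\<Sum>q'\<in>facets_above f q. of_real (?v \<bullet> onormal q q') * face_mero W f q' \<alpha>))"
    by (intro generically_conj st xi_const_ocomp \<xi>)
  then show ?thesis
  proof (rule generically_mono)
    fix \<alpha> assume *: "cpair \<alpha> ?u * face_mero W f q \<alpha>
         = (\<Sum>q'\<in>facets_above f q. of_real (?u \<bullet> onormal q q') * face_mero W f q' \<alpha>) \<and>
       cpair \<alpha> ?v * face_mero W f q \<alpha>
         = (\<Sum>q'\<in>facets_above f q. of_real (?v \<bullet> onormal q q') * face_mero W f q' \<alpha>)"
    have hp: "hpair \<xi> (onormal q q') = of_real (?u \<bullet> onormal q q') - \<i> * of_real (?v \<bullet> onormal q q')"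
      if "q' \<in> facets_above f q" for q'
    proof -
      have "onormal q q' \<in> lin q" by (rule onormal_in_lin[OF polyhedron facets_aboveD(1)[OF that]])
      then have "?u \<bullet> onormal q q' = fst \<xi> \<bullet> onormal q q'" "?v \<bullet> onormal q q' = snd \<xi> \<bullet> onormal q q'"
        by (metis inner_commute inner_proj subspace_lin)+
      then show ?thesis by (simp add: hpair_def complex_eq_iff)
    qed
    have "conj_pair \<xi> q \<alpha> * face_mero W f q \<alpha>
        = cpair \<alpha> ?u * face_mero W f q \<alpha> - \<i> * (cpair \<alpha> ?v * face_mero W f q \<alpha>)"
      by (simp add: conj_pair_def algebra_simps)
    also have "\<dots> = (\<Sum>q'\<in>facets_above f q. hpair \<xi> (onormal q q') * face_mero W f q' \<alpha>)"
      unfolding *[THEN conjunct1] *[THEN conjunct2] sum_distrib_left sum_subtractf[symmetric]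
      by (intro sum.cong refl) (simp add: hp algebra_simps)
    finally show "conj_pair \<xi> q \<alpha> * face_mero W f q \<alpha>
        = (\<Sum>q'\<in>facets_above f q. hpair \<xi> (onormal q q') * face_mero W f q' \<alpha>)" .
  qed
qed

lemma LC_chains_face_chain: "g \<noteq> {} \<Longrightarrow> hs \<in> LC_chains p g \<xi> \<Longrightarrow> face_chain p hs"
  using sorted_wrt_psubset_hd by (fastforce simp: LC_chains_def face_chain_def)

lemma lin_full_dim:
  fixes p :: "'a::euclidean_space set"
  assumes "aff_dim p = int DIM('a)" shows "lin p = UNIV"
proof -
  have "p \<noteq> {}" using assms by auto
  then have "dim (lin p) = DIM('a)" using dim_lin[of p] assms by simp
  then show ?thesis using dim_eq_full[of "lin p"] subspace_lin[of p] span_eq_iff[of "lin p"] by simp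
qed

text \<open>F and Z are any continuations of the single integrals with their polar sets. On the
  polar sets nothing is known about F, so holomorphy of the sum is expressed by a function G that is
  holomorphic near \<open>\<xi>\<close> and agrees with the sum off them.\<close>

theorem mainTheorem3:
  fixes p g :: "'a::euclidean_space set" and \<xi> :: "'a \<times> 'a"
    and F :: "'a set list \<Rightarrow> 'a \<times> 'a \<Rightarrow> complex"
    and Z :: "'a set list \<Rightarrow> ('a \<times> 'a) set"
  assumes "polytope p" and "aff_dim p = int DIM('a)"
    and "g face_of p" and "g \<noteq> {}" and "xi_const \<xi> g"
    and "\<forall>hs\<in>LC_chains p g \<xi>. is_mero_cont (ocomp (lin g)) (LC_cone p hs) (F hs) (Z hs)"
  shows "\<exists>U G. openin (top_of_set (cplx (ocomp (lin g)))) U \<and>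
           (proj (ocomp (lin g)) (fst \<xi>), proj (ocomp (lin g)) (snd \<xi>)) \<in> U \<and>
           holo_on U G \<and>
           (\<forall>\<alpha>\<in>U - (\<Union>hs\<in>LC_chains p g \<xi>. Z hs).
              G \<alpha> = (\<Sum>hs\<in>LC_chains p g \<xi>. (-1) ^ (length hs - 1) * F hs \<alpha>)) \<and>
           G (proj (ocomp (lin g)) (fst \<xi>), proj (ocomp (lin g)) (snd \<xi>)) = DBI0 p g \<xi>"
proof -
  define W where "W = ocomp (lin g)"
  note p = assms(1) and g = assms(3-5)
  have sW: "subspace W" by (simp add: W_def subspace_ocomp)
  have linp: "lin p = UNIV" by (rule lin_full_dim[OF assms(2)])
  have cp: "convex p" using p polytope_imp_convex by blast
  let ?X = "top_of_set (cplx W)"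
  let ?C = "LC_chains p g \<xi>"
  have finC: "finite ?C" by (rule finite_LC_chains[OF p])
  have \<xi>W: "fst \<xi> \<in> W" "snd \<xi> \<in> W" using xi_const_ocomp[OF g(3)] by (auto simp: W_def)
  \<comment> \<open>As g is \<open>\<xi>\<close>-constant, \<open>\<xi>\<close> already lies in the
    complexification of W, so the restriction changes nothing.\<close>
  then have \<xi>_eq: "(proj W (fst \<xi>), proj W (snd \<xi>)) = \<xi>" by (simp add: proj_id[OF sW])
  define N where "N = {q. q face_of p \<and> g \<subseteq> q \<and> \<not> xi_const \<xi> q}"
  have finN: "finite N"
    by (rule finite_subset[OF _ finite_polytope_faces[OF p]]) (auto simp: N_def)
  \<comment> \<open>Off the zeros of all possible denominators. At \<open>\<xi>\<close> these are
    the squared norms of the restrictions, nonzero on faces that are not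
    \<open>\<xi>\<close>-constant.\<close>
  define U where "U = {\<alpha> \<in> cplx W. \<forall>q\<in>N. conj_pair \<xi> q \<alpha> \<noteq> 0}"
  define G where "G \<alpha> = flag_sum g \<xi> (\<lambda>h. conj_pair \<xi> h \<alpha>) p" for \<alpha>
  have openU: "openin ?X U"
  proof -
    have "U = cplx W \<inter> (\<Inter>q\<in>N. - (conj_pair \<xi> q -` {0}))" by (auto simp: U_def)
    moreover have "open (- (conj_pair \<xi> q -` {0}))" for q
      by (intro open_Compl closed_vimage holo_on_imp_continuous_on holo_on_conj_pair) auto
    ultimately show ?thesis using finN by (simp add: openin_open_Int open_INT)
  qed
  have \<xi>U: "\<xi> \<in> U"
    using \<xi>W restr_normsq_nonzero[of \<xi>] by (auto simp: U_def cplx_def conj_pair_self N_def mem_Times_iff)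
  have holoG: "holo_on U G"
    unfolding G_def flag_sum_def flag_term_def
  proof (intro holo_on_sum holo_on_prod holo_on_divide holo_on_const holo_on_conj_pair)
    fix hs j \<alpha> assume hs: "hs \<in> sFl p g \<xi>" and j: "j \<in> {1..<length hs}" and \<alpha>: "\<alpha> \<in> U"
    have "hs ! 0 = g" using hs by (auto simp: sFl_def hd_conv_nth)
    moreover have "hs ! 0 \<subseteq> hs ! j" by (rule nth_mono_subset) (use hs j in \<open>auto simp: sFl_def\<close>)
    ultimately have "hs ! j \<in> N" using hs j by (auto simp: sFl_def N_def)
    then show "conj_pair \<xi> (hs ! j) \<alpha> \<noteq> 0" using \<alpha> by (simp add: U_def)
  qed
  have G\<xi>: "G \<xi> = DBI0 p g \<xi>" by (simp add: G_def DBI0_eq_flag_sum conj_pair_self)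
  have F: "is_mero_cont W (LC_cone p hs) (F hs) (Z hs)" if "hs \<in> ?C" for hs
    using assms(6) that by (simp add: W_def)
  have chain: "face_chain p hs" "hd hs = g" if "hs \<in> ?C" for hs
    using LC_chains_face_chain[OF g(2) that] that by (auto simp: LC_chains_def)
  have noline: "\<not> contains_line (LC_cone p hs)" if "hs \<in> ?C" for hs
    by (rule LC_cone_no_line[OF p linp chain(1)[OF that]])
  have fp: "face_pair f q" "lin_quot f q \<subseteq> W" if "q face_of p" "f face_of q" "g \<subseteq> f" for f q
    using that p g(2) face_of_polytope_polytope ocomp_mono[OF lin_mono[OF that(3)]]
    by (auto simp: face_pair_def lin_quot_def W_def)
  \<comment> \<open>All pairs for which the recursion needs Stokes' formula. Finiteness allows a
    single dense open set for all of them and for all chains.\<close>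
  define PQ where "PQ = {(f, q). q face_of p \<and> f face_of q \<and> g \<subseteq> f \<and> xi_const \<xi> f \<and> \<not> xi_const \<xi> q}"
  have finPQ: "finite PQ"
    by (rule finite_subset[OF _ finite_cartesian_product[OF finite_polytope_faces[OF p] finite_polytope_faces[OF p]]])
       (auto simp: PQ_def intro: face_of_trans)
  have "generically W (\<lambda>\<alpha>.
      (\<forall>z\<in>PQ. conj_pair \<xi> (snd z) \<alpha> * face_mero W (fst z) (snd z) \<alpha>
        = (\<Sum>q'\<in>facets_above (fst z) (snd z). hpair \<xi> (onormal (snd z) q') * face_mero W (fst z) q' \<alpha>)) \<and>
      (\<forall>hs\<in>?C. F hs \<alpha> = (\<Prod>(x, y)\<leftarrow>chain_pairs p hs. face_mero W x y \<alpha>)))"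
  proof (intro generically_conj generically_ball finPQ finC)
    fix z assume "z \<in> PQ"
    then show "generically W (\<lambda>\<alpha>. conj_pair \<xi> (snd z) \<alpha> * face_mero W (fst z) (snd z) \<alpha>
        = (\<Sum>q'\<in>facets_above (fst z) (snd z). hpair \<xi> (onormal (snd z) q') * face_mero W (fst z) q' \<alpha>))"
      by (intro conj_pair_stokes sW fp) (auto simp: PQ_def)
  next
    fix hs assume hs: "hs \<in> ?C"
    show "generically W (\<lambda>\<alpha>. F hs \<alpha> = (\<Prod>(x, y)\<leftarrow>chain_pairs p hs. face_mero W x y \<alpha>))"
      by (rule is_mero_cont_LC_cone_eq[OF p linp chain(1)[OF hs] _ F[OF hs]]) (simp add: W_def chain(2)[OF hs])
  qed
  then obtain D where D: "open_dense W D"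
    and stokes: "\<And>\<alpha> f q. \<alpha> \<in> D \<Longrightarrow> (f, q) \<in> PQ \<Longrightarrow> conj_pair \<xi> q \<alpha> * face_mero W f q \<alpha>
        = (\<Sum>q'\<in>facets_above f q. hpair \<xi> (onormal q q') * face_mero W f q' \<alpha>)"
    and F_eq: "\<And>\<alpha> hs. \<alpha> \<in> D \<Longrightarrow> hs \<in> ?C \<Longrightarrow> F hs \<alpha> = (\<Prod>(x, y)\<leftarrow>chain_pairs p hs. face_mero W x y \<alpha>)"
    unfolding generically_def by fastforce
  define S where "S \<alpha> = (\<Sum>hs\<in>?C. (-1) ^ (length hs - 1) * F hs \<alpha>)" for \<alpha>
  have S_eq: "S \<alpha> = G \<alpha>" if \<alpha>: "\<alpha> \<in> U" "\<alpha> \<in> D" for \<alpha>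
  proof -
    have "S \<alpha> = chain_sum (\<lambda>x y. face_mero W x y \<alpha>) g \<xi> p"
      unfolding S_def chain_sum_def by (intro sum.cong refl) (simp add: F_eq[OF \<alpha>(2)])
    also have "\<dots> = G \<alpha>"
      unfolding G_def
    proof (rule chain_sum_eq_flag_sum[OF p g])
      fix f assume "f face_of p" "g \<subseteq> f"
      then show "face_mero W f f \<alpha> = 1"
        by (intro face_mero_self[OF sW] fp) (auto intro: face_of_refl face_of_imp_convex)
    next
      fix f q assume "q face_of p" "f face_of q" "g \<subseteq> f" "xi_const \<xi> f" "\<not> xi_const \<xi> q"
      then show "conj_pair \<xi> q \<alpha> * face_mero W f q \<alpha>
          = (\<Sum>q'\<in>facets_above f q. hpair \<xi> (onormal q q') * face_mero W f q' \<alpha>)"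
        by (intro stokes[OF \<alpha>(2)]) (simp add: PQ_def)
    qed (use \<alpha>(1) g(1) cp face_of_imp_subset in \<open>auto simp: U_def N_def face_of_refl\<close>)
    finally show ?thesis .
  qed
  let ?Z = "\<Union>hs\<in>?C. Z hs"
  have "closedin ?X ?Z"
    using finC F noline by (intro closedin_Union) (auto simp: is_mero_cont_def)
  then have openUZ: "openin ?X (U - ?Z)" using openU by (rule openin_diff[rotated])
  have "continuous_on (U - ?Z) (F hs)" if "hs \<in> ?C" for hs
    by (rule continuous_on_subset[OF is_mero_cont_continuous_on[OF F[OF that] noline[OF that]]])
       (use that in \<open>auto simp: U_def\<close>)
  then have cont: "continuous_on (U - ?Z) (\<lambda>\<alpha>. G \<alpha> - S \<alpha>)"
    unfolding S_def
    by (intro continuous_intros continuous_on_subset[OF holo_on_imp_continuous_on[OF holoG]]) auto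
  \<comment> \<open>Equality is known on the dense set D; both sides are continuous on U minus the
    polar sets, which form a closed finite union.\<close>
  have "G \<alpha> = S \<alpha>" if "\<alpha> \<in> U - ?Z" for \<alpha>
    using open_dense_continuous_zero[OF D openUZ cont _ that] S_eq by simp
  then show ?thesis
    using openU \<xi>U holoG G\<xi> unfolding W_def[symmetric] \<xi>_eq S_def by blast
qed

end
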